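(* Let $G$ be a countable discrete group with 2-cocycle $c$. Suppose $S$ is maximal among abelian subgroups of $G$ on which $c$ is symmetric, and that $S$ is normal and immediately centralizing. Let $\Sigma$ denote the Weyl twist associated to the Cartan pair $(A,B)=(C^*_r(G,c),C^*_r(S,c))$, let $\alpha$ be the action of $G/S$ on $\widehat B$ given by $\alpha_{[g]}=\alpha_{\delta_g}$, and let $\mathcal{K}=(G/S)\,{}_\alpha\!\ltimes\widehat B$ be the transformation groupoid. Assume $\alpha$ is topologically free. Let $R(S)=\{r_{[g]}:[g]\in G/S\}$, $r_{[g]}\in[g]$, be any choice of coset representatives for $G/S$, and let $\sigma$ be the 2-cocycle on $\mathcal{K}$ given by $$\sigma\bigl(([g],\alpha_h(y)),([h],y)\bigr)=\frac{\bigl(\delta_{r_{[gh]}}^*\delta_{r_{[g]}}\delta_{r_{[h]}}\bigr)(y)}{\bigl|\bigl(\delta_{r_{[gh]}}^*\delta_{r_{[g]}}\delta_{r_{[h]}}\bigr)(y)\bigr|}.$$ Then the map $\psi([g],x,\lambda)=\llbracket\alpha_{[g]}(x),\lambda\delta_{r_{[g]}},x\rrbracket$ is a groupoid homomorphism from $\mathcal{K}\times_\sigma\mathbb{T}$ to $\Sigma$ which intertwines the actions of $\mathbb{T}$.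
   Context: 2-cocycles. A 2-cocycle on a group $G$ is $c:G\times G\to\mathbb{T}$ with $c(g,e)=c(e,g)=1$ and $c(g,hk)c(h,k)=c(gh,k)c(g,h)$; it is symmetric on $S$ if $c(s,t)=c(t,s)$ for all $s,t\in S$. A 2-cocycle on a groupoid $\mathcal{K}$ is $\sigma:\mathcal{K}^{(2)}\to\mathbb{T}$ (with $\mathcal{K}^{(2)}$ the set of composable pairs) such that $\sigma(\gamma,s(\gamma))=\sigma(r(\gamma),\gamma)=1$ and the same cocycle identity holds. $C^*_r(G,c)$ is the completion of $C_c(G)$, with $\delta_g\delta_h=c(g,h)\delta_{gh}$ and $\delta_g^*=\overline{c(g,g^{-1})}\delta_{g^{-1}}$, in the operator norm of its left regular representation on $\ell^2(G)$, $\delta_g\,e_h=c(g,h)e_{gh}$. $C^*_r(S,c)$ is viewed as the closure of $C_c(S)$ in $C^*_r(G,c)$. Immediately centralizing. $\nu\in G$ is $k$-centralizing for $S$ if for every $t\in S$ there is $j\in\{1,\dots,k\}$ with $\nu t^j=t^j\nu$; $S$ is immediately centralizing if for every $k\ge1$ each $k$-centralizing element is $1$-centralizing. Under the hypotheses on $G$, $S$, $c$ above, $(A,B)$ is a Cartan pair: $B$ is maximal abelian in $A$, is the range of a faithful conditional expectation, has normalizer $N(B)=\{n\in A:nbn^*,n^*bn\in B\ \forall b\in B\}$ generating $A$, and contains an approximate identity for $A$. Weyl twist. For a separable Cartan pair $(A,B)$ identify $B\cong C_0(\widehat B)$. For $n\in N(B)$ let $\mathrm{dom}(n)=\{x\in\widehat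 B:n^*n(x)>0\}$ and let $\alpha_n:\mathrm{dom}(n)\to\mathrm{dom}(n^* )$ be the unique homeomorphism with $n^*bn=(b\circ\alpha_n)\cdot n^*n$ for all $b\in B$. The Weyl twist $\Sigma=\Sigma_{(A,B)}$ is the groupoid of classes $\llbracket\alpha_n(x),n,x\rrbracket$ ($n\in N(B)$, $x\in\mathrm{dom}(n)$) under $(\alpha_n(x),n,x)\approx(\alpha_m(y),m,y)$ iff $x=y$ and there are $b,b'\in B$ with $b(x),b'(x)>0$ and $nb=mb'$, with multiplication $\llbracket\alpha_n(\alpha_m(x)),n,\alpha_m(x)\rrbracket\llbracket\alpha_m(x),m,x\rrbracket=\llbracket\alpha_{nm}(x),nm,x\rrbracket$ and $\mathbb{T}$-action $\lambda\cdot\llbracket\alpha_n(x),n,x\rrbracket=\llbracket\alpha_n(x),\lambda n,x\rrbracket$. In the group case, each $\delta_g$ is a unitary in $N(B)$, so $\alpha_g:=\alpha_{\delta_g}$ is a homeomorphism of $\widehat B$; it depends only on $[g]\in G/S$, and $[g]\mapsto\alpha_{[g]}:=\alpha_g$ is an action. It is topologically free if for every finite $F\subseteq(G/S)\setminus\{e\}$ the set $\{x\in\widehat B:\alpha_q(x)\ne x\ \forall q\in F\}$ is dense in $\widehat B$. $\mathcal{K}=(G/S)\times\widehat B$ with the product topology ($G/S$ discrete), $s([g],x)=x$, $r([g],x)=\alpha_g(x)$, $([g],\alpha_h(y))([h],y)=([gh],y)$. Note $\delta_{r_{[gh]}}^*\delta_{r_{[g]}}\delta_{r_{[h]}}\in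 B\cong C_0(\widehat B)$, so it can be evaluated at $y\in\widehat B$. $\mathcal{K}\times_\sigma\mathbb{T}$ is $\mathcal{K}\times\mathbb{T}$ with multiplication $(\gamma,t)(\eta,s)=(\gamma\eta,\sigma(\gamma,\eta)ts)$ and $\mathbb{T}$-action $\nu\cdot(\gamma,t)=(\gamma,\nu t)$. *)

theory Defs
  imports
    "HOL-Analysis.Analysis"
    "HOL-Algebra.Coset"
    "HOL-Algebra.Module"
    "HOL-Library.Complex_Order"
begin

section \<open>Circle-valued 2-cocycles and the hypotheses on the subgroup\<close>

abbreviation circle :: "complex set" where
  "circle \<equiv> sphere 0 1"

definition group_cocycle :: "('g, 'm) monoid_scheme \<Rightarrow> ('g \<Rightarrow> 'g \<Rightarrow> complex) \<Rightarrow> bool" where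
  "group_cocycle G c \<longleftrightarrow>
     (\<forall>g\<in>carrier G. \<forall>h\<in>carrier G. c g h \<in> circle) \<and>
     (\<forall>g\<in>carrier G. c g \<one>\<^bsub>G\<^esub> = 1 \<and> c \<one>\<^bsub>G\<^esub> g = 1) \<and>
     (\<forall>g\<in>carrier G. \<forall>h\<in>carrier G. \<forall>k\<in>carrier G.
        c g (h \<otimes>\<^bsub>G\<^esub> k) * c h k = c (g \<otimes>\<^bsub>G\<^esub> h) k * c g h)"

definition abelian_symmetric_subgroup ::
    "('g, 'm) monoid_scheme \<Rightarrow> ('g \<Rightarrow> 'g \<Rightarrow> complex) \<Rightarrow> 'g set \<Rightarrow> bool" where
  "abelian_symmetric_subgroup G c H \<longleftrightarrow>
     subgroup H G \<and>
     (\<forall>s\<in>H. \<forall>t\<in>H. s \<otimes>\<^bsub>G\<^esub> t = t \<otimes>\<^bsub>G\<^esub> s) \<and>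
     (\<forall>s\<in>H. \<forall>t\<in>H. c s t = c t s)"

definition maximal_abelian_symmetric ::
    "('g, 'm) monoid_scheme \<Rightarrow> ('g \<Rightarrow> 'g \<Rightarrow> complex) \<Rightarrow> 'g set \<Rightarrow> bool" where
  "maximal_abelian_symmetric G c S \<longleftrightarrow>
     abelian_symmetric_subgroup G c S \<and>
     (\<forall>H. abelian_symmetric_subgroup G c H \<and> S \<subseteq> H \<longrightarrow> H = S)"

definition centralizing :: "('g, 'm) monoid_scheme \<Rightarrow> 'g set \<Rightarrow> nat \<Rightarrow> 'g \<Rightarrow> bool" where
  "centralizing G S k \<nu> \<longleftrightarrow>
     (\<forall>t\<in>S. \<exists>j\<in>{1..k}. \<nu> \<otimes>\<^bsub>G\<^esub> (t [^]\<^bsub>G\<^esub> j) = (t [^]\<^bsub>G\<^esub> j) \<otimes>\<^bsub>G\<^esub> \<nu>)"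

definition immediately_centralizing :: "('g, 'm) monoid_scheme \<Rightarrow> 'g set \<Rightarrow> bool" where
  "immediately_centralizing G S \<longleftrightarrow>
     (\<forall>k\<ge>1. \<forall>\<nu>\<in>carrier G. centralizing G S k \<nu> \<longrightarrow> centralizing G S 1 \<nu>)"


section \<open>Bounded operators on \<open>\<ell>\<^sup>2\<close> of a set\<close>

text \<open>Vectors of \<open>\<ell>\<^sup>2(I)\<close> are functions on the ambient type that vanish off \<open>I\<close>; operators are
  functions on vectors that are extensional on \<open>\<ell>\<^sup>2(I)\<close>, so that equality of operators is
  equality of functions.\<close>

definition ell2 :: "'i set \<Rightarrow> ('i \<Rightarrow> complex) set" where
  "ell2 I = {f. (\<forall>i. i \<notin> I \<longrightarrow> f i = 0) \<and> (\<lambda>i. (cmod (f i))\<^sup>2) summable_on I}"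

definition l2_norm :: "('i \<Rightarrow> complex) \<Rightarrow> real" where
  "l2_norm f = sqrt (\<Sum>\<^sub>\<infinity>i. (cmod (f i))\<^sup>2)"

definition l2_inner :: "('i \<Rightarrow> complex) \<Rightarrow> ('i \<Rightarrow> complex) \<Rightarrow> complex" where
  "l2_inner f h = (\<Sum>\<^sub>\<infinity>i. cnj (f i) * h i)"

type_synonym 'i l2_op = "('i \<Rightarrow> complex) \<Rightarrow> ('i \<Rightarrow> complex)"

definition bounded_ops :: "'i set \<Rightarrow> 'i l2_op set" where
  "bounded_ops I = {T \<in> ell2 I \<rightarrow>\<^sub>E ell2 I.
     (\<forall>f\<in>ell2 I. \<forall>h\<in>ell2 I. T (\<lambda>i. f i + h i) = (\<lambda>i. T f i + T h i)) \<and>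
     (\<forall>z. \<forall>f\<in>ell2 I. T (\<lambda>i. z * f i) = (\<lambda>i. z * T f i)) \<and>
     (\<exists>C. \<forall>f\<in>ell2 I. l2_norm (T f) \<le> C * l2_norm f)}"

definition op_norm :: "'i set \<Rightarrow> 'i l2_op \<Rightarrow> real" where
  "op_norm I T = (SUP f\<in>{f \<in> ell2 I. l2_norm f \<le> 1}. l2_norm (T f))"

record 'a star_algebra = "(complex, 'a) module" +
  star :: "'a \<Rightarrow> 'a"

definition bounded_op_algebra :: "'i set \<Rightarrow> 'i l2_op star_algebra" where
  "bounded_op_algebra I =
     \<lparr> carrier = bounded_ops I,
       mult = compose (ell2 I),
       one = (\<lambda>f\<in>ell2 I. f),
       zero = (\<lambda>f\<in>ell2 I. \<lambda>i. 0),
       add = (\<lambda>T U. \<lambda>f\<in>ell2 I. \<lambda>i. T f i + U f i),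
       smult = (\<lambda>z T. \<lambda>f\<in>ell2 I. \<lambda>i. z * T f i),
       star = (\<lambda>T. THE U. U \<in> bounded_ops I \<and>
                 (\<forall>f\<in>ell2 I. \<forall>h\<in>ell2 I. l2_inner (U f) h = l2_inner f (T h))) \<rparr>"


section \<open>Twisted reduced group \<open>C\<^sup>*\<close>-algebras\<close>

text \<open>\<open>delta G c g\<close> is the operator with \<open>\<delta>\<^sub>g e\<^sub>h = c(g,h) e\<^bsub>gh\<^esub>\<close>, written out on a general vector.\<close>

definition delta :: "('g, 'm) monoid_scheme \<Rightarrow> ('g \<Rightarrow> 'g \<Rightarrow> complex) \<Rightarrow> 'g \<Rightarrow> 'g l2_op" where
  "delta G c g = (\<lambda>f\<in>ell2 (carrier G). \<lambda>k.
     if k \<in> carrier G then c g (inv\<^bsub>G\<^esub> g \<otimes>\<^bsub>G\<^esub> k) * f (inv\<^bsub>G\<^esub> g \<otimes>\<^bsub>G\<^esub> k) else 0)"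

definition Cc :: "'g set \<Rightarrow> ('g \<Rightarrow> complex) set" where
  "Cc H = {a. finite {h. a h \<noteq> 0} \<and> {h. a h \<noteq> 0} \<subseteq> H}"

definition regular_rep ::
    "('g, 'm) monoid_scheme \<Rightarrow> ('g \<Rightarrow> 'g \<Rightarrow> complex) \<Rightarrow> ('g \<Rightarrow> complex) \<Rightarrow> 'g l2_op" where
  "regular_rep G c a = (\<lambda>f\<in>ell2 (carrier G). \<lambda>k. \<Sum>h\<in>{h. a h \<noteq> 0}. a h * delta G c h f k)"

text \<open>The operator-norm closure of \<open>C\<^sub>c(H)\<close>. As the operators on \<open>\<ell>\<^sup>2(G)\<close> are norm complete, this is
  \<open>C\<^sup>*\<^sub>r(G,c)\<close> for \<open>H = G\<close>, and for a subgroup \<open>H\<close> it is \<open>C\<^sup>*\<^sub>r(H,c)\<close> inside \<open>C\<^sup>*\<^sub>r(G,c)\<close>.\<close>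

definition reduced_closure ::
    "('g, 'm) monoid_scheme \<Rightarrow> ('g \<Rightarrow> 'g \<Rightarrow> complex) \<Rightarrow> 'g set \<Rightarrow> 'g l2_op set" where
  "reduced_closure G c H = {T \<in> bounded_ops (carrier G).
     \<forall>\<epsilon>>0. \<exists>a\<in>Cc H. op_norm (carrier G) (\<lambda>f k. T f k - regular_rep G c a f k) < \<epsilon>}"

definition reduced_algebra ::
    "('g, 'm) monoid_scheme \<Rightarrow> ('g \<Rightarrow> 'g \<Rightarrow> complex) \<Rightarrow> 'g l2_op star_algebra" where
  "reduced_algebra G c =
     (bounded_op_algebra (carrier G)) \<lparr> carrier := reduced_closure G c (carrier G) \<rparr>"


section \<open>Groupoids\<close>

text \<open>Groupoids are algebraic here and given by their arrows, so units and inverses are determined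
  by the product. The value of \<open>gprod\<close> off the composable pairs is irrelevant.\<close>

record 'a groupoid_data =
  arrows :: "'a set"
  composable :: "('a \<times> 'a) set"
  gprod :: "'a \<Rightarrow> 'a \<Rightarrow> 'a"

definition is_groupoid :: "'a groupoid_data \<Rightarrow> bool" where
  "is_groupoid K \<longleftrightarrow>
     composable K \<subseteq> arrows K \<times> arrows K \<and>
     (\<forall>(\<gamma>, \<eta>)\<in>composable K. gprod K \<gamma> \<eta> \<in> arrows K) \<and>
     (\<forall>\<gamma> \<eta> \<zeta>. (\<gamma>, \<eta>) \<in> composable K \<and> (\<eta>, \<zeta>) \<in> composable K \<longrightarrow>
        (gprod K \<gamma> \<eta>, \<zeta>) \<in> composable K \<and> (\<gamma>, gprod K \<eta> \<zeta>) \<in> composable K \<and>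
        gprod K (gprod K \<gamma> \<eta>) \<zeta> = gprod K \<gamma> (gprod K \<eta> \<zeta>)) \<and>
     (\<exists>i. \<forall>\<gamma>\<in>arrows K. i \<gamma> \<in> arrows K \<and> i (i \<gamma>) = \<gamma> \<and> (\<gamma>, i \<gamma>) \<in> composable K \<and>
        (\<forall>\<eta>. (\<gamma>, \<eta>) \<in> composable K \<longrightarrow> gprod K (i \<gamma>) (gprod K \<gamma> \<eta>) = \<eta>) \<and>
        (\<forall>\<eta>. (\<eta>, \<gamma>) \<in> composable K \<longrightarrow> gprod K (gprod K \<eta> \<gamma>) (i \<gamma>) = \<eta>))"

definition groupoid_hom ::
    "'a groupoid_data \<Rightarrow> 'b groupoid_data \<Rightarrow> ('a \<Rightarrow> 'b) \<Rightarrow> bool" where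
  "groupoid_hom K L \<phi> \<longleftrightarrow>
     is_groupoid K \<and> is_groupoid L \<and> \<phi> \<in> arrows K \<rightarrow> arrows L \<and>
     (\<forall>(\<gamma>, \<eta>)\<in>composable K.
        (\<phi> \<gamma>, \<phi> \<eta>) \<in> composable L \<and> \<phi> (gprod K \<gamma> \<eta>) = gprod L (\<phi> \<gamma>) (\<phi> \<eta>))"

definition transformation_groupoid ::
    "('q, 'm) monoid_scheme \<Rightarrow> 'x set \<Rightarrow> ('q \<Rightarrow> 'x \<Rightarrow> 'x) \<Rightarrow> ('q \<times> 'x) groupoid_data" where
  "transformation_groupoid Q X act =
     \<lparr> arrows = carrier Q \<times> X,
       composable = {((p, z), (q, y)) | p z q y.
          p \<in> carrier Q \<and> q \<in> carrier Q \<and> z \<in> X \<and> y \<in> X \<and> z = act q y},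
       gprod = (\<lambda>(p, z) (q, y). (p \<otimes>\<^bsub>Q\<^esub> q, y)) \<rparr>"

definition twisted_groupoid ::
    "'a groupoid_data \<Rightarrow> ('a \<Rightarrow> 'a \<Rightarrow> complex) \<Rightarrow> ('a \<times> complex) groupoid_data" where
  "twisted_groupoid K \<sigma> =
     \<lparr> arrows = arrows K \<times> circle,
       composable = {((\<gamma>, t), (\<eta>, s)) | \<gamma> t \<eta> s.
          (\<gamma>, \<eta>) \<in> composable K \<and> t \<in> circle \<and> s \<in> circle},
       gprod = (\<lambda>(\<gamma>, t) (\<eta>, s). (gprod K \<gamma> \<eta>, \<sigma> \<gamma> \<eta> * t * s)) \<rparr>"

definition twisted_action :: "complex \<Rightarrow> 'a \<times> complex \<Rightarrow> 'a \<times> complex" where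
  "twisted_action \<nu> = (\<lambda>(\<gamma>, t). (\<gamma>, \<nu> * t))"


section \<open>The Weyl twist of a pair \<open>(A, B)\<close>\<close>

text \<open>Points of the Gelfand spectrum are the nonzero \<open>*\<close>-homomorphisms \<open>B \<rightarrow> \<complex>\<close>, extensional on \<open>B\<close>,
  with the topology of pointwise convergence. Under \<open>B \<cong> C\<^sub>0\<close> of the spectrum, the value \<open>b(x)\<close> is
  the function application \<open>x b\<close>.\<close>

definition spectrum :: "('a, 'm) star_algebra_scheme \<Rightarrow> 'a set \<Rightarrow> ('a \<Rightarrow> complex) set" where
  "spectrum A B = {x \<in> extensional B.
     (\<forall>a\<in>B. \<forall>b\<in>B. x (a \<oplus>\<^bsub>A\<^esub> b) = x a + x b \<and> x (a \<otimes>\<^bsub>A\<^esub> b) = x a * x b) \<and>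
     (\<forall>z. \<forall>b\<in>B. x (z \<odot>\<^bsub>A\<^esub> b) = z * x b) \<and>
     (\<forall>b\<in>B. x (star A b) = cnj (x b)) \<and>
     (\<exists>b\<in>B. x b \<noteq> 0)}"

definition spectrum_topology ::
    "('a, 'm) star_algebra_scheme \<Rightarrow> 'a set \<Rightarrow> ('a \<Rightarrow> complex) topology" where
  "spectrum_topology A B =
     subtopology (product_topology (\<lambda>_. euclidean) B) (spectrum A B)"

definition normalizers :: "('a, 'm) star_algebra_scheme \<Rightarrow> 'a set \<Rightarrow> 'a set" where
  "normalizers A B = {n \<in> carrier A. \<forall>b\<in>B.
     n \<otimes>\<^bsub>A\<^esub> b \<otimes>\<^bsub>A\<^esub> star A n \<in> B \<and> star A n \<otimes>\<^bsub>A\<^esub> b \<otimes>\<^bsub>A\<^esub> n \<in> B}"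

text \<open>The order on complex numbers is the one of \<open>Complex_Order\<close>: \<open>0 < z\<close> says that \<open>z\<close> is real and
  positive.\<close>

definition weyl_dom ::
    "('a, 'm) star_algebra_scheme \<Rightarrow> 'a set \<Rightarrow> 'a \<Rightarrow> ('a \<Rightarrow> complex) set" where
  "weyl_dom A B n = {x \<in> spectrum A B. 0 < x (star A n \<otimes>\<^bsub>A\<^esub> n)}"

definition weyl_map ::
    "('a, 'm) star_algebra_scheme \<Rightarrow> 'a set \<Rightarrow> 'a \<Rightarrow> ('a \<Rightarrow> complex) \<Rightarrow> ('a \<Rightarrow> complex)" where
  "weyl_map A B n = (THE \<alpha>.
     \<alpha> \<in> extensional (weyl_dom A B n) \<and>
     homeomorphic_map
       (subtopology (spectrum_topology A B) (weyl_dom A B n))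
       (subtopology (spectrum_topology A B) (weyl_dom A B (star A n))) \<alpha> \<and>
     (\<forall>b\<in>B. \<forall>x\<in>weyl_dom A B n.
        x (star A n \<otimes>\<^bsub>A\<^esub> b \<otimes>\<^bsub>A\<^esub> n) = \<alpha> x b * x (star A n \<otimes>\<^bsub>A\<^esub> n)))"

type_synonym 'a weyl_triple = "('a \<Rightarrow> complex) \<times> 'a \<times> ('a \<Rightarrow> complex)"

definition weyl_triples :: "('a, 'm) star_algebra_scheme \<Rightarrow> 'a set \<Rightarrow> 'a weyl_triple set" where
  "weyl_triples A B =
     {(weyl_map A B n x, n, x) | n x. n \<in> normalizers A B \<and> x \<in> weyl_dom A B n}"

definition weyl_rel ::
    "('a, 'm) star_algebra_scheme \<Rightarrow> 'a set \<Rightarrow> 'a weyl_triple rel" where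
  "weyl_rel A B = {((u, n, x), (v, m, y)) | u n x v m y.
     (u, n, x) \<in> weyl_triples A B \<and> (v, m, y) \<in> weyl_triples A B \<and> x = y \<and>
     (\<exists>b\<in>B. \<exists>b'\<in>B. 0 < x b \<and> 0 < x b' \<and> n \<otimes>\<^bsub>A\<^esub> b = m \<otimes>\<^bsub>A\<^esub> b')}"

definition weyl_class ::
    "('a, 'm) star_algebra_scheme \<Rightarrow> 'a set \<Rightarrow> 'a weyl_triple \<Rightarrow> 'a weyl_triple set" where
  "weyl_class A B \<tau> = weyl_rel A B `` {\<tau>}"

text \<open>\<open>weyl_product A B P Q R\<close>: the class \<open>R\<close> is the product of the classes \<open>P\<close> and \<open>Q\<close>, computed on
  some choice of representatives.\<close>

definition weyl_product ::
    "('a, 'm) star_algebra_scheme \<Rightarrow> 'a set \<Rightarrow>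
     'a weyl_triple set \<Rightarrow> 'a weyl_triple set \<Rightarrow> 'a weyl_triple set \<Rightarrow> bool" where
  "weyl_product A B P Q R \<longleftrightarrow>
     (\<exists>n\<in>normalizers A B. \<exists>m\<in>normalizers A B. \<exists>x\<in>weyl_dom A B m.
        weyl_map A B m x \<in> weyl_dom A B n \<and>
        P = weyl_class A B (weyl_map A B n (weyl_map A B m x), n, weyl_map A B m x) \<and>
        Q = weyl_class A B (weyl_map A B m x, m, x) \<and>
        R = weyl_class A B (weyl_map A B (n \<otimes>\<^bsub>A\<^esub> m) x, n \<otimes>\<^bsub>A\<^esub> m, x))"

definition weyl_twist ::
    "('a, 'm) star_algebra_scheme \<Rightarrow> 'a set \<Rightarrow> 'a weyl_triple set groupoid_data" where
  "weyl_twist A B =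
     \<lparr> arrows = weyl_triples A B // weyl_rel A B,
       composable = {(P, Q). \<exists>R. weyl_product A B P Q R},
       gprod = (\<lambda>P Q. THE R. weyl_product A B P Q R) \<rparr>"

definition weyl_action ::
    "('a, 'm) star_algebra_scheme \<Rightarrow> 'a set \<Rightarrow> complex \<Rightarrow>
     'a weyl_triple set \<Rightarrow> 'a weyl_triple set" where
  "weyl_action A B z P = (THE R. \<exists>n\<in>normalizers A B. \<exists>x\<in>weyl_dom A B n.
     P = weyl_class A B (weyl_map A B n x, n, x) \<and>
     R = weyl_class A B (weyl_map A B n x, z \<odot>\<^bsub>A\<^esub> n, x))"


section \<open>The pair \<open>(C\<^sup>*\<^sub>r(G,c), C\<^sup>*\<^sub>r(S,c))\<close>\<close>

text \<open>Elements of \<open>G Mod S\<close> are cosets \<open>q\<close>. The map \<open>\<alpha>\<^sub>g\<close> is the same for all \<open>g \<in> q\<close>.\<close>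

definition quotient_action ::
    "('g, 'm) monoid_scheme \<Rightarrow> ('g \<Rightarrow> 'g \<Rightarrow> complex) \<Rightarrow> 'g set \<Rightarrow>
     'g set \<Rightarrow> ('g l2_op \<Rightarrow> complex) \<Rightarrow> ('g l2_op \<Rightarrow> complex)" where
  "quotient_action G c S q = (THE \<alpha>. \<forall>g\<in>q.
     \<alpha> = weyl_map (reduced_algebra G c) (reduced_closure G c S) (delta G c g))"

definition topologically_free ::
    "('q, 'm) monoid_scheme \<Rightarrow> 'x topology \<Rightarrow> ('q \<Rightarrow> 'x \<Rightarrow> 'x) \<Rightarrow> bool" where
  "topologically_free Q X act \<longleftrightarrow>
     (\<forall>F. finite F \<and> F \<subseteq> carrier Q - {\<one>\<^bsub>Q\<^esub>} \<longrightarrow>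
        X closure_of {x \<in> topspace X. \<forall>q\<in>F. act q x \<noteq> x} = topspace X)"

definition quotient_groupoid ::
    "('g, 'm) monoid_scheme \<Rightarrow> ('g \<Rightarrow> 'g \<Rightarrow> complex) \<Rightarrow> 'g set \<Rightarrow>
     ('g set \<times> ('g l2_op \<Rightarrow> complex)) groupoid_data" where
  "quotient_groupoid G c S =
     transformation_groupoid (G Mod S)
       (spectrum (reduced_algebra G c) (reduced_closure G c S)) (quotient_action G c S)"

text \<open>Only \<open>y\<close> and the two cosets enter the formula for \<open>\<sigma>\<close>. It satisfies the cocycle identity for
  every choice \<open>r\<close> of representatives, but \<open>\<sigma>(\<gamma>, s(\<gamma>)) = \<sigma>(r(\<gamma>), \<gamma>) = 1\<close> in general only if the
  trivial coset is represented by the identity, which is not assumed.\<close>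

definition quotient_cocycle ::
    "('g, 'm) monoid_scheme \<Rightarrow> ('g \<Rightarrow> 'g \<Rightarrow> complex) \<Rightarrow> 'g set \<Rightarrow> ('g set \<Rightarrow> 'g) \<Rightarrow>
     'g set \<times> ('g l2_op \<Rightarrow> complex) \<Rightarrow> 'g set \<times> ('g l2_op \<Rightarrow> complex) \<Rightarrow> complex" where
  "quotient_cocycle G c S r = (\<lambda>(p, z) (q, y).
     let A = reduced_algebra G c;
         w = y (star A (delta G c (r (p \<otimes>\<^bsub>G Mod S\<^esub> q)))
                  \<otimes>\<^bsub>A\<^esub> delta G c (r p) \<otimes>\<^bsub>A\<^esub> delta G c (r q))
     in w / complex_of_real (cmod w))"

definition twist_map ::
    "('g, 'm) monoid_scheme \<Rightarrow> ('g \<Rightarrow> 'g \<Rightarrow> complex) \<Rightarrow> 'g set \<Rightarrow> ('g set \<Rightarrow> 'g) \<Rightarrow>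
     ('g set \<times> ('g l2_op \<Rightarrow> complex)) \<times> complex \<Rightarrow> 'g l2_op weyl_triple set" where
  "twist_map G c S r = (\<lambda>((q, x), t).
     let A = reduced_algebra G c
     in weyl_class A (reduced_closure G c S)
          (quotient_action G c S q x, t \<odot>\<^bsub>A\<^esub> delta G c (r q), x))"

end

theory Submission
  imports Defs
begin

text \<open>
  Since \<open>B\<close> is commutative and contains the unit, the Weyl twist can be treated algebraically: for a
  normalizer \<open>n\<close> and a character \<open>x\<close> with \<open>x(n\<^sup>*n) > 0\<close>, the map \<open>b \<mapsto> x(n\<^sup>*bn) / x(n\<^sup>*n)\<close> is again a
  character, and it is \<open>\<alpha>\<^sub>n(x)\<close>. Products and inverses of germs are well defined because the factors
  \<open>nn\<^sup>*\<close> and \<open>n\<^sup>*n\<close> lie in \<open>B\<close> and may be moved past each other.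

  The operators \<open>\<delta>\<^sub>g\<close> are unitary normalizers of \<open>B\<close>, and \<open>\<delta>\<^bsub>r(p)\<^esub> \<delta>\<^bsub>r(q)\<^esub> = \<delta>\<^bsub>r(pq)\<^esub> W(p,q)\<close> with \<open>W(p,q)\<close> a
  unitary of \<open>B\<close>, so that \<open>\<sigma>((p, \<alpha>\<^sub>q(y)), (q, y)) = y(W(p,q))\<close>. Associativity of the product gives the
  cocycle identity, and for a unitary \<open>w \<in> B\<close> the germ of \<open>nw\<close> at \<open>y\<close> is the germ of \<open>y(w) n\<close>, which
  is the homomorphism property.
\<close>

section \<open>The Weyl twist of a commutative unital subalgebra\<close>

text \<open>The star, the maps on the spectrum, the induced action, the product of germs and the
  circle action on germs are all given by definite descriptions. Each has to be identified with an
  explicit expression by existence and uniqueness before it can be used; for the star of an operator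
  this means constructing the adjoint. Two germs at a point are compared by exhibiting two elements
  of B that are positive there and stand to the right of the normalizers. No function on the
  spectrum is ever constructed. The work lies in finding these witnesses, and factors such as n* n
  are inserted to carry elements of B across a normalizer. Facts about the closure B are never
  proved on limits directly: the operators with a given property form a norm-closed subspace, so
  that checking the generators \<open>delta G c s\<close> is enough. Being a homomorphism includes
  that domain and target are groupoids, so inverses are needed on both sides. For germs they come
  from adjoints; in the domain they are computed by hand from the cocycle identity.\<close>

lemma complex_mult_pos: "0 < z \<Longrightarrow> 0 < w \<Longrightarrow> 0 < z * w" for z w :: complex
  by (auto simp: less_complex_def)

lemma complex_one_pos: "0 < (1::complex)"
  by (simp add: less_complex_def)

text \<open>No norm appears: the calculus of germs uses only identities in A and values of
  characters.\<close>

locale star_algebra_pair = monoid A for A :: "('a, 'm) star_algebra_scheme" (structure) +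
  fixes B :: "'a set"
  assumes star_closed [simp, intro]: "a \<in> carrier A \<Longrightarrow> star A a \<in> carrier A"
    and star_star [simp]: "a \<in> carrier A \<Longrightarrow> star A (star A a) = a"
    and star_mult: "a \<in> carrier A \<Longrightarrow> b \<in> carrier A \<Longrightarrow> star A (a \<otimes> b) = star A b \<otimes> star A a"
    and smult_closed [simp, intro]: "a \<in> carrier A \<Longrightarrow> z \<odot> a \<in> carrier A"
    and smult_mult: "a \<in> carrier A \<Longrightarrow> b \<in> carrier A \<Longrightarrow> (z \<odot> a) \<otimes> b = z \<odot> (a \<otimes> b)"
    and mult_smult: "a \<in> carrier A \<Longrightarrow> b \<in> carrier A \<Longrightarrow> a \<otimes> (z \<odot> b) = z \<odot> (a \<otimes> b)"
    and smult_smult: "a \<in> carrier A \<Longrightarrow> z \<odot> (w \<odot> a) = (z * w) \<odot> a"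
    and one_smult: "a \<in> carrier A \<Longrightarrow> 1 \<odot> a = a"
    and star_smult: "a \<in> carrier A \<Longrightarrow> star A (z \<odot> a) = cnj z \<odot> star A a"
    and add_closed [simp, intro]: "a \<in> carrier A \<Longrightarrow> b \<in> carrier A \<Longrightarrow> a \<oplus> b \<in> carrier A"
    and distrib_left: "a \<in> carrier A \<Longrightarrow> b \<in> carrier A \<Longrightarrow> d \<in> carrier A \<Longrightarrow>
          a \<otimes> (b \<oplus> d) = a \<otimes> b \<oplus> a \<otimes> d"
    and distrib_right: "a \<in> carrier A \<Longrightarrow> b \<in> carrier A \<Longrightarrow> d \<in> carrier A \<Longrightarrow>
          (a \<oplus> b) \<otimes> d = a \<otimes> d \<oplus> b \<otimes> d"
    and sub_carrier: "B \<subseteq> carrier A"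
    and sub_one [simp, intro]: "\<one> \<in> B"
    and sub_mult [simp, intro]: "a \<in> B \<Longrightarrow> b \<in> B \<Longrightarrow> a \<otimes> b \<in> B"
    and sub_add [simp, intro]: "a \<in> B \<Longrightarrow> b \<in> B \<Longrightarrow> a \<oplus> b \<in> B"
    and sub_smult [simp, intro]: "a \<in> B \<Longrightarrow> z \<odot> a \<in> B"
    and sub_star [simp, intro]: "a \<in> B \<Longrightarrow> star A a \<in> B"
    and sub_comm: "a \<in> B \<Longrightarrow> b \<in> B \<Longrightarrow> a \<otimes> b = b \<otimes> a"
begin

abbreviation adjoint :: "'a \<Rightarrow> 'a" (\<open>_\<^sup>\<star>\<close> [1000] 1000) where "a\<^sup>\<star> \<equiv> star A a"
abbreviation X where "X \<equiv> spectrum A B"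
abbreviation N where "N \<equiv> normalizers A B"
abbreviation dom where "dom \<equiv> weyl_dom A B"

lemma sub_closed [simp, intro]: "b \<in> B \<Longrightarrow> b \<in> carrier A"
  using sub_carrier by blast

lemma sub_lcomm: "a \<in> B \<Longrightarrow> b \<in> B \<Longrightarrow> d \<in> carrier A \<Longrightarrow> a \<otimes> (b \<otimes> d) = b \<otimes> (a \<otimes> d)"
  by (metis m_assoc sub_closed sub_comm)

subsection \<open>Characters and normalizers\<close>

lemma character_mult: "x \<in> X \<Longrightarrow> a \<in> B \<Longrightarrow> b \<in> B \<Longrightarrow> x (a \<otimes> b) = x a * x b"
  and character_add: "x \<in> X \<Longrightarrow> a \<in> B \<Longrightarrow> b \<in> B \<Longrightarrow> x (a \<oplus> b) = x a + x b"
  and character_smult: "x \<in> X \<Longrightarrow> a \<in> B \<Longrightarrow> x (z \<odot> a) = z * x a"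
  and character_star: "x \<in> X \<Longrightarrow> a \<in> B \<Longrightarrow> x (a\<^sup>\<star>) = cnj (x a)"
  and character_extensional: "x \<in> X \<Longrightarrow> x \<in> extensional B"
  by (auto simp: spectrum_def)

lemma character_one: assumes "x \<in> X" shows "x \<one> = 1"
proof -
  obtain b where "b \<in> B" "x b \<noteq> 0" using assms by (auto simp: spectrum_def)
  then show ?thesis using character_mult[OF assms, of b \<one>] by simp
qed

lemma star_one [simp]: "\<one>\<^sup>\<star> = \<one>"
  by (metis l_one one_closed r_one star_closed star_mult star_star)

lemma normalizer_closed: "n \<in> N \<Longrightarrow> n \<in> carrier A"
  by (simp add: normalizers_def)

text \<open>Brackets are moved to the right, the normal form under \<open>m_assoc\<close>, so that
  conjugates keep a matching shape after rewriting by associativity.\<close>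

lemma normalizer_conj: "n \<in> N \<Longrightarrow> b \<in> B \<Longrightarrow> n\<^sup>\<star> \<otimes> (b \<otimes> n) \<in> B"
  using m_assoc[of "n\<^sup>\<star>" b n] by (auto simp: normalizers_def)

lemma normalizer_conj': "n \<in> N \<Longrightarrow> b \<in> B \<Longrightarrow> n \<otimes> (b \<otimes> n\<^sup>\<star>) \<in> B"
  using m_assoc[of n b "n\<^sup>\<star>"] by (auto simp: normalizers_def)

lemma normalizerI:
  assumes "n \<in> carrier A"
    and "\<And>b. b \<in> B \<Longrightarrow> n\<^sup>\<star> \<otimes> (b \<otimes> n) \<in> B"
    and "\<And>b. b \<in> B \<Longrightarrow> n \<otimes> (b \<otimes> n\<^sup>\<star>) \<in> B"
  shows "n \<in> N"
  unfolding normalizers_def using assms m_assoc[of n _ "n\<^sup>\<star>"] m_assoc[of "n\<^sup>\<star>" _ n]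
  by simp

declare normalizer_closed [simp, intro]

lemma normalizer_star [simp, intro]: "n \<in> N \<Longrightarrow> n\<^sup>\<star> \<in> N"
  using normalizer_conj normalizer_conj' by (intro normalizerI) (simp_all del: sub_mult)

lemma normalizer_mult [simp, intro]: assumes "n \<in> N" "m \<in> N" shows "n \<otimes> m \<in> N"
proof -
  have "(n \<otimes> m)\<^sup>\<star> \<otimes> (b \<otimes> (n \<otimes> m)) = m\<^sup>\<star> \<otimes> ((n\<^sup>\<star> \<otimes> (b \<otimes> n)) \<otimes> m)"
       "(n \<otimes> m) \<otimes> (b \<otimes> (n \<otimes> m)\<^sup>\<star>) = n \<otimes> ((m \<otimes> (b \<otimes> m\<^sup>\<star>)) \<otimes> n\<^sup>\<star>)" if "b \<in> B" for b
    using assms that by (simp_all add: star_mult m_assoc)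
  then show ?thesis
    using assms by (intro normalizerI) (simp_all add: normalizer_conj normalizer_conj')
qed

lemma normalizer_smult [simp, intro]: assumes "n \<in> N" shows "z \<odot> n \<in> N"
proof -
  have "(z \<odot> n)\<^sup>\<star> \<otimes> (b \<otimes> (z \<odot> n)) = (cnj z * z) \<odot> (n\<^sup>\<star> \<otimes> (b \<otimes> n))"
       "(z \<odot> n) \<otimes> (b \<otimes> (z \<odot> n)\<^sup>\<star>) = (z * cnj z) \<odot> (n \<otimes> (b \<otimes> n\<^sup>\<star>))" if "b \<in> B" for b
    using assms that by (simp_all add: star_smult smult_mult mult_smult smult_smult mult.commute)
  then show ?thesis
    using assms by (intro normalizerI) (simp_all add: normalizer_conj normalizer_conj')
qed

lemma normalizer_star_mult [simp, intro]: "n \<in> N \<Longrightarrow> n\<^sup>\<star> \<otimes> n \<in> B"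
  using normalizer_conj[of n \<one>] by simp

lemma normalizer_mult_star [simp, intro]: "n \<in> N \<Longrightarrow> n \<otimes> n\<^sup>\<star> \<in> B"
  using normalizer_conj'[of n \<one>] by simp

lemma dom_character: "x \<in> dom n \<Longrightarrow> x \<in> X"
  and dom_pos: "x \<in> dom n \<Longrightarrow> 0 < x (n\<^sup>\<star> \<otimes> n)"
  by (auto simp: weyl_dom_def)

lemma dom_nonzero: "x \<in> dom n \<Longrightarrow> x (n\<^sup>\<star> \<otimes> n) \<noteq> 0"
  using dom_pos by fastforce

subsection \<open>The partial homeomorphism of a normalizer\<close>

text \<open>The formula is total, with junk values off \<open>dom n\<close>. Some of its identities
  then need no domain condition; \<open>weyl_map_eq\<close> restricts it afterwards.\<close>

definition move :: "'a \<Rightarrow> ('a \<Rightarrow> complex) \<Rightarrow> 'a \<Rightarrow> complex" where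
  "move n x = (\<lambda>b\<in>B. x (n\<^sup>\<star> \<otimes> (b \<otimes> n)) / x (n\<^sup>\<star> \<otimes> n))"

lemma move_apply: "b \<in> B \<Longrightarrow> x \<in> dom n \<Longrightarrow> x (n\<^sup>\<star> \<otimes> (b \<otimes> n)) = move n x b * x (n\<^sup>\<star> \<otimes> n)"
  using dom_nonzero by (simp add: move_def)

text \<open>As n n* lies in B it commutes with a, so n* a n n* b n = n* n n* a b n. Evaluated at x
  this is multiplicativity of \<open>move n x\<close> with the denominators cleared.\<close>

lemma conj_mult:
  assumes "n \<in> N" "a \<in> B" "b \<in> B"
  shows "(n\<^sup>\<star> \<otimes> (a \<otimes> n)) \<otimes> (n\<^sup>\<star> \<otimes> (b \<otimes> n)) = (n\<^sup>\<star> \<otimes> n) \<otimes> (n\<^sup>\<star> \<otimes> ((a \<otimes> b) \<otimes> n))"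
proof -
  have "a \<otimes> (n \<otimes> n\<^sup>\<star>) = (n \<otimes> n\<^sup>\<star>) \<otimes> a" using assms sub_comm by blast
  then have "n\<^sup>\<star> \<otimes> ((a \<otimes> (n \<otimes> n\<^sup>\<star>)) \<otimes> (b \<otimes> n)) = n\<^sup>\<star> \<otimes> (((n \<otimes> n\<^sup>\<star>) \<otimes> a) \<otimes> (b \<otimes> n))" by simp
  then show ?thesis using assms by (simp add: m_assoc)
qed

lemma move_character:
  assumes n: "n \<in> N" and x: "x \<in> dom n" shows "move n x \<in> X"
proof -
  note X = dom_character[OF x] and nz = dom_nonzero[OF x] and cj = normalizer_conj[OF n]
  have mult: "move n x (a \<otimes> b) = move n x a * move n x b" if "a \<in> B" "b \<in> B" for a b
  proof -
    have "x (n\<^sup>\<star> \<otimes> (a \<otimes> n)) * x (n\<^sup>\<star> \<otimes> (b \<otimes> n)) = x (n\<^sup>\<star> \<otimes> n) * x (n\<^sup>\<star> \<otimes> ((a \<otimes> b) \<otimes> n))"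
      using that n cj character_mult[OF X] conj_mult[OF n that] by (metis normalizer_star_mult sub_mult)
    then show ?thesis using that nz by (simp add: move_def divide_simps mult.commute)
  qed
  have add: "move n x (a \<oplus> b) = move n x a + move n x b" if "a \<in> B" "b \<in> B" for a b
    using that n cj by (simp add: move_def distrib_left distrib_right character_add[OF X] add_divide_distrib)
  have smult: "move n x (z \<odot> b) = z * move n x b" if "b \<in> B" for z b
    using that n cj by (simp add: move_def smult_mult mult_smult character_smult[OF X])
  \<comment> \<open>n* n is self-adjoint, so the denominator is real and complex conjugation passes
    through the quotient.\<close>
  have real: "cnj (x (n\<^sup>\<star> \<otimes> n)) = x (n\<^sup>\<star> \<otimes> n)"
    using character_star[OF X normalizer_star_mult[OF n]] n by (simp add: star_mult)
  have st: "move n x (b\<^sup>\<star>) = cnj (move n x b)" if "b \<in> B" for b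
  proof -
    have "(n\<^sup>\<star> \<otimes> (b \<otimes> n))\<^sup>\<star> = n\<^sup>\<star> \<otimes> (b\<^sup>\<star> \<otimes> n)" using that n by (simp add: star_mult m_assoc)
    then show ?thesis using that character_star[OF X cj[OF that]] by (simp add: move_def real)
  qed
  have "move n x \<one> = 1" using n nz by (simp add: move_def)
  then have "\<exists>b\<in>B. move n x b \<noteq> 0" by (intro bexI[of _ \<one>]) auto
  with mult add smult st show ?thesis
    by (auto simp: spectrum_def) (simp add: move_def)
qed

text \<open>n* n n* n is the square of n* n, and one factor cancels against the denominator.\<close>

lemma move_dom_star:
  assumes n: "n \<in> N" and x: "x \<in> dom n"
  shows "move n x \<in> dom (n\<^sup>\<star>)" and "move n x (n \<otimes> n\<^sup>\<star>) = x (n\<^sup>\<star> \<otimes> n)"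
proof -
  have "x (n\<^sup>\<star> \<otimes> ((n \<otimes> n\<^sup>\<star>) \<otimes> n)) = x (n\<^sup>\<star> \<otimes> n) * x (n\<^sup>\<star> \<otimes> n)"
    using character_mult[OF dom_character[OF x], of "n\<^sup>\<star> \<otimes> n" "n\<^sup>\<star> \<otimes> n"] n by (simp add: m_assoc)
  then show *: "move n x (n \<otimes> n\<^sup>\<star>) = x (n\<^sup>\<star> \<otimes> n)"
    using n dom_nonzero[OF x] by (simp add: move_def)
  show "move n x \<in> dom (n\<^sup>\<star>)"
    using n * dom_pos[OF x] move_character[OF n x] by (simp add: weyl_dom_def)
qed

text \<open>n* n b n* n has the value x(b) x(n* n)^2 at x. Both quotients have denominator x(n* n),
  the second one by \<open>move_dom_star\<close>.\<close>

lemma move_star_move: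
  assumes n: "n \<in> N" and x: "x \<in> dom n" shows "move (n\<^sup>\<star>) (move n x) = x"
proof (rule extensionalityI[of _ B])
  fix b assume b: "b \<in> B"
  have "x (n\<^sup>\<star> \<otimes> ((n \<otimes> (b \<otimes> n\<^sup>\<star>)) \<otimes> n)) = x (n\<^sup>\<star> \<otimes> n) * x b * x (n\<^sup>\<star> \<otimes> n)"
    using character_mult[OF dom_character[OF x], of "n\<^sup>\<star> \<otimes> n" "b \<otimes> (n\<^sup>\<star> \<otimes> n)"]
      character_mult[OF dom_character[OF x], of b "n\<^sup>\<star> \<otimes> n"] n b by (simp add: m_assoc)
  then have "move n x (n \<otimes> (b \<otimes> n\<^sup>\<star>)) = x b * x (n\<^sup>\<star> \<otimes> n)"
    using n b dom_nonzero[OF x] normalizer_conj' by (simp add: move_def)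
  then show "move (n\<^sup>\<star>) (move n x) b = x b"
    using n b dom_nonzero[OF x] move_dom_star(2)[OF n x] by (simp add: move_def[of "n\<^sup>\<star>"])
qed (use character_extensional[OF dom_character[OF x]] in \<open>simp_all add: move_def\<close>)

text \<open>Characters are extensional on B, hence lie in the carrier of the product
  topology.\<close>

lemma topspace_spectrum_dom:
  "topspace (subtopology (spectrum_topology A B) (dom n)) = dom n"
  using character_extensional dom_character[of _ n]
  by (fastforce simp: spectrum_topology_def PiE_def)

text \<open>For pointwise convergence one coordinate at a time suffices, and each is a quotient of
  two evaluations. The denominator is nonzero on \<open>dom n\<close> but may vanish elsewhere,
  hence the pointwise argument with \<open>atin\<close> inside the subspace.\<close>

lemma continuous_map_move:
  assumes n: "n \<in> N"
  shows "continuous_map (subtopology (spectrum_topology A B) (dom n))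
           (subtopology (spectrum_topology A B) (dom (n\<^sup>\<star>))) (move n)"
proof -
  let ?T = "subtopology (spectrum_topology A B) (dom n)"
  have ev: "continuous_map ?T euclidean (\<lambda>x. x b)" if "b \<in> B" for b
    unfolding spectrum_topology_def
    by (intro continuous_map_from_subtopology continuous_map_product_projection that)
  have "continuous_map ?T euclidean (\<lambda>x. move n x b)" if b: "b \<in> B" for b
  proof -
    have "continuous_map ?T euclidean (\<lambda>x. x (n\<^sup>\<star> \<otimes> (b \<otimes> n)) / x (n\<^sup>\<star> \<otimes> n))"
      unfolding continuous_map_atin
    proof (rule ballI)
      fix x assume x: "x \<in> topspace ?T"
      then have "x (n\<^sup>\<star> \<otimes> n) \<noteq> 0" using topspace_spectrum_dom dom_nonzero by blast
      moreover have "limitin euclidean (\<lambda>x. x (n\<^sup>\<star> \<otimes> (b \<otimes> n))) (x (n\<^sup>\<star> \<otimes> (b \<otimes> n))) (atin ?T x)"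
           "limitin euclidean (\<lambda>x. x (n\<^sup>\<star> \<otimes> n)) (x (n\<^sup>\<star> \<otimes> n)) (atin ?T x)"
        using ev[OF normalizer_conj[OF n b]] ev[OF normalizer_star_mult[OF n]] x
        unfolding continuous_map_atin by blast+
      ultimately show "limitin euclidean (\<lambda>x. x (n\<^sup>\<star> \<otimes> (b \<otimes> n)) / x (n\<^sup>\<star> \<otimes> n))
           (x (n\<^sup>\<star> \<otimes> (b \<otimes> n)) / x (n\<^sup>\<star> \<otimes> n)) (atin ?T x)"
        using tendsto_divide by fastforce
    qed
    then show ?thesis using b by (simp add: move_def)
  qed
  then have "continuous_map ?T (product_topology (\<lambda>_. euclidean) B) (move n)"
    by (auto simp: continuous_map_componentwise move_def)
  then show ?thesis
    using move_dom_star(1)[OF n] move_character[OF n]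
    unfolding spectrum_topology_def
    by (auto simp: continuous_map_in_subtopology Pi_iff dest: dom_character)
qed

text \<open>The map of the adjoint is a continuous two-sided inverse, which gives the
  homeomorphism.\<close>

lemma weyl_map_eq:
  assumes n: "n \<in> N" shows "weyl_map A B n = restrict (move n) (dom n)"
proof -
  let ?T = "\<lambda>n. subtopology (spectrum_topology A B) (dom n)"
  have nn: "(n\<^sup>\<star>)\<^sup>\<star> = n" using n by simp
  have "homeomorphic_maps (?T n) (?T (n\<^sup>\<star>)) (move n) (move (n\<^sup>\<star>))"
    using continuous_map_move[OF n] continuous_map_move[OF normalizer_star[OF n]]
      move_star_move[OF n] move_star_move[OF normalizer_star[OF n]]
    unfolding homeomorphic_maps_def topspace_spectrum_dom nn by auto
  then have "homeomorphic_map (?T n) (?T (n\<^sup>\<star>)) (move n)"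
    using homeomorphic_maps_map by blast
  then have hom: "homeomorphic_map (?T n) (?T (n\<^sup>\<star>)) (restrict (move n) (dom n))"
    by (rule homeomorphic_map_eq) (use topspace_spectrum_dom in auto)
  show ?thesis unfolding weyl_map_def
  proof (rule the_equality, intro conjI hom)
    fix \<alpha>
    assume a: "\<alpha> \<in> extensional (dom n) \<and> homeomorphic_map (?T n) (?T (n\<^sup>\<star>)) \<alpha> \<and>
      (\<forall>b\<in>B. \<forall>x\<in>dom n. x (n\<^sup>\<star> \<otimes> b \<otimes> n) = \<alpha> x b * x (n\<^sup>\<star> \<otimes> n))"
    show "\<alpha> = restrict (move n) (dom n)"
    proof (rule extensionalityI[of _ "dom n"])
      fix x assume x: "x \<in> dom n"
      \<comment> \<open>The defining equation fixes a competitor only on B. Surjectivity onto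
        \<open>dom (n\<^sup>\<star>)\<close> makes its values characters, hence extensional, and
        thereby determined.\<close>
      have "\<alpha> ` dom n = dom (n\<^sup>\<star>)"
        using a homeomorphic_imp_surjective_map[of "?T n" "?T (n\<^sup>\<star>)" \<alpha>]
        by (simp only: topspace_spectrum_dom)
      then have "\<alpha> x \<in> extensional B" using x dom_character character_extensional by blast
      moreover have "\<alpha> x b = move n x b" if "b \<in> B" for b
        using bspec[OF bspec[OF conjunct2[OF conjunct2[OF a]] that] x] that n dom_nonzero[OF x]
        by (simp add: move_def m_assoc)
      ultimately have "\<alpha> x = move n x"
        by (intro extensionalityI[of _ B]) (simp_all add: move_def)
      then show "\<alpha> x = restrict (move n) (dom n) x" using x by simp
    qed (use a in auto)
  qed (use n move_apply in \<open>auto simp: m_assoc\<close>)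
qed

lemma weyl_map_apply [simp]: "n \<in> N \<Longrightarrow> x \<in> dom n \<Longrightarrow> weyl_map A B n x = move n x"
  by (simp add: weyl_map_eq)

text \<open>Evaluating m* n* b n m at x is evaluating n* b n at the point to which m moves x, up to
  the factor x(m* m). The case b = 1 gives the denominator, where the same factor cancels.\<close>

lemma move_mult:
  assumes "n \<in> N" "m \<in> N" and x: "x \<in> dom m" and y: "move m x \<in> dom n"
  shows "x \<in> dom (n \<otimes> m)" and "move (n \<otimes> m) x = move n (move m x)"
proof -
  have eq: "(n \<otimes> m)\<^sup>\<star> \<otimes> (b \<otimes> (n \<otimes> m)) = m\<^sup>\<star> \<otimes> ((n\<^sup>\<star> \<otimes> (b \<otimes> n)) \<otimes> m)" if "b \<in> B" for b
    using assms that by (simp add: star_mult m_assoc)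
  have val: "x ((n \<otimes> m)\<^sup>\<star> \<otimes> (b \<otimes> (n \<otimes> m))) = move m x (n\<^sup>\<star> \<otimes> (b \<otimes> n)) * x (m\<^sup>\<star> \<otimes> m)" if "b \<in> B" for b
    unfolding eq[OF that] using move_apply[OF normalizer_conj x] assms that by blast
  have val1: "x ((n \<otimes> m)\<^sup>\<star> \<otimes> (n \<otimes> m)) = move m x (n\<^sup>\<star> \<otimes> n) * x (m\<^sup>\<star> \<otimes> m)"
    using val[of \<one>] assms by simp
  show "x \<in> dom (n \<otimes> m)"
    using val1 dom_pos[OF x] dom_pos[OF y] dom_character[OF x]
    unfolding weyl_dom_def by (auto intro: complex_mult_pos)
  show "move (n \<otimes> m) x = move n (move m x)"
    unfolding move_def[of "n \<otimes> m"] move_def[of n]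
    by (rule restrict_ext) (use dom_nonzero[OF x] val val1 in simp)
qed

text \<open>Conjugating any d in B by the common element nb = mb' yields |x(b)|^2 x(n* d n) =
  |x(b')|^2 x(m* d m). Dividing by the case d = 1 removes both factors.\<close>

lemma move_eqI:
  assumes n: "n \<in> N" "x \<in> dom n" and m: "m \<in> N" "x \<in> dom m"
    and b: "b \<in> B" "b' \<in> B" "0 < x b" "0 < x b'" and eq: "n \<otimes> b = m \<otimes> b'"
  shows "move n x = move m x"
proof -
  note X = dom_character[OF n(2)]
  have val: "x (b\<^sup>\<star> \<otimes> ((n\<^sup>\<star> \<otimes> (d \<otimes> n)) \<otimes> b)) = cnj (x b) * x b * x (n\<^sup>\<star> \<otimes> (d \<otimes> n))"
    if "b \<in> B" "n \<in> N" "d \<in> B" for b n d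
    using that normalizer_conj[OF that(2,3)] character_mult[OF X] character_star[OF X] by simp
  have eq2: "b\<^sup>\<star> \<otimes> ((n\<^sup>\<star> \<otimes> (d \<otimes> n)) \<otimes> b) = b'\<^sup>\<star> \<otimes> ((m\<^sup>\<star> \<otimes> (d \<otimes> m)) \<otimes> b')" if d: "d \<in> B" for d
  proof -
    have "(n \<otimes> b)\<^sup>\<star> \<otimes> (d \<otimes> (n \<otimes> b)) = (m \<otimes> b')\<^sup>\<star> \<otimes> (d \<otimes> (m \<otimes> b'))" by (simp add: eq)
    then show ?thesis using n m b d by (simp add: star_mult m_assoc)
  qed
  have key: "cnj (x b) * x b * x (n\<^sup>\<star> \<otimes> (d \<otimes> n)) = cnj (x b') * x b' * x (m\<^sup>\<star> \<otimes> (d \<otimes> m))" if "d \<in> B" for d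
    using val[of b n d] val[of b' m d] eq2[OF that] n m b that by simp
  have nz: "cnj (x b) * x b \<noteq> 0" "cnj (x b') * x b' \<noteq> 0" using b by auto
  have "x (n\<^sup>\<star> \<otimes> (d \<otimes> n)) / x (n\<^sup>\<star> \<otimes> n) = x (m\<^sup>\<star> \<otimes> (d \<otimes> m)) / x (m\<^sup>\<star> \<otimes> m)" if d: "d \<in> B" for d
  proof -
    have "x (n\<^sup>\<star> \<otimes> (d \<otimes> n)) / x (n\<^sup>\<star> \<otimes> n) = (cnj (x b) * x b * x (n\<^sup>\<star> \<otimes> (d \<otimes> n))) / (cnj (x b) * x b * x (n\<^sup>\<star> \<otimes> n))"
      by (rule mult_divide_mult_cancel_left[OF nz(1), symmetric])
    also have "\<dots> = (cnj (x b') * x b' * x (m\<^sup>\<star> \<otimes> (d \<otimes> m))) / (cnj (x b') * x b' * x (m\<^sup>\<star> \<otimes> m))"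
      using key[OF d] key[OF sub_one] n m by simp
    also have "\<dots> = x (m\<^sup>\<star> \<otimes> (d \<otimes> m)) / x (m\<^sup>\<star> \<otimes> m)"
      by (rule mult_divide_mult_cancel_left[OF nz(2)])
    finally show ?thesis .
  qed
  then show ?thesis unfolding move_def by (intro restrict_ext)
qed

subsection \<open>Germs of normalizers\<close>

text \<open>The germ relation at a fixed point without the range component, which is determined by
  the rest (\<open>agree_move\<close>).\<close>

definition agree :: "'a \<Rightarrow> 'a \<Rightarrow> ('a \<Rightarrow> complex) \<Rightarrow> bool" where
  "agree n m x \<longleftrightarrow> (\<exists>b\<in>B. \<exists>b'\<in>B. 0 < x b \<and> 0 < x b' \<and> n \<otimes> b = m \<otimes> b')"

lemma agree_refl: "x \<in> X \<Longrightarrow> agree n n x"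
  unfolding agree_def by (intro bexI[of _ \<one>]) (auto simp: character_one complex_one_pos)

lemma agree_sym: "agree n m x \<Longrightarrow> agree m n x"
  unfolding agree_def by metis

text \<open>Given nb = mb' and md = ld', multiply the first by d and the second by b'; the middle
  terms agree because B is commutative.\<close>

lemma agree_trans:
  assumes "x \<in> X" "n \<in> N" "m \<in> N" "l \<in> N" "agree n m x" "agree m l x"
  shows "agree n l x"
proof -
  obtain b b' where b: "b \<in> B" "b' \<in> B" "0 < x b" "0 < x b'" "n \<otimes> b = m \<otimes> b'"
    using assms by (auto simp: agree_def)
  obtain d d' where d: "d \<in> B" "d' \<in> B" "0 < x d" "0 < x d'" "m \<otimes> d = l \<otimes> d'"
    using assms by (auto simp: agree_def)
  have "n \<otimes> (b \<otimes> d) = (n \<otimes> b) \<otimes> d" using assms b(1,2) d(1,2) by (simp add: m_assoc)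
  also have "\<dots> = m \<otimes> (b' \<otimes> d)" unfolding b(5) using assms b(1,2) d(1,2) by (simp add: m_assoc)
  also have "\<dots> = (m \<otimes> d) \<otimes> b'" using assms b(1,2) d(1,2) sub_comm[of b' d] by (simp add: m_assoc)
  also have "\<dots> = l \<otimes> (d' \<otimes> b')" unfolding d(5) using assms b(1,2) d(1,2) by (simp add: m_assoc)
  finally have "n \<otimes> (b \<otimes> d) = l \<otimes> (d' \<otimes> b')" .
  moreover have "0 < x (b \<otimes> d)" "0 < x (d' \<otimes> b')"
    using b d assms(1) by (auto simp: character_mult intro: complex_mult_pos)
  moreover have "b \<otimes> d \<in> B" "d' \<otimes> b' \<in> B" using b d by auto
  ultimately show ?thesis unfolding agree_def by blast
qed

lemma weyl_rel_iff:
  "(\<tau>, \<tau>') \<in> weyl_rel A B \<longleftrightarrow>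
     (\<exists>n m x. n \<in> N \<and> m \<in> N \<and> x \<in> dom n \<and> x \<in> dom m \<and> agree n m x \<and>
       \<tau> = (move n x, n, x) \<and> \<tau>' = (move m x, m, x))"
proof -
  have triple: "(u, n, x) \<in> weyl_triples A B \<longleftrightarrow> n \<in> N \<and> x \<in> dom n \<and> u = move n x" for u n x
    by (auto simp: weyl_triples_def)
  obtain u n x v m y where \<tau>: "\<tau> = (u, n, x)" "\<tau>' = (v, m, y)" by (metis prod_cases3)
  have "(\<tau>, \<tau>') \<in> weyl_rel A B \<longleftrightarrow>
      (u, n, x) \<in> weyl_triples A B \<and> (v, m, y) \<in> weyl_triples A B \<and> x = y \<and> agree n m x"
    unfolding weyl_rel_def agree_def \<tau> by (cases "x = y") auto
  then show ?thesis unfolding triple \<tau> by auto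
qed

lemma equiv_weyl_rel: "equiv (weyl_triples A B) (weyl_rel A B)"
proof (rule equivI)
  show "weyl_rel A B \<subseteq> weyl_triples A B \<times> weyl_triples A B"
    by (auto simp: weyl_rel_def)
  show "refl_on (weyl_triples A B) (weyl_rel A B)"
  proof (rule refl_onI)
    fix \<tau> assume "\<tau> \<in> weyl_triples A B"
    then obtain n x where t: "n \<in> N" "x \<in> dom n" "\<tau> = (move n x, n, x)"
      by (auto simp: weyl_triples_def)
    then have "agree n n x" using agree_refl dom_character by blast
    then show "(\<tau>, \<tau>) \<in> weyl_rel A B" unfolding weyl_rel_iff using t by blast
  qed
  show "sym (weyl_rel A B)"
  proof (rule symI)
    fix \<tau> \<tau>' assume "(\<tau>, \<tau>') \<in> weyl_rel A B"
    then obtain n m x where "n \<in> N" "m \<in> N" "x \<in> dom n" "x \<in> dom m" "agree n m x"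
        "\<tau> = (move n x, n, x)" "\<tau>' = (move m x, m, x)"
      unfolding weyl_rel_iff by blast
    then show "(\<tau>', \<tau>) \<in> weyl_rel A B" unfolding weyl_rel_iff using agree_sym by metis
  qed
  show "trans (weyl_rel A B)"
  proof (rule transI)
    fix \<tau> \<tau>' \<tau>'' assume r: "(\<tau>, \<tau>') \<in> weyl_rel A B" "(\<tau>', \<tau>'') \<in> weyl_rel A B"
    obtain n m x where 1: "n \<in> N" "m \<in> N" "x \<in> dom n" "x \<in> dom m" "agree n m x"
        "\<tau> = (move n x, n, x)" "\<tau>' = (move m x, m, x)"
      using r(1) unfolding weyl_rel_iff by blast
    obtain m' l y where 2: "l \<in> N" "y \<in> dom l" "agree m' l y"
        "\<tau>' = (move m' y, m', y)" "\<tau>'' = (move l y, l, y)"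
      using r(2) unfolding weyl_rel_iff by blast
    have eq: "m' = m" "y = x" using 1(7) 2(4) by auto
    have "agree n l x" using agree_trans[of x n m l] dom_character[OF 1(3)] 1 2 unfolding eq by blast
    then show "(\<tau>, \<tau>'') \<in> weyl_rel A B"
      unfolding weyl_rel_iff using 1(1,3,6) 2(1,2,5) unfolding eq by blast
  qed
qed

definition germ :: "'a \<Rightarrow> ('a \<Rightarrow> complex) \<Rightarrow> 'a weyl_triple set" where
  "germ n x = weyl_class A B (weyl_map A B n x, n, x)"

lemma germ_eq_iff:
  assumes "n \<in> N" "x \<in> dom n" "m \<in> N" "y \<in> dom m"
  shows "germ n x = germ m y \<longleftrightarrow> x = y \<and> agree n m x"
proof -
  have "germ n x = germ m y \<longleftrightarrow> ((move n x, n, x), (move m y, m, y)) \<in> weyl_rel A B"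
    unfolding weyl_class_def germ_def using assms
    by (subst eq_equiv_class_iff[OF equiv_weyl_rel]) (auto simp: weyl_triples_def)
  then show ?thesis using assms unfolding weyl_rel_iff by auto
qed

lemma agree_move: "n \<in> N \<Longrightarrow> m \<in> N \<Longrightarrow> x \<in> dom n \<Longrightarrow> x \<in> dom m \<Longrightarrow> agree n m x \<Longrightarrow> move n x = move m x"
  unfolding agree_def using move_eqI by blast

text \<open>The witness b for n has to pass to the right of m. Conjugation does this at the cost of
  a factor from B: m times m* b m is f b m with f = m m*.\<close>

lemma agree_mult:
  assumes N: "n \<in> N" "n' \<in> N" "m \<in> N" "m' \<in> N"
    and x: "x \<in> dom m" "x \<in> dom m'" and m: "agree m m' x" and n: "agree n n' (move m x)"
  shows "agree (n \<otimes> m) (n' \<otimes> m') x"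
proof -
  obtain b b' where b: "b \<in> B" "b' \<in> B" "0 < move m x b" "0 < move m x b'" "n \<otimes> b = n' \<otimes> b'"
    using n by (auto simp: agree_def)
  obtain d d' where d: "d \<in> B" "d' \<in> B" "0 < x d" "0 < x d'" "m \<otimes> d = m' \<otimes> d'"
    using m by (auto simp: agree_def)
  have mv: "move m x = move m' x" by (rule agree_move) (use assms in auto)
  let ?f = "m \<otimes> m\<^sup>\<star>" and ?f' = "m' \<otimes> m'\<^sup>\<star>"
  \<comment> \<open>The two sides produce different factors f and f'. Putting f' into the first
    witness and f into the second makes both products equal to n b f f' m d, since elements of B
    commute.\<close>
  let ?e = "(m\<^sup>\<star> \<otimes> ((b \<otimes> ?f') \<otimes> m)) \<otimes> d" and ?e' = "(m'\<^sup>\<star> \<otimes> ((b' \<otimes> ?f) \<otimes> m')) \<otimes> d'"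
  have f: "?f \<in> B" "?f' \<in> B" using N by auto
  have "(n \<otimes> m) \<otimes> ?e = n \<otimes> ((?f \<otimes> (b \<otimes> ?f')) \<otimes> (m \<otimes> d))"
    using N b(1,2) d(1,2) by (simp add: m_assoc)
  also have "?f \<otimes> (b \<otimes> ?f') = b \<otimes> (?f \<otimes> ?f')" using f b by (intro sub_lcomm) auto
  also have "n \<otimes> ((b \<otimes> (?f \<otimes> ?f')) \<otimes> (m \<otimes> d)) = (n \<otimes> b) \<otimes> ((?f \<otimes> ?f') \<otimes> (m \<otimes> d))"
    using N b(1,2) d(1,2) by (simp add: m_assoc)
  also have "\<dots> = n' \<otimes> ((b' \<otimes> (?f \<otimes> ?f')) \<otimes> (m' \<otimes> d'))"
    unfolding b(5) d(5) using N b(1,2) d(1,2) by (simp add: m_assoc)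
  also have "b' \<otimes> (?f \<otimes> ?f') = ?f' \<otimes> (b' \<otimes> ?f)"
    using f b by (metis m_assoc sub_closed sub_comm sub_mult)
  also have "n' \<otimes> ((?f' \<otimes> (b' \<otimes> ?f)) \<otimes> (m' \<otimes> d')) = (n' \<otimes> m') \<otimes> ?e'"
    using N b(1,2) d(1,2) by (simp add: m_assoc)
  finally have eq: "(n \<otimes> m) \<otimes> ?e = (n' \<otimes> m') \<otimes> ?e'" .
  \<comment> \<open>The value of the witness is a product of x(d), x(m* m) and the values of b and
    m' m'* at the moved point. The last one is x(m'* m'), because m and m' move x to the same
    point.\<close>
  have val: "0 < x ((m\<^sup>\<star> \<otimes> ((b \<otimes> (m' \<otimes> m'\<^sup>\<star>)) \<otimes> m)) \<otimes> d)"
    if "m \<in> N" "m' \<in> N" "x \<in> dom m" "x \<in> dom m'" "move m x = move m' x" "b \<in> B" "d \<in> B" "0 < x d" "0 < move m x b"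
    for m m' b d
  proof -
    have X: "x \<in> X" using that dom_character by blast
    have "0 < move m x b * move m x (m' \<otimes> m'\<^sup>\<star>)"
      using that move_dom_star(2)[of m' x] dom_pos[of x m'] by (auto intro: complex_mult_pos)
    then have "0 < x (m\<^sup>\<star> \<otimes> ((b \<otimes> (m' \<otimes> m'\<^sup>\<star>)) \<otimes> m))"
      using that move_apply[of "b \<otimes> (m' \<otimes> m'\<^sup>\<star>)" x m] dom_pos[of x m]
        character_mult[OF move_character[of m x], of b "m' \<otimes> m'\<^sup>\<star>"]
      by (auto intro: complex_mult_pos)
    then show ?thesis using character_mult[OF X normalizer_conj[of m "b \<otimes> (m' \<otimes> m'\<^sup>\<star>)"], of d] that
      by (auto intro: complex_mult_pos)
  qed
  have "?e \<in> B" "?e' \<in> B"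
    using b d f N by (auto intro!: sub_mult[OF _ d(1)] sub_mult[OF _ d(2)] normalizer_conj)
  moreover have "0 < x ?e" "0 < x ?e'"
    using val[of m m' b d] val[of m' m b' d'] N x b d mv by auto
  ultimately show ?thesis using eq unfolding agree_def by blast
qed

text \<open>The adjoint of nb = mb' is b* n* = b'* m*, with the elements of B on the wrong side;
  conjugation by n and m brings them to the right.\<close>

lemma agree_star:
  assumes N: "n \<in> N" "m \<in> N" and x: "x \<in> dom n" "x \<in> dom m" and a: "agree n m x"
  shows "agree (n\<^sup>\<star>) (m\<^sup>\<star>) (move n x)"
proof -
  obtain b b' where b: "b \<in> B" "b' \<in> B" "0 < x b" "0 < x b'" "n \<otimes> b = m \<otimes> b'"
    using a by (auto simp: agree_def)
  have X: "x \<in> X" using x dom_character by blast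
  have mv: "move n x = move m x" by (rule agree_move) (use assms in auto)
  have adj: "b\<^sup>\<star> \<otimes> n\<^sup>\<star> = b'\<^sup>\<star> \<otimes> m\<^sup>\<star>"
    using arg_cong[OF b(5), of "star A"] N b(1,2) by (simp add: star_mult)
  \<comment> \<open>n* e = n* n b* n* m m* = h m* m m*, and h commutes with m* m, so this equals m*
    m h m* = m* e'. The factor m m* in e is there to make this commutation possible.\<close>
  let ?h = "(n\<^sup>\<star> \<otimes> n) \<otimes> b'\<^sup>\<star>"
  let ?e = "(n \<otimes> (b\<^sup>\<star> \<otimes> n\<^sup>\<star>)) \<otimes> (m \<otimes> m\<^sup>\<star>)" and ?e' = "m \<otimes> (?h \<otimes> m\<^sup>\<star>)"
  have h: "?h \<in> B" using N b by auto
  have "n\<^sup>\<star> \<otimes> ?e = ((n\<^sup>\<star> \<otimes> n) \<otimes> (b\<^sup>\<star> \<otimes> n\<^sup>\<star>)) \<otimes> (m \<otimes> m\<^sup>\<star>)"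
    using N b(1,2) by (simp add: m_assoc)
  also have "\<dots> = (?h \<otimes> (m\<^sup>\<star> \<otimes> m)) \<otimes> m\<^sup>\<star>"
    unfolding adj using N b(1,2) by (simp add: m_assoc)
  also have "?h \<otimes> (m\<^sup>\<star> \<otimes> m) = (m\<^sup>\<star> \<otimes> m) \<otimes> ?h" using h N by (intro sub_comm) auto
  also have "((m\<^sup>\<star> \<otimes> m) \<otimes> ?h) \<otimes> m\<^sup>\<star> = m\<^sup>\<star> \<otimes> ?e'" using N b(1,2) by (simp add: m_assoc)
  finally have eq: "n\<^sup>\<star> \<otimes> ?e = m\<^sup>\<star> \<otimes> ?e'" .
  \<comment> \<open>The adjoint of m carries the moved point back to x, and its denominator there is
    x(m* m).\<close>
  have val: "move m x (m \<otimes> (d \<otimes> m\<^sup>\<star>)) = x d * x (m\<^sup>\<star> \<otimes> m)" if "m \<in> N" "x \<in> dom m" "d \<in> B" for m d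
    using move_apply[OF that(3) move_dom_star(1)[OF that(1,2)]] move_star_move[OF that(1,2)] move_dom_star(2)[OF that(1,2)] that(1)
    by simp
  have cn: "0 < x (b\<^sup>\<star>)" "0 < x (b'\<^sup>\<star>)" using b character_star[OF X] by (auto simp: less_complex_def)
  have "0 < move n x (n \<otimes> (b\<^sup>\<star> \<otimes> n\<^sup>\<star>))"
    using val[of n "b\<^sup>\<star>"] N x b cn dom_pos by (auto intro: complex_mult_pos)
  moreover have "0 < move n x (m \<otimes> m\<^sup>\<star>)" unfolding mv using move_dom_star(2)[of m x] N x dom_pos by auto
  moreover have "move n x ?e = move n x (n \<otimes> (b\<^sup>\<star> \<otimes> n\<^sup>\<star>)) * move n x (m \<otimes> m\<^sup>\<star>)"
    using N b x by (intro character_mult move_character normalizer_conj') auto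
  ultimately have "0 < move n x ?e" by (auto intro: complex_mult_pos)
  moreover have "0 < move n x ?e'"
    unfolding mv using val[OF N(2) x(2) h] character_mult[OF X, of "n\<^sup>\<star> \<otimes> n" "b'\<^sup>\<star>"] N b cn dom_pos x
    by (auto intro: complex_mult_pos)
  moreover have "?e \<in> B" "?e' \<in> B"
    using N b h by (auto intro!: normalizer_conj' sub_mult[of _ "m \<otimes> m\<^sup>\<star>"])
  ultimately show ?thesis using eq unfolding agree_def by blast
qed

text \<open>Commuting n* n with m m* carries it to the right of m as the conjugate m* n* n m, whose
  value at x is positive because n* n is positive at the moved point.\<close>

lemma agree_cancel_left:
  assumes "n \<in> N" "m \<in> N" "x \<in> dom m" "move m x \<in> dom n"
  shows "agree (n\<^sup>\<star> \<otimes> (n \<otimes> m)) m x"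
proof -
  have X: "x \<in> X" using assms dom_character by blast
  have "(n\<^sup>\<star> \<otimes> (n \<otimes> m)) \<otimes> (m\<^sup>\<star> \<otimes> m) = ((n\<^sup>\<star> \<otimes> n) \<otimes> (m \<otimes> m\<^sup>\<star>)) \<otimes> m"
    using assms by (simp add: m_assoc)
  also have "(n\<^sup>\<star> \<otimes> n) \<otimes> (m \<otimes> m\<^sup>\<star>) = (m \<otimes> m\<^sup>\<star>) \<otimes> (n\<^sup>\<star> \<otimes> n)"
    using assms by (intro sub_comm) auto
  also have "((m \<otimes> m\<^sup>\<star>) \<otimes> (n\<^sup>\<star> \<otimes> n)) \<otimes> m = m \<otimes> (m\<^sup>\<star> \<otimes> ((n\<^sup>\<star> \<otimes> n) \<otimes> m))"
    using assms by (simp add: m_assoc)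
  finally have eq: "(n\<^sup>\<star> \<otimes> (n \<otimes> m)) \<otimes> (m\<^sup>\<star> \<otimes> m) = m \<otimes> (m\<^sup>\<star> \<otimes> ((n\<^sup>\<star> \<otimes> n) \<otimes> m))" .
  have "0 < x (m\<^sup>\<star> \<otimes> ((n\<^sup>\<star> \<otimes> n) \<otimes> m))"
    using move_apply[of "n\<^sup>\<star> \<otimes> n" x m] assms dom_pos by (auto intro: complex_mult_pos)
  moreover have "m\<^sup>\<star> \<otimes> ((n\<^sup>\<star> \<otimes> n) \<otimes> m) \<in> B" "m\<^sup>\<star> \<otimes> m \<in> B" using assms normalizer_conj by auto
  ultimately show ?thesis using eq dom_pos[OF assms(3)] unfolding agree_def by blast
qed

lemma agree_cancel_right:
  assumes "n \<in> N" "m \<in> N" "x \<in> dom n"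
  shows "agree ((m \<otimes> n) \<otimes> n\<^sup>\<star>) m (move n x)"
proof -
  have "((m \<otimes> n) \<otimes> n\<^sup>\<star>) \<otimes> \<one> = m \<otimes> (n \<otimes> n\<^sup>\<star>)" using assms by (simp add: m_assoc)
  moreover have "0 < move n x (n \<otimes> n\<^sup>\<star>)" "0 < move n x \<one>"
    using move_dom_star(2)[of n x] dom_pos[of x n] character_one[OF move_character[of n x]] assms
    by (auto simp: complex_one_pos)
  ultimately show ?thesis using assms unfolding agree_def by blast
qed

subsection \<open>The Weyl twist is a groupoid\<close>

lemma weyl_product_iff:
  "weyl_product A B P Q R \<longleftrightarrow> (\<exists>n\<in>N. \<exists>m\<in>N. \<exists>x\<in>dom m. move m x \<in> dom n \<and>
     P = germ n (move m x) \<and> Q = germ m x \<and> R = germ (n \<otimes> m) x)"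
  unfolding weyl_product_def germ_def by (intro bex_cong refl) simp

text \<open>Independence of the representatives, by \<open>agree_mult\<close>. It makes the product
  relation single-valued, which resolves the definite description in \<open>gprod\<close>.\<close>

lemma weyl_product_germ:
  assumes N: "n \<in> N" "m \<in> N" and x: "x \<in> dom m" "move m x \<in> dom n"
  shows "weyl_product A B (germ n (move m x)) (germ m x) R \<longleftrightarrow> R = germ (n \<otimes> m) x"
proof
  assume "weyl_product A B (germ n (move m x)) (germ m x) R"
  then obtain n' m' x' where p: "n' \<in> N" "m' \<in> N" "x' \<in> dom m'" "move m' x' \<in> dom n'"
      "germ n (move m x) = germ n' (move m' x')" "germ m x = germ m' x'" "R = germ (n' \<otimes> m') x'"
    unfolding weyl_product_iff by metis
  have m: "x = x'" "agree m m' x" using p(2,3,6) N(2) x(1) germ_eq_iff by blast+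
  have n: "agree n n' (move m x)" using p(1,4,5) N(1) x(2) germ_eq_iff by blast
  have x': "x \<in> dom m'" using m p by simp
  have mn: "x \<in> dom (n \<otimes> m)" by (rule move_mult(1)[OF N x])
  have mn': "x \<in> dom (n' \<otimes> m')" using move_mult(1)[OF p(1-4)] m by simp
  have "agree (n \<otimes> m) (n' \<otimes> m') x"
    by (rule agree_mult[OF N(1) p(1) N(2) p(2) x(1) x' m(2) n])
  then have "germ (n \<otimes> m) x = germ (n' \<otimes> m') x"
    using germ_eq_iff[OF normalizer_mult[OF N] mn normalizer_mult[OF p(1,2)] mn'] by blast
  then show "R = germ (n \<otimes> m) x" unfolding p(7) m(1)[symmetric] by (rule sym)
next
  assume "R = germ (n \<otimes> m) x"
  then show "weyl_product A B (germ n (move m x)) (germ m x) R"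
    unfolding weyl_product_iff using N x by blast
qed

lemma arrows_weyl_twist: "arrows (weyl_twist A B) = {germ n x | n x. n \<in> N \<and> x \<in> dom n}"
  by (auto simp: weyl_twist_def weyl_triples_def weyl_class_def quotient_def germ_def)

text \<open>Source and range can both be read off a germ: equal germs have the same base point, and
  their normalizers move it to the same place.\<close>

lemma composable_weyl_twist_iff:
  assumes "n \<in> N" "y \<in> dom n" "m \<in> N" "x \<in> dom m"
  shows "(germ n y, germ m x) \<in> composable (weyl_twist A B) \<longleftrightarrow> y = move m x"
proof
  assume "(germ n y, germ m x) \<in> composable (weyl_twist A B)"
  then obtain n' m' x' where p: "n' \<in> N" "m' \<in> N" "x' \<in> dom m'" "move m' x' \<in> dom n'"
      "germ n y = germ n' (move m' x')" "germ m x = germ m' x'"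
    by (auto simp: weyl_twist_def weyl_product_iff)
  then have "x = x'" "y = move m' x'" "agree m m' x" using assms germ_eq_iff by blast+
  then show "y = move m x" using agree_move[of m m' x] assms p by simp
next
  assume "y = move m x"
  then show "(germ n y, germ m x) \<in> composable (weyl_twist A B)"
    using assms weyl_product_germ by (auto simp: weyl_twist_def)
qed

lemma gprod_weyl_twist:
  assumes "n \<in> N" "m \<in> N" "x \<in> dom m" "move m x \<in> dom n"
  shows "gprod (weyl_twist A B) (germ n (move m x)) (germ m x) = germ (n \<otimes> m) x"
  unfolding weyl_twist_def by (auto intro!: the_equality simp: weyl_product_germ[OF assms])

lemma composable_weyl_twistE:
  assumes "(P, Q) \<in> composable (weyl_twist A B)"
  obtains n m x where "n \<in> N" "m \<in> N" "x \<in> dom m" "move m x \<in> dom n"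
    "P = germ n (move m x)" "Q = germ m x"
  using assms by (auto simp: weyl_twist_def weyl_product_iff)

text \<open>A unimodular z drops out of conjugation by zn, so the domain and the moved point do not
  change. An equation nb = mb' survives multiplication by z, so the result does not depend on the
  representative.\<close>

lemma weyl_action_germ:
  assumes n: "n \<in> N" "x \<in> dom n" and z: "z \<in> circle"
  shows "x \<in> dom (z \<odot> n)" and "move (z \<odot> n) x = move n x"
    and "weyl_action A B z (germ n x) = germ (z \<odot> n) x"
proof -
  have unit: "cnj z * z = 1" using z by (simp add: complex_norm_square[symmetric] mult.commute)
  have cj: "(z \<odot> m)\<^sup>\<star> \<otimes> (b \<otimes> (z \<odot> m)) = m\<^sup>\<star> \<otimes> (b \<otimes> m)" if "m \<in> N" "b \<in> B" for m b
    using that unit by (simp add: star_smult smult_mult mult_smult smult_smult one_smult mult.commute)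
  have cj1: "(z \<odot> m)\<^sup>\<star> \<otimes> (z \<odot> m) = m\<^sup>\<star> \<otimes> m" if "m \<in> N" for m
    using cj[OF that sub_one] that by simp
  have dom: "y \<in> dom (z \<odot> m)" if "m \<in> N" "y \<in> dom m" for m y
    using that cj1 by (simp add: weyl_dom_def)
  then show "x \<in> dom (z \<odot> n)" using n by blast
  show "move (z \<odot> n) x = move n x"
    unfolding move_def by (rule restrict_ext) (simp add: cj cj1 n)
  have mv: "move (z \<odot> m) y = move m y" if "m \<in> N" for m y
    unfolding move_def by (rule restrict_ext) (simp add: cj cj1 that)
  have eq: "weyl_class A B (weyl_map A B m y, z \<odot> m, y) = germ (z \<odot> m) y" if "m \<in> N" "y \<in> dom m" for m y
    using that dom mv unfolding germ_def by simp
  show "weyl_action A B z (germ n x) = germ (z \<odot> n) x"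
    unfolding weyl_action_def germ_def[of _ _, symmetric]
  proof (rule the_equality)
    show "\<exists>m\<in>N. \<exists>y\<in>dom m. germ n x = germ m y \<and> germ (z \<odot> n) x = weyl_class A B (weyl_map A B m y, z \<odot> m, y)"
      using n eq by blast
    fix R
    assume "\<exists>m\<in>N. \<exists>y\<in>dom m. germ n x = germ m y \<and> R = weyl_class A B (weyl_map A B m y, z \<odot> m, y)"
    then obtain m y where m: "m \<in> N" "y \<in> dom m" "germ n x = germ m y" "R = germ (z \<odot> m) y"
      using eq by auto
    then have a: "x = y" "agree n m x" using n germ_eq_iff by blast+
    have "agree (z \<odot> n) (z \<odot> m) x"
    proof -
      obtain b b' where b: "b \<in> B" "b' \<in> B" "0 < x b" "0 < x b'" "n \<otimes> b = m \<otimes> b'"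
        using a(2) by (auto simp: agree_def)
      then have "(z \<odot> n) \<otimes> b = (z \<odot> m) \<otimes> b'" using n m(1) b(1,2) by (simp add: smult_mult b(5))
      then show ?thesis using b unfolding agree_def by blast
    qed
    then show "R = germ (z \<odot> n) x"
      unfolding m(4) using n m a dom by (subst germ_eq_iff) (auto intro: agree_sym)
  qed
qed

lemma is_groupoid_weyl_twist: "is_groupoid (weyl_twist A B)"
proof -
  let ?W = "weyl_twist A B"
  \<comment> \<open>Inversion must be a function on classes, so a representative is chosen;
    \<open>agree_star\<close> shows that the choice is immaterial.\<close>
  define rep where "rep P = (SOME (n, x). n \<in> N \<and> x \<in> dom n \<and> P = germ n x)" for P
  define i where "i P = (case rep P of (n, x) \<Rightarrow> germ (n\<^sup>\<star>) (move n x))" for P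
  have i_germ: "i (germ n x) = germ (n\<^sup>\<star>) (move n x)" if n: "n \<in> N" "x \<in> dom n" for n x
  proof -
    obtain m y where rep: "rep (germ n x) = (m, y)" by fastforce
    have "\<exists>p. case p of (m, y) \<Rightarrow> m \<in> N \<and> y \<in> dom m \<and> germ n x = germ m y" using n by blast
    then have "case rep (germ n x) of (m, y) \<Rightarrow> m \<in> N \<and> y \<in> dom m \<and> germ n x = germ m y"
      unfolding rep_def by (rule someI_ex)
    then have m: "m \<in> N" "y \<in> dom m" "germ n x = germ m y" using rep by auto
    then have a: "x = y" "agree n m x" using n germ_eq_iff by blast+
    have mv: "move n x = move m x" using agree_move n m a by blast
    have "germ (n\<^sup>\<star>) (move n x) = germ (m\<^sup>\<star>) (move m y)"
      using agree_star[of n m x] n m a mv move_dom_star(1)[OF n] move_dom_star(1)[OF m(1,2)]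
      by (subst germ_eq_iff) auto
    then show ?thesis unfolding i_def rep by simp
  qed
  have comp: "composable ?W \<subseteq> arrows ?W \<times> arrows ?W"
  proof clarify
    fix P Q assume "(P, Q) \<in> composable ?W"
    then obtain n m x where "n \<in> N" "m \<in> N" "x \<in> dom m" "move m x \<in> dom n"
        "P = germ n (move m x)" "Q = germ m x" by (rule composable_weyl_twistE)
    then show "P \<in> arrows ?W \<and> Q \<in> arrows ?W" unfolding arrows_weyl_twist by blast
  qed
  have cl: "\<forall>(P, Q)\<in>composable ?W. gprod ?W P Q \<in> arrows ?W"
  proof clarify
    fix P Q assume "(P, Q) \<in> composable ?W"
    then obtain n m x where p: "n \<in> N" "m \<in> N" "x \<in> dom m" "move m x \<in> dom n"
        and PQ: "P = germ n (move m x)" "Q = germ m x" by (rule composable_weyl_twistE)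
    show "gprod ?W P Q \<in> arrows ?W"
      unfolding arrows_weyl_twist PQ gprod_weyl_twist[OF p]
      using normalizer_mult[OF p(1,2)] move_mult(1)[OF p] by blast
  qed
  have assoc: "(gprod ?W P Q, R) \<in> composable ?W \<and> (P, gprod ?W Q R) \<in> composable ?W \<and>
        gprod ?W (gprod ?W P Q) R = gprod ?W P (gprod ?W Q R)"
    if PQ: "(P, Q) \<in> composable ?W" and QR: "(Q, R) \<in> composable ?W" for P Q R
  proof -
    obtain m l y where q: "m \<in> N" "l \<in> N" "y \<in> dom l" "move l y \<in> dom m" "Q = germ m (move l y)" "R = germ l y"
      using QR by (rule composable_weyl_twistE)
    have "P \<in> arrows ?W" using PQ comp by blast
    then obtain n z where p: "n \<in> N" "z \<in> dom n" "P = germ n z" unfolding arrows_weyl_twist by blast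
    have z: "z = move m (move l y)" using PQ composable_weyl_twist_iff p q by blast
    have ml: "y \<in> dom (m \<otimes> l)" "move (m \<otimes> l) y = z" using move_mult[of m l y] q z by auto
    have nm: "move l y \<in> dom (n \<otimes> m)" using move_mult(1)[of n m "move l y"] p q z by auto
    have a: "gprod ?W P Q = germ (n \<otimes> m) (move l y)" using gprod_weyl_twist[of n m "move l y"] p q z by simp
    have b: "gprod ?W Q R = germ (m \<otimes> l) y" using gprod_weyl_twist[of m l y] q by simp
    have c: "gprod ?W (gprod ?W P Q) R = germ ((n \<otimes> m) \<otimes> l) y"
      unfolding a q(6) by (rule gprod_weyl_twist) (use p q nm in auto)
    have d: "gprod ?W P (gprod ?W Q R) = germ (n \<otimes> (m \<otimes> l)) y"
      unfolding b p(3) ml(2)[symmetric] by (rule gprod_weyl_twist) (use p q ml in auto)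
    have "(gprod ?W P Q, R) \<in> composable ?W"
      unfolding a q(6) by (subst composable_weyl_twist_iff) (use p q nm in auto)
    moreover have "(P, gprod ?W Q R) \<in> composable ?W"
      unfolding b p(3) by (subst composable_weyl_twist_iff) (use p q ml in auto)
    moreover have "(n \<otimes> m) \<otimes> l = n \<otimes> (m \<otimes> l)" using p q by (simp add: m_assoc)
    ultimately show ?thesis unfolding c d by simp
  qed
  have inv: "i P \<in> arrows ?W \<and> i (i P) = P \<and> (P, i P) \<in> composable ?W \<and>
        (\<forall>Q. (P, Q) \<in> composable ?W \<longrightarrow> gprod ?W (i P) (gprod ?W P Q) = Q) \<and>
        (\<forall>Q. (Q, P) \<in> composable ?W \<longrightarrow> gprod ?W (gprod ?W Q P) (i P) = Q)"
    if P: "P \<in> arrows ?W" for P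
  proof -
    obtain n x where p: "n \<in> N" "x \<in> dom n" "P = germ n x" using P unfolding arrows_weyl_twist by blast
    have iP: "i P = germ (n\<^sup>\<star>) (move n x)" using i_germ p by simp
    have st: "n\<^sup>\<star> \<in> N" "move n x \<in> dom (n\<^sup>\<star>)" "move (n\<^sup>\<star>) (move n x) = x"
      using p move_dom_star move_star_move by auto
    have "i (i P) = P" unfolding iP using i_germ[OF st(1,2)] st p by simp
    moreover have "i P \<in> arrows ?W" unfolding iP arrows_weyl_twist using st by blast
    moreover have "(P, i P) \<in> composable ?W"
      unfolding iP using composable_weyl_twist_iff[of n x "n\<^sup>\<star>" "move n x"] st p by simp
    moreover have "gprod ?W (i P) (gprod ?W P Q) = Q" if "(P, Q) \<in> composable ?W" for Q
    proof -
      have "Q \<in> arrows ?W" using that comp by blast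
      then obtain m y where q: "m \<in> N" "y \<in> dom m" "Q = germ m y" unfolding arrows_weyl_twist by blast
      have x: "x = move m y" using that composable_weyl_twist_iff p q by blast
      have nm: "y \<in> dom (n \<otimes> m)" "move (n \<otimes> m) y = move n x" using move_mult[of n m y] p q x by auto
      have "gprod ?W P Q = germ (n \<otimes> m) y" using gprod_weyl_twist[of n m y] p q x by simp
      then have "gprod ?W (i P) (gprod ?W P Q) = germ (n\<^sup>\<star> \<otimes> (n \<otimes> m)) y"
        using gprod_weyl_twist[of "n\<^sup>\<star>" "n \<otimes> m" y] st nm p q iP by auto
      also have "\<dots> = germ m y"
        using agree_cancel_left[of n m y] p q x st nm move_mult(1)[of "n\<^sup>\<star>" "n \<otimes> m" y]
        by (subst germ_eq_iff) auto
      finally show ?thesis using q by simp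
    qed
    moreover have "gprod ?W (gprod ?W Q P) (i P) = Q" if "(Q, P) \<in> composable ?W" for Q
    proof -
      have "Q \<in> arrows ?W" using that comp by blast
      then obtain m y where q: "m \<in> N" "y \<in> dom m" "Q = germ m y" unfolding arrows_weyl_twist by blast
      have y: "y = move n x" using that composable_weyl_twist_iff p q by blast
      have mn: "x \<in> dom (m \<otimes> n)" using move_mult(1)[of m n x] p q y by auto
      have "gprod ?W Q P = germ (m \<otimes> n) x" using gprod_weyl_twist[of m n x] p q y by simp
      then have "gprod ?W (gprod ?W Q P) (i P) = germ ((m \<otimes> n) \<otimes> n\<^sup>\<star>) (move n x)"
        using gprod_weyl_twist[of "m \<otimes> n" "n\<^sup>\<star>" "move n x"] st mn p q iP by auto
      also have "\<dots> = germ m y"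
        using agree_cancel_right[of n m x] p q y st mn move_mult(1)[of "m \<otimes> n" "n\<^sup>\<star>" "move n x"]
        by (subst germ_eq_iff) auto
      finally show ?thesis using q by simp
    qed
    ultimately show ?thesis by blast
  qed
  show ?thesis unfolding is_groupoid_def
  proof (intro conjI comp cl)
    show "\<forall>P Q R. (P, Q) \<in> composable ?W \<and> (Q, R) \<in> composable ?W \<longrightarrow>
        (gprod ?W P Q, R) \<in> composable ?W \<and> (P, gprod ?W Q R) \<in> composable ?W \<and>
        gprod ?W (gprod ?W P Q) R = gprod ?W P (gprod ?W Q R)"
      using assoc by blast
  qed (rule exI[of _ i], rule ballI, rule inv)
qed

subsection \<open>Unitary elements\<close>

definition unitary :: "'a \<Rightarrow> bool" where
  "unitary u \<longleftrightarrow> u \<in> carrier A \<and> u\<^sup>\<star> \<otimes> u = \<one> \<and> u \<otimes> u\<^sup>\<star> = \<one>"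

lemma unitary_star: "unitary u \<Longrightarrow> unitary (u\<^sup>\<star>)"
  by (simp add: unitary_def)

lemma unitary_mult: assumes "unitary u" "unitary v" shows "unitary (u \<otimes> v)"
proof -
  have c: "u \<in> carrier A" "v \<in> carrier A" using assms by (auto simp: unitary_def)
  have "(u \<otimes> v)\<^sup>\<star> \<otimes> (u \<otimes> v) = v\<^sup>\<star> \<otimes> ((u\<^sup>\<star> \<otimes> u) \<otimes> v)"
       "(u \<otimes> v) \<otimes> (u \<otimes> v)\<^sup>\<star> = u \<otimes> ((v \<otimes> v\<^sup>\<star>) \<otimes> u\<^sup>\<star>)"
    using c by (simp_all add: star_mult m_assoc)
  then show ?thesis using assms by (simp add: unitary_def)
qed

lemma unitary_dom: assumes "unitary u" "x \<in> X" shows "x \<in> dom u"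
  using assms character_one[OF assms(2)] by (simp add: unitary_def weyl_dom_def complex_one_pos)

lemma character_unitary:
  assumes "unitary u" "u \<in> B" "x \<in> X" shows "x u \<in> circle" and "cnj (x u) * x u = 1"
proof -
  show 1: "cnj (x u) * x u = 1"
    using assms character_mult[OF assms(3), of "u\<^sup>\<star>" u] character_star[OF assms(3,2)]
      character_one[OF assms(3)]
    by (simp add: unitary_def)
  have "(cmod (x u))\<^sup>2 = cmod (cnj (x u) * x u)" by (simp add: norm_mult power2_eq_square)
  then have "(cmod (x u))\<^sup>2 = 1" unfolding 1 by simp
  then have "cmod (x u) = 1" using norm_ge_zero[of "x u"] by (auto simp: power2_eq_1_iff)
  then show "x u \<in> circle" by simp
qed

text \<open>The witness x(w) w* turns mw into x(w) m, and its own value at x is |x(w)|^2 =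
  1.\<close>

lemma agree_unitary:
  assumes "m \<in> N" "unitary w" "w \<in> B" "x \<in> X"
  shows "agree (m \<otimes> w) (x w \<odot> m) x"
proof -
  have "(m \<otimes> w) \<otimes> (x w \<odot> w\<^sup>\<star>) = (x w \<odot> m) \<otimes> \<one>"
    using assms by (simp add: mult_smult smult_mult m_assoc unitary_def)
  moreover have "x (x w \<odot> w\<^sup>\<star>) = 1"
    using character_smult[OF assms(4)] character_star[OF assms(4,3)] character_unitary(2)[OF assms(2-4)] assms
    by (simp add: mult.commute)
  moreover have "x w \<odot> w\<^sup>\<star> \<in> B" using assms by auto
  ultimately show ?thesis
    using character_one[OF assms(4)] complex_one_pos unfolding agree_def by (metis sub_one)
qed

text \<open>The first part turns a unitary of B into a scalar. The second, applied with m = 1, shows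
  that such a unitary fixes every character.\<close>

lemma germ_unitary:
  assumes m: "m \<in> N" and x: "x \<in> dom m" "x \<in> dom (m \<otimes> w)" and w: "unitary w" "w \<in> B"
  shows "germ (m \<otimes> w) x = germ (x w \<odot> m) x" and "move (m \<otimes> w) x = move m x"
proof -
  have X: "x \<in> X" using x dom_character by blast
  have W: "w \<in> N"
  proof (rule normalizerI)
    show "w \<in> carrier A" using w by simp
  qed (use w in auto)
  have z: "x w \<in> circle" using character_unitary(1)[OF w X] .
  note a = agree_unitary[OF m w X]
  note d = weyl_action_germ(1)[OF m x(1) z]
  show "germ (m \<otimes> w) x = germ (x w \<odot> m) x"
    using a x(2) d m W by (subst germ_eq_iff) auto
  show "move (m \<otimes> w) x = move m x"
    using agree_move[OF _ _ x(2) d a] m W weyl_action_germ(2)[OF m x(1) z] by simp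
qed

lemma move_one: assumes "x \<in> X" shows "move \<one> x = x"
proof (rule extensionalityI[of _ B])
  show "move \<one> x b = x b" if "b \<in> B" for b
    using that character_one[OF assms] by (simp add: move_def)
qed (use character_extensional[OF assms] in \<open>simp_all add: move_def\<close>)

end

section \<open>Bounded operators on square-summable functions\<close>

subsection \<open>Square-summable functions\<close>

text \<open>\<open>l2_norm\<close> and \<open>l2_inner\<close> sum over the whole type, and
  summability in this form matches them.\<close>

lemma ell2_iff: "f \<in> ell2 I \<longleftrightarrow> (\<forall>i. i \<notin> I \<longrightarrow> f i = 0) \<and> (\<lambda>i. (cmod (f i))\<^sup>2) summable_on UNIV"
proof -
  have "(\<lambda>i. (cmod (f i))\<^sup>2) summable_on I \<longleftrightarrow> (\<lambda>i. (cmod (f i))\<^sup>2) summable_on UNIV"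
    if "\<forall>i. i \<notin> I \<longrightarrow> f i = 0"
    using that by (intro summable_on_cong_neutral) auto
  then show ?thesis by (auto simp: ell2_def)
qed

lemma ell2_eq_0: "f \<in> ell2 I \<Longrightarrow> i \<notin> I \<Longrightarrow> f i = 0"
  by (simp add: ell2_def)

lemma L2_set_le_l2_norm:
  assumes "f \<in> ell2 I" "finite F" shows "L2_set (\<lambda>i. cmod (f i)) F \<le> l2_norm f"
  using assms unfolding L2_set_def l2_norm_def
  by (intro real_sqrt_le_mono finite_sum_le_infsum) (auto simp: ell2_iff)

text \<open>Reduces estimates for infinite sums to uniform ones for the finite
  \<open>L2_set\<close>. The triangle inequality and the bounds for adjoints and translations are
  obtained in this way.\<close>

lemma ell2_boundI:
  assumes off: "\<And>i. i \<notin> I \<Longrightarrow> f i = 0"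
    and bound: "\<And>F. finite F \<Longrightarrow> L2_set (\<lambda>i. cmod (f i)) F \<le> M"
  shows "f \<in> ell2 I" and "l2_norm f \<le> M"
proof -
  have M: "0 \<le> M" using bound[of "{}"] by simp
  have le: "(\<Sum>i\<in>F. (cmod (f i))\<^sup>2) \<le> M\<^sup>2" if "finite F" for F
  proof -
    have "(L2_set (\<lambda>i. cmod (f i)) F)\<^sup>2 \<le> M\<^sup>2" using bound[OF that] by (intro power_mono) auto
    then show ?thesis by (simp add: L2_set_def sum_nonneg)
  qed
  have s: "(\<lambda>i. (cmod (f i))\<^sup>2) summable_on UNIV"
    by (rule nonneg_bdd_above_summable_on) (auto intro!: bdd_aboveI[of _ "M\<^sup>2"] le)
  then show "f \<in> ell2 I" using off by (simp add: ell2_iff)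
  have "(\<Sum>\<^sub>\<infinity>i. (cmod (f i))\<^sup>2) \<le> M\<^sup>2" by (rule infsum_le_finite_sums[OF s]) (use le in auto)
  then show "l2_norm f \<le> M" unfolding l2_norm_def using M by (simp add: real_le_lsqrt)
qed

lemma l2_norm_nonneg [simp]: "0 \<le> l2_norm f"
  by (simp add: l2_norm_def infsum_nonneg)

lemma norm_le_l2_norm: "f \<in> ell2 I \<Longrightarrow> cmod (f i) \<le> l2_norm f"
  using L2_set_le_l2_norm[of f I "{i}"] by simp

lemma l2_norm_eq_0: "f \<in> ell2 I \<Longrightarrow> l2_norm f \<le> 0 \<Longrightarrow> f = (\<lambda>i. 0)"
  using norm_le_l2_norm[of f I] by (metis norm_le_zero_iff order_trans)

lemma ell2_zero [simp]: "(\<lambda>i. 0) \<in> ell2 I" and l2_norm_zero [simp]: "l2_norm (\<lambda>i. 0) = 0"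
  by (auto simp: ell2_iff l2_norm_def)

lemma
  assumes f: "f \<in> ell2 I" and h: "h \<in> ell2 I"
  shows ell2_add [simp]: "(\<lambda>i. f i + h i) \<in> ell2 I"
    and l2_norm_add_le: "l2_norm (\<lambda>i. f i + h i) \<le> l2_norm f + l2_norm h"
proof -
  have le: "L2_set (\<lambda>i. cmod (f i + h i)) F \<le> l2_norm f + l2_norm h" if "finite F" for F
  proof -
    have "L2_set (\<lambda>i. cmod (f i + h i)) F \<le> L2_set (\<lambda>i. cmod (f i) + cmod (h i)) F"
      by (intro L2_set_mono norm_triangle_ineq) auto
    also have "\<dots> \<le> L2_set (\<lambda>i. cmod (f i)) F + L2_set (\<lambda>i. cmod (h i)) F"
      by (rule L2_set_triangle_ineq)
    finally show ?thesis using L2_set_le_l2_norm[OF f that] L2_set_le_l2_norm[OF h that] by linarith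
  qed
  show "(\<lambda>i. f i + h i) \<in> ell2 I" "l2_norm (\<lambda>i. f i + h i) \<le> l2_norm f + l2_norm h"
    using ell2_boundI[of I "\<lambda>i. f i + h i", OF _ le] ell2_eq_0[OF f] ell2_eq_0[OF h] by auto
qed

lemma
  assumes f: "f \<in> ell2 I"
  shows ell2_cmult [simp]: "(\<lambda>i. z * f i) \<in> ell2 I"
    and l2_norm_cmult_le: "l2_norm (\<lambda>i. z * f i) \<le> cmod z * l2_norm f"
proof -
  have le: "L2_set (\<lambda>i. cmod (z * f i)) F \<le> cmod z * l2_norm f" if "finite F" for F
    using L2_set_le_l2_norm[OF f that]
    by (simp add: norm_mult L2_set_right_distrib[symmetric] mult_left_mono)
  show "(\<lambda>i. z * f i) \<in> ell2 I" "l2_norm (\<lambda>i. z * f i) \<le> cmod z * l2_norm f"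
    using ell2_boundI[of I "\<lambda>i. z * f i", OF _ le] ell2_eq_0[OF f] by auto
qed

lemma ell2_diff [simp]: "f \<in> ell2 I \<Longrightarrow> h \<in> ell2 I \<Longrightarrow> (\<lambda>i. f i - h i) \<in> ell2 I"
  using ell2_add[of f I "\<lambda>i. - 1 * h i"] ell2_cmult[of h I "-1"] by simp

definition unit_fun :: "'i \<Rightarrow> 'i \<Rightarrow> complex" where
  "unit_fun i = (\<lambda>j. if j = i then 1 else 0)"

lemma ell2_finite_support:
  assumes "finite F" "F \<subseteq> I"
  shows "(\<lambda>i. if i \<in> F then u i else 0) \<in> ell2 I"
    and "l2_norm (\<lambda>i. if i \<in> F then u i else 0) = L2_set (\<lambda>i. cmod (u i)) F"
proof -
  have "(\<lambda>i. (cmod (if i \<in> F then u i else 0))\<^sup>2) summable_on UNIV"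
    by (subst summable_on_cong_neutral[where T=F and g="\<lambda>i. (cmod (u i))\<^sup>2"]) (auto simp: assms)
  then show "(\<lambda>i. if i \<in> F then u i else 0) \<in> ell2 I" using assms by (auto simp: ell2_iff)
  have "(\<Sum>\<^sub>\<infinity>i. (cmod (if i \<in> F then u i else 0))\<^sup>2) = (\<Sum>\<^sub>\<infinity>i\<in>F. (cmod (u i))\<^sup>2)"
    by (rule infsum_cong_neutral) auto
  then show "l2_norm (\<lambda>i. if i \<in> F then u i else 0) = L2_set (\<lambda>i. cmod (u i)) F"
    using assms by (simp add: l2_norm_def L2_set_def)
qed

lemma unit_fun_ell2 [simp]: "i \<in> I \<Longrightarrow> unit_fun i \<in> ell2 I"
  using ell2_finite_support(1)[of "{i}" I "\<lambda>_. 1"] by (simp add: unit_fun_def)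

text \<open>Any finite part of the tail has square sum at most the total minus the sum over F. This
  density extends identities checked on unit vectors to all vectors.\<close>

lemma ell2_truncate:
  assumes h: "h \<in> ell2 I" and "0 < \<epsilon>"
  shows "\<exists>F. finite F \<and> F \<subseteq> I \<and> l2_norm (\<lambda>i. h i - (if i \<in> F then h i else 0)) \<le> \<epsilon>"
proof -
  let ?q = "\<lambda>i. (cmod (h i))\<^sup>2"
  have s: "?q summable_on I" using h by (simp add: ell2_def)
  obtain F where F: "finite F" "F \<subseteq> I" "dist (sum ?q F) (infsum ?q I) \<le> \<epsilon>\<^sup>2"
    using infsum_finite_approximation[OF s, of "\<epsilon>\<^sup>2"] \<open>0 < \<epsilon>\<close> by auto
  have le: "L2_set (\<lambda>i. cmod (h i - (if i \<in> F then h i else 0))) F' \<le> \<epsilon>" if F': "finite F'" for F'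
  proof -
    have "(\<Sum>i\<in>F'. (cmod (h i - (if i \<in> F then h i else 0)))\<^sup>2) = (\<Sum>i\<in>(F' - F) \<inter> I. ?q i)"
      using F' h by (intro sum.mono_neutral_cong_right) (auto simp: ell2_def)
    also have "\<dots> = sum ?q (F \<union> (F' - F) \<inter> I) - sum ?q F"
      using F F' by (subst sum.union_disjoint) auto
    also have "\<dots> \<le> infsum ?q I - sum ?q F"
      using F F' s by (intro diff_mono finite_sum_le_infsum) auto
    also have "\<dots> \<le> \<epsilon>\<^sup>2" using F(3) by (simp add: dist_real_def)
    finally show ?thesis unfolding L2_set_def using \<open>0 < \<epsilon>\<close> by (simp add: real_le_lsqrt sum_nonneg)
  qed
  have "l2_norm (\<lambda>i. h i - (if i \<in> F then h i else 0)) \<le> \<epsilon>"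
    by (rule ell2_boundI(2)[of I, OF _ le]) (use h in \<open>auto simp: ell2_def\<close>)
  then show ?thesis using F by blast
qed

text \<open>Cauchy-Schwarz for finite sums bounds all partial sums, which gives absolute summability
  and the estimate together.\<close>

lemma
  assumes f: "f \<in> ell2 I" and h: "h \<in> ell2 J"
  shows l2_inner_summable: "(\<lambda>i. cnj (f i) * h i) summable_on UNIV"
    and l2_inner_bound: "cmod (l2_inner f h) \<le> l2_norm f * l2_norm h"
proof -
  have le: "(\<Sum>i\<in>F. cmod (cnj (f i) * h i)) \<le> l2_norm f * l2_norm h" if "finite F" for F
  proof -
    have "(\<Sum>i\<in>F. cmod (cnj (f i) * h i)) \<le> L2_set (\<lambda>i. cmod (f i)) F * L2_set (\<lambda>i. cmod (h i)) F"
      using L2_set_mult_ineq[of "\<lambda>i. cmod (f i)" "\<lambda>i. cmod (h i)" F] by (simp add: norm_mult)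
    also have "\<dots> \<le> l2_norm f * l2_norm h"
      using that f h by (intro mult_mono L2_set_le_l2_norm) auto
    finally show ?thesis .
  qed
  have s: "(\<lambda>i. cmod (cnj (f i) * h i)) summable_on UNIV"
    by (rule nonneg_bdd_above_summable_on) (auto intro!: bdd_aboveI[of _ "l2_norm f * l2_norm h"] le)
  then show "(\<lambda>i. cnj (f i) * h i) summable_on UNIV" by (rule abs_summable_summable)
  have "cmod (l2_inner f h) \<le> (\<Sum>\<^sub>\<infinity>i. cmod (cnj (f i) * h i))"
    unfolding l2_inner_def by (rule norm_infsum_bound[OF s])
  also have "\<dots> \<le> l2_norm f * l2_norm h" by (rule infsum_le_finite_sums[OF s]) (use le in auto)
  finally show "cmod (l2_inner f h) \<le> l2_norm f * l2_norm h" .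
qed

lemma l2_inner_cnj: "l2_inner h f = cnj (l2_inner f h)"
  unfolding l2_inner_def infsum_cnj[symmetric] by (simp add: mult.commute)

lemma l2_inner_add_right:
  "f \<in> ell2 I \<Longrightarrow> g \<in> ell2 J \<Longrightarrow> h \<in> ell2 K \<Longrightarrow>
    l2_inner f (\<lambda>i. g i + h i) = l2_inner f g + l2_inner f h"
  unfolding l2_inner_def
  by (subst infsum_add[symmetric]) (auto simp: l2_inner_summable distrib_left)

lemma l2_inner_cmult_right: "l2_inner f (\<lambda>i. z * h i) = z * l2_inner f h"
  unfolding l2_inner_def
  by (subst infsum_cmult_right'[symmetric]) (simp add: algebra_simps)

lemma l2_inner_diff_right:
  assumes "f \<in> ell2 I" "g \<in> ell2 J" "h \<in> ell2 K"
  shows "l2_inner f (\<lambda>i. g i - h i) = l2_inner f g - l2_inner f h"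
  using l2_inner_add_right[OF assms(1,2) ell2_cmult[OF assms(3), of "-1"]]
    l2_inner_cmult_right[of f "-1" h] by simp

lemma l2_inner_add_left:
  "f \<in> ell2 I \<Longrightarrow> g \<in> ell2 J \<Longrightarrow> h \<in> ell2 K \<Longrightarrow>
    l2_inner (\<lambda>i. g i + h i) f = l2_inner g f + l2_inner h f"
  using l2_inner_add_right[of f I g J h K] by (simp add: l2_inner_cnj[of _ f])

lemma l2_inner_cmult_left: "l2_inner (\<lambda>i. z * h i) f = cnj z * l2_inner h f"
  using l2_inner_cmult_right[of f z h] by (simp add: l2_inner_cnj[of _ f])

lemma l2_inner_finite_support:
  assumes "finite F"
  shows "l2_inner (\<lambda>i. if i \<in> F then u i else 0) h = (\<Sum>i\<in>F. cnj (u i) * h i)"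
proof -
  have "l2_inner (\<lambda>i. if i \<in> F then u i else 0) h = (\<Sum>\<^sub>\<infinity>i\<in>F. cnj (u i) * h i)"
    unfolding l2_inner_def by (rule infsum_cong_neutral) auto
  then show ?thesis using assms by simp
qed

lemma l2_inner_unit_fun [simp]: "l2_inner (unit_fun i) h = h i"
  using l2_inner_finite_support[of "{i}" "\<lambda>_. 1" h] by (simp add: unit_fun_def)

lemma l2_inner_self:
  assumes f: "f \<in> ell2 I"
  shows "l2_inner f f = complex_of_real ((l2_norm f)\<^sup>2)"
proof -
  have "l2_inner f f = (\<Sum>\<^sub>\<infinity>i. complex_of_real ((cmod (f i))\<^sup>2))"
    unfolding l2_inner_def by (intro infsum_cong) (simp add: complex_norm_square[symmetric] mult.commute)
  also have "\<dots> = complex_of_real (\<Sum>\<^sub>\<infinity>i. (cmod (f i))\<^sup>2)" 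
    by (rule infsumI, rule has_sum_of_real, rule has_sum_infsum) (use f in \<open>simp add: ell2_iff\<close>)
  also have "\<dots> = complex_of_real ((l2_norm f)\<^sup>2)" by (simp add: l2_norm_def infsum_nonneg)
  finally show ?thesis .
qed

subsection \<open>The algebra of bounded operators\<close>

text \<open>An arbitrary bound composes more easily than the supremum \<open>op_norm\<close>. The
  two are exchanged by \<open>op_norm_le\<close> and \<open>op_bound_op_norm\<close>.\<close>

definition op_bound :: "'i set \<Rightarrow> 'i l2_op \<Rightarrow> real \<Rightarrow> bool" where
  "op_bound I T C \<longleftrightarrow> (\<forall>f\<in>ell2 I. l2_norm (T f) \<le> C * l2_norm f)"

lemma bounded_opsI:
  assumes "T \<in> ell2 I \<rightarrow>\<^sub>E ell2 I"
    and "\<And>f h. f \<in> ell2 I \<Longrightarrow> h \<in> ell2 I \<Longrightarrow> T (\<lambda>i. f i + h i) = (\<lambda>i. T f i + T h i)"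
    and "\<And>z f. f \<in> ell2 I \<Longrightarrow> T (\<lambda>i. z * f i) = (\<lambda>i. z * T f i)"
    and "op_bound I T C"
  shows "T \<in> bounded_ops I"
  using assms unfolding bounded_ops_def op_bound_def by blast

lemma
  assumes "T \<in> bounded_ops I"
  shows bounded_ops_ell2 [simp]: "f \<in> ell2 I \<Longrightarrow> T f \<in> ell2 I"
    and bounded_ops_extensional: "T \<in> extensional (ell2 I)"
    and bounded_ops_add: "f \<in> ell2 I \<Longrightarrow> h \<in> ell2 I \<Longrightarrow> T (\<lambda>i. f i + h i) = (\<lambda>i. T f i + T h i)"
    and bounded_ops_cmult: "f \<in> ell2 I \<Longrightarrow> T (\<lambda>i. z * f i) = (\<lambda>i. z * T f i)"
  using assms by (auto simp: bounded_ops_def PiE_def)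

text \<open>Over an empty index set all norms vanish and the constant could be negative; the maximum
  with 0 allows bounds to be multiplied.\<close>

lemma bounded_ops_bound: assumes "T \<in> bounded_ops I" obtains C where "0 \<le> C" "op_bound I T C"
proof -
  obtain C where C: "op_bound I T C" using assms by (auto simp: bounded_ops_def op_bound_def)
  have "op_bound I T (max C 0)"
    using C unfolding op_bound_def by (meson l2_norm_nonneg max.cobounded1 mult_right_mono order_trans)
  then show thesis using that[of "max C 0"] by simp
qed

lemma bounded_ops_zero: "T \<in> bounded_ops I \<Longrightarrow> T (\<lambda>i. 0) = (\<lambda>i. 0)"
  using bounded_ops_cmult[of T I "\<lambda>i. 0" 0] by simp

lemma bounded_ops_diff:
  "T \<in> bounded_ops I \<Longrightarrow> f \<in> ell2 I \<Longrightarrow> h \<in> ell2 I \<Longrightarrow> T (\<lambda>i. f i - h i) = (\<lambda>i. T f i - T h i)"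
  using bounded_ops_add[of T I f "\<lambda>i. - 1 * h i"] bounded_ops_cmult[of T I h "-1"] ell2_cmult[of h I "-1"]
  by simp

lemma bounded_ops_eqI:
  assumes "T \<in> bounded_ops I" "U \<in> bounded_ops I" "\<And>f. f \<in> ell2 I \<Longrightarrow> T f = U f"
  shows "T = U"
  using assms by (meson bounded_ops_extensional extensionalityI)

lemma bounded_ops_finite_sum:
  assumes T: "T \<in> bounded_ops I" and "finite F" "F \<subseteq> I"
  shows "T (\<lambda>i. if i \<in> F then u i else 0) = (\<lambda>k. \<Sum>i\<in>F. u i * T (unit_fun i) k)"
  using assms(2,3)
proof (induction F)
  case empty
  show ?case using bounded_ops_zero[OF T] by simp
next
  case (insert j F)
  have "(\<lambda>i. if i \<in> insert j F then u i else 0) = (\<lambda>i. u j * unit_fun j i + (if i \<in> F then u i else 0))"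
    using insert.hyps by (auto simp: unit_fun_def)
  moreover have "(\<lambda>i. if i \<in> F then u i else 0) \<in> ell2 I"
    using insert by (intro ell2_finite_support) auto
  moreover have "unit_fun j \<in> ell2 I" using insert.prems by simp
  ultimately show ?case
    using insert bounded_ops_add[OF T, of "\<lambda>i. u j * unit_fun j i"] bounded_ops_cmult[OF T, of "unit_fun j"]
    by simp
qed

lemma l2_inner_bounded_ops_finite_sum:
  assumes T: "T \<in> bounded_ops I" and f: "f \<in> ell2 I" and "finite F" "F \<subseteq> I"
  shows "l2_inner f (T (\<lambda>i. if i \<in> F then u i else 0)) = (\<Sum>i\<in>F. u i * l2_inner f (T (unit_fun i)))"
proof -
  have "l2_inner f (\<lambda>k. \<Sum>i\<in>F. u i * T (unit_fun i) k) = (\<Sum>i\<in>F. u i * l2_inner f (T (unit_fun i)))"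
    using assms(3,4)
  proof (induction F)
    case (insert j F)
    have F: "F \<subseteq> I" "j \<in> I" using insert.prems by auto
    have "T (\<lambda>i. if i \<in> F then u i else 0) \<in> ell2 I"
      by (rule bounded_ops_ell2[OF T ell2_finite_support(1)[OF insert.hyps(1) F(1)]])
    then have "(\<lambda>k. \<Sum>i\<in>F. u i * T (unit_fun i) k) \<in> ell2 I"
      unfolding bounded_ops_finite_sum[OF T insert.hyps(1) F(1)] .
    moreover have "(\<lambda>k. u j * T (unit_fun j) k) \<in> ell2 I" using T F by simp
    ultimately show ?case
      using insert.hyps insert.IH[OF F(1)] l2_inner_add_right[OF f]
      by (simp add: l2_inner_cmult_right)
  qed (simp add: l2_inner_def)
  then show ?thesis unfolding bounded_ops_finite_sum[OF T assms(3,4)] .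
qed

text \<open>The adjoint is given by its coordinates: \<open>u f i\<close> is the inner product of T
  applied to the unit vector at i with f. The adjoint equation holds for finitely supported h by
  linearity and extends by truncation.\<close>

lemma adjoint_exists:
  assumes T: "T \<in> bounded_ops I"
  shows "\<exists>U\<in>bounded_ops I. \<forall>f\<in>ell2 I. \<forall>h\<in>ell2 I. l2_inner (U f) h = l2_inner f (T h)"
proof -
  obtain C where C: "0 \<le> C" "op_bound I T C" using T by (rule bounded_ops_bound)
  define u where "u f i = (if i \<in> I then l2_inner (T (unit_fun i)) f else 0)" for f i
  \<comment> \<open>Test against v, the restriction of \<open>u f\<close> to F: its squared norm is
    the inner product of f with T v, hence at most |f| C |v|, and one factor |v| cancels.\<close>
  have fin: "L2_set (\<lambda>i. cmod (u f i)) F \<le> C * l2_norm f" if f: "f \<in> ell2 I" and F: "finite F" "F \<subseteq> I" for f F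
  proof -
    let ?v = "\<lambda>i. if i \<in> F then u f i else 0"
    let ?L = "L2_set (\<lambda>i. cmod (u f i)) F"
    have v: "?v \<in> ell2 I" "l2_norm ?v = ?L" using ell2_finite_support[OF F] by blast+
    have "l2_inner f (T ?v) = (\<Sum>i\<in>F. u f i * l2_inner f (T (unit_fun i)))"
      by (rule l2_inner_bounded_ops_finite_sum[OF T f F])
    also have "\<dots> = (\<Sum>i\<in>F. u f i * cnj (u f i))"
      using F by (intro sum.cong refl) (auto simp: u_def l2_inner_cnj[of f])
    also have "\<dots> = complex_of_real (?L\<^sup>2)"
      unfolding complex_norm_square[symmetric] by (simp add: L2_set_def sum_nonneg)
    finally have "?L\<^sup>2 = cmod (l2_inner f (T ?v))" by (simp add: norm_power)
    also have "\<dots> \<le> l2_norm f * l2_norm (T ?v)" using f v T by (intro l2_inner_bound[where I=I and J=I]) auto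
    also have "\<dots> \<le> l2_norm f * (C * ?L)"
      using C(2) v unfolding op_bound_def by (intro mult_left_mono) auto
    finally have "?L * ?L \<le> (C * l2_norm f) * ?L" by (simp add: power2_eq_square algebra_simps)
    then show ?thesis
      using C(1) by (cases "?L = 0") (auto simp: mult_le_cancel_right less_le)
  qed
  have bd: "L2_set (\<lambda>i. cmod (u f i)) F \<le> C * l2_norm f" if f: "f \<in> ell2 I" and F: "finite F" for f F
  proof -
    have "L2_set (\<lambda>i. cmod (u f i)) F = L2_set (\<lambda>i. cmod (u f i)) (F \<inter> I)"
      unfolding L2_set_def using F by (intro arg_cong[of _ _ sqrt] sum.mono_neutral_right) (auto simp: u_def)
    then show ?thesis using fin[OF f, of "F \<inter> I"] F by simp
  qed
  have u: "u f \<in> ell2 I" "l2_norm (u f) \<le> C * l2_norm f" if "f \<in> ell2 I" for f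
    using ell2_boundI[of I "u f" "C * l2_norm f"] bd[OF that] by (auto simp: u_def)
  define U where "U = (\<lambda>f\<in>ell2 I. u f)"
  have "U \<in> bounded_ops I"
  proof (rule bounded_opsI)
    show "U \<in> ell2 I \<rightarrow>\<^sub>E ell2 I" using u by (auto simp: U_def)
    show "U (\<lambda>i. f i + h i) = (\<lambda>i. U f i + U h i)" if "f \<in> ell2 I" "h \<in> ell2 I" for f h
    proof
      fix i show "U (\<lambda>i. f i + h i) i = U f i + U h i"
      proof (cases "i \<in> I")
        case True
        then have "T (unit_fun i) \<in> ell2 I" using T by simp
        then show ?thesis using that True by (simp add: U_def u_def l2_inner_add_right)
      qed (use that in \<open>simp add: U_def u_def\<close>)
    qed
    show "U (\<lambda>i. z * f i) = (\<lambda>i. z * U f i)" if "f \<in> ell2 I" for z f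
      using that by (auto simp: U_def u_def l2_inner_cmult_right)
    show "op_bound I U C" using u by (simp add: op_bound_def U_def)
  qed
  moreover have "l2_inner (U f) h = l2_inner f (T h)" if f: "f \<in> ell2 I" and h: "h \<in> ell2 I" for f h
  proof -
    have "cmod (l2_inner (u f) h - l2_inner f (T h)) \<le> \<epsilon>" if "0 < \<epsilon>" for \<epsilon>
    proof -
      \<comment> \<open>Each of the two truncation errors is at most C |f| |w|; the summand 1 keeps
        K positive when C |f| = 0.\<close>
      define K where "K = 2 * C * l2_norm f + 1"
      have K: "0 < K" using C(1) by (simp add: K_def add_nonneg_pos)
      obtain F where F: "finite F" "F \<subseteq> I" "l2_norm (\<lambda>i. h i - (if i \<in> F then h i else 0)) \<le> \<epsilon> / K"
        using ell2_truncate[OF h, of "\<epsilon> / K"] \<open>0 < \<epsilon>\<close> K by auto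
      let ?v = "\<lambda>i. if i \<in> F then h i else 0"
      let ?w = "\<lambda>i. h i - ?v i"
      have v: "?v \<in> ell2 I" using F by (intro ell2_finite_support)
      then have w: "?w \<in> ell2 I" using h by simp
      have "l2_inner f (T ?v) = l2_inner (u f) ?v"
        unfolding l2_inner_bounded_ops_finite_sum[OF T f F(1,2)] l2_inner_cnj[of "u f"]
          l2_inner_finite_support[OF F(1)] cnj_sum
        using F(2) by (intro sum.cong refl) (auto simp: u_def l2_inner_cnj[of f])
      then have "l2_inner (u f) h - l2_inner f (T h) = l2_inner (u f) ?w - l2_inner f (T ?w)"
        unfolding bounded_ops_diff[OF T h v]
        using l2_inner_diff_right[OF u(1)[OF f] h v]
          l2_inner_diff_right[OF f bounded_ops_ell2[OF T h] bounded_ops_ell2[OF T v]] by simp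
      then have "cmod (l2_inner (u f) h - l2_inner f (T h)) \<le> cmod (l2_inner (u f) ?w) + cmod (l2_inner f (T ?w))"
        by (simp add: norm_triangle_ineq4)
      also have "\<dots> \<le> l2_norm (u f) * l2_norm ?w + l2_norm f * l2_norm (T ?w)"
        using f w u T by (intro add_mono l2_inner_bound[where I=I and J=I]) auto
      also have "\<dots> \<le> (C * l2_norm f) * l2_norm ?w + l2_norm f * (C * l2_norm ?w)"
        using C(2) w u(2)[OF f] unfolding op_bound_def by (intro add_mono mult_left_mono mult_right_mono) auto
      also have "\<dots> \<le> K * l2_norm ?w" by (simp add: K_def algebra_simps)
      also have "\<dots> \<le> \<epsilon>" using F(3) K by (simp add: field_simps)
      finally show ?thesis .
    qed
    then have "cmod (l2_inner (u f) h - l2_inner f (T h)) \<le> 0" by (rule field_le_epsilon) simp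
    then show ?thesis using f by (simp add: U_def)
  qed
  ultimately show ?thesis by blast
qed

section \<open>Star-algebra operations on bounded operators and their norm bounds\<close>

lemma bounded_op_algebra_simps:
  "carrier (bounded_op_algebra I) = bounded_ops I"
  "mult (bounded_op_algebra I) = compose (ell2 I)"
  "one (bounded_op_algebra I) = (\<lambda>f\<in>ell2 I. f)"
  "zero (bounded_op_algebra I) = (\<lambda>f\<in>ell2 I. \<lambda>i. 0)"
  "add (bounded_op_algebra I) = (\<lambda>T U. \<lambda>f\<in>ell2 I. \<lambda>i. T f i + U f i)"
  "smult (bounded_op_algebra I) = (\<lambda>z T. \<lambda>f\<in>ell2 I. \<lambda>i. z * T f i)"
  by (simp_all add: bounded_op_algebra_def)

abbreviation op_star :: "'i set \<Rightarrow> 'i l2_op \<Rightarrow> 'i l2_op" where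
  "op_star I \<equiv> star (bounded_op_algebra I)"

text \<open>Two adjoints agree in each coordinate, as pairing with the unit vectors shows; with
  \<open>adjoint_exists\<close> this resolves the definite description.\<close>

lemma
  assumes T: "T \<in> bounded_ops I"
  shows op_star_closed [simp]: "op_star I T \<in> bounded_ops I"
    and op_star_inner: "f \<in> ell2 I \<Longrightarrow> h \<in> ell2 I \<Longrightarrow> l2_inner (op_star I T f) h = l2_inner f (T h)"
    and op_star_unique: "U \<in> bounded_ops I \<Longrightarrow>
      (\<And>f h. f \<in> ell2 I \<Longrightarrow> h \<in> ell2 I \<Longrightarrow> l2_inner (U f) h = l2_inner f (T h)) \<Longrightarrow> op_star I T = U"
proof -
  let ?P = "\<lambda>U. U \<in> bounded_ops I \<and> (\<forall>f\<in>ell2 I. \<forall>h\<in>ell2 I. l2_inner (U f) h = l2_inner f (T h))"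
  have unique: "U = V" if "?P U" "?P V" for U V
  proof (rule bounded_ops_eqI)
    fix f assume f: "f \<in> ell2 I"
    show "U f = V f"
    proof
      fix i show "U f i = V f i"
      proof (cases "i \<in> I")
        case True
        then have "l2_inner (U f) (unit_fun i) = l2_inner (V f) (unit_fun i)" using that f by simp
        then show ?thesis by (simp add: l2_inner_cnj[of _ "unit_fun i"])
      next
        case False
        then show ?thesis using that f ell2_eq_0 bounded_ops_ell2 by metis
      qed
    qed
  qed (use that in auto)
  obtain V where V: "?P V" using adjoint_exists[OF T] by blast
  have star: "op_star I T = (THE U. ?P U)" by (simp add: bounded_op_algebra_def)
  have "?P (op_star I T)" unfolding star by (rule theI[of ?P V]) (use V unique in blast)+
  then show "op_star I T \<in> bounded_ops I"
    and "f \<in> ell2 I \<Longrightarrow> h \<in> ell2 I \<Longrightarrow> l2_inner (op_star I T f) h = l2_inner f (T h)"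
    and "U \<in> bounded_ops I \<Longrightarrow>
      (\<And>f h. f \<in> ell2 I \<Longrightarrow> h \<in> ell2 I \<Longrightarrow> l2_inner (U f) h = l2_inner f (T h)) \<Longrightarrow> op_star I T = U"
    using unique by blast+
qed

abbreviation ops :: "'i set \<Rightarrow> 'i l2_op star_algebra" where "ops \<equiv> bounded_op_algebra"

lemma op_mult_apply [simp]: "f \<in> ell2 I \<Longrightarrow> (T \<otimes>\<^bsub>ops I\<^esub> U) f = T (U f)"
  and op_add_apply [simp]: "f \<in> ell2 I \<Longrightarrow> (T \<oplus>\<^bsub>ops I\<^esub> U) f = (\<lambda>i. T f i + U f i)"
  and op_smult_apply [simp]: "f \<in> ell2 I \<Longrightarrow> (z \<odot>\<^bsub>ops I\<^esub> T) f = (\<lambda>i. z * T f i)"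
  and op_one_apply [simp]: "f \<in> ell2 I \<Longrightarrow> \<one>\<^bsub>ops I\<^esub> f = f"
  and op_zero_apply [simp]: "f \<in> ell2 I \<Longrightarrow> \<zero>\<^bsub>ops I\<^esub> f = (\<lambda>i. 0)"
  by (simp_all add: bounded_op_algebra_simps compose_def)

lemma carrier_ops [simp]: "carrier (ops I) = bounded_ops I"
  by (simp add: bounded_op_algebra_simps)

lemma op_bound_mult:
  assumes "U \<in> bounded_ops I" "0 \<le> C" "op_bound I T C" "op_bound I U D"
  shows "op_bound I (T \<otimes>\<^bsub>ops I\<^esub> U) (C * D)"
  unfolding op_bound_def
proof
  fix f assume f: "f \<in> ell2 I"
  have "l2_norm (T (U f)) \<le> C * l2_norm (U f)" using assms f by (simp add: op_bound_def)
  also have "\<dots> \<le> C * (D * l2_norm f)" using assms f by (simp add: op_bound_def mult_left_mono)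
  finally show "l2_norm ((T \<otimes>\<^bsub>ops I\<^esub> U) f) \<le> C * D * l2_norm f" using f by (simp add: mult.assoc)
qed

lemma op_mult_closed [simp, intro]:
  assumes T: "T \<in> bounded_ops I" and U: "U \<in> bounded_ops I" shows "T \<otimes>\<^bsub>ops I\<^esub> U \<in> bounded_ops I"
proof -
  obtain C where C: "0 \<le> C" "op_bound I T C" using T by (rule bounded_ops_bound)
  obtain D where D: "op_bound I U D" using U by (rule bounded_ops_bound)
  show ?thesis
    using T U op_bound_mult[OF U C D] by (intro bounded_opsI) (auto simp: bounded_ops_add bounded_ops_cmult
        bounded_op_algebra_simps compose_def)
qed

lemma op_add_closed [simp, intro]:
  assumes "T \<in> bounded_ops I" "U \<in> bounded_ops I" shows "T \<oplus>\<^bsub>ops I\<^esub> U \<in> bounded_ops I"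
proof -
  obtain C where C: "op_bound I T C" using assms(1) by (rule bounded_ops_bound)
  obtain D where D: "op_bound I U D" using assms(2) by (rule bounded_ops_bound)
  have "op_bound I (T \<oplus>\<^bsub>ops I\<^esub> U) (C + D)"
    unfolding op_bound_def
  proof
    fix f assume f: "f \<in> ell2 I"
    have "l2_norm (\<lambda>i. T f i + U f i) \<le> l2_norm (T f) + l2_norm (U f)"
      using f assms by (intro l2_norm_add_le[of _ I]) auto
    also have "\<dots> \<le> C * l2_norm f + D * l2_norm f"
      using C D f by (intro add_mono) (auto simp: op_bound_def)
    finally show "l2_norm ((T \<oplus>\<^bsub>ops I\<^esub> U) f) \<le> (C + D) * l2_norm f"
      using f by (simp add: distrib_right)
  qed
  then show ?thesis
    using assms by (intro bounded_opsI) (auto simp: bounded_ops_add bounded_ops_cmult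
        bounded_op_algebra_simps algebra_simps)
qed

lemma op_bound_smult:
  assumes "T \<in> bounded_ops I" "op_bound I T C" shows "op_bound I (z \<odot>\<^bsub>ops I\<^esub> T) (cmod z * C)"
  unfolding op_bound_def
proof
  fix f assume f: "f \<in> ell2 I"
  have "l2_norm (\<lambda>i. z * T f i) \<le> cmod z * l2_norm (T f)"
    using f assms by (intro l2_norm_cmult_le[of _ I]) auto
  also have "\<dots> \<le> cmod z * (C * l2_norm f)"
    using assms f by (intro mult_left_mono) (auto simp: op_bound_def)
  finally show "l2_norm ((z \<odot>\<^bsub>ops I\<^esub> T) f) \<le> cmod z * C * l2_norm f" using f by (simp add: mult.assoc)
qed

lemma op_smult_closed [simp, intro]:
  assumes "T \<in> bounded_ops I" shows "z \<odot>\<^bsub>ops I\<^esub> T \<in> bounded_ops I"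
proof -
  obtain C where C: "op_bound I T C" using assms(1) by (rule bounded_ops_bound)
  then show ?thesis
    using assms op_bound_smult[OF assms C] by (intro bounded_opsI) (auto simp: bounded_ops_add bounded_ops_cmult
        bounded_op_algebra_simps algebra_simps)
qed

lemma op_one_closed [simp, intro]: "\<one>\<^bsub>ops I\<^esub> \<in> bounded_ops I"
  by (rule bounded_opsI[of _ _ 1]) (auto simp: bounded_op_algebra_simps op_bound_def)

lemma op_zero_closed [simp, intro]: "\<zero>\<^bsub>ops I\<^esub> \<in> bounded_ops I"
  by (rule bounded_opsI[of _ _ 1]) (auto simp: bounded_op_algebra_simps op_bound_def)

lemma op_mult_assoc:
  assumes "T \<in> bounded_ops I" "U \<in> bounded_ops I" "V \<in> bounded_ops I"
  shows "(T \<otimes>\<^bsub>ops I\<^esub> U) \<otimes>\<^bsub>ops I\<^esub> V = T \<otimes>\<^bsub>ops I\<^esub> (U \<otimes>\<^bsub>ops I\<^esub> V)"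
  by (rule bounded_ops_eqI[of _ I]) (use assms in auto)

lemma op_one_mult: "T \<in> bounded_ops I \<Longrightarrow> \<one>\<^bsub>ops I\<^esub> \<otimes>\<^bsub>ops I\<^esub> T = T"
  and op_mult_one: "T \<in> bounded_ops I \<Longrightarrow> T \<otimes>\<^bsub>ops I\<^esub> \<one>\<^bsub>ops I\<^esub> = T"
  by (rule bounded_ops_eqI[of _ I]; auto)+

lemma op_add_mult: "T \<in> bounded_ops I \<Longrightarrow> U \<in> bounded_ops I \<Longrightarrow> V \<in> bounded_ops I \<Longrightarrow>
    (T \<oplus>\<^bsub>ops I\<^esub> U) \<otimes>\<^bsub>ops I\<^esub> V = T \<otimes>\<^bsub>ops I\<^esub> V \<oplus>\<^bsub>ops I\<^esub> U \<otimes>\<^bsub>ops I\<^esub> V"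
  and op_mult_add: "T \<in> bounded_ops I \<Longrightarrow> U \<in> bounded_ops I \<Longrightarrow> V \<in> bounded_ops I \<Longrightarrow>
    T \<otimes>\<^bsub>ops I\<^esub> (U \<oplus>\<^bsub>ops I\<^esub> V) = T \<otimes>\<^bsub>ops I\<^esub> U \<oplus>\<^bsub>ops I\<^esub> T \<otimes>\<^bsub>ops I\<^esub> V"
  by (rule bounded_ops_eqI[of _ I]; auto simp: bounded_ops_add)+

lemma op_smult_mult: "T \<in> bounded_ops I \<Longrightarrow> U \<in> bounded_ops I \<Longrightarrow>
    (z \<odot>\<^bsub>ops I\<^esub> T) \<otimes>\<^bsub>ops I\<^esub> U = z \<odot>\<^bsub>ops I\<^esub> (T \<otimes>\<^bsub>ops I\<^esub> U)"
  and op_mult_smult: "T \<in> bounded_ops I \<Longrightarrow> U \<in> bounded_ops I \<Longrightarrow>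
    T \<otimes>\<^bsub>ops I\<^esub> (z \<odot>\<^bsub>ops I\<^esub> U) = z \<odot>\<^bsub>ops I\<^esub> (T \<otimes>\<^bsub>ops I\<^esub> U)"
  by (rule bounded_ops_eqI[of _ I]; auto simp: bounded_ops_cmult)+

lemma op_smult_smult: "T \<in> bounded_ops I \<Longrightarrow> z \<odot>\<^bsub>ops I\<^esub> (w \<odot>\<^bsub>ops I\<^esub> T) = (z * w) \<odot>\<^bsub>ops I\<^esub> T"
  and op_one_smult: "T \<in> bounded_ops I \<Longrightarrow> 1 \<odot>\<^bsub>ops I\<^esub> T = T"
  by (rule bounded_ops_eqI[of _ I]; auto simp: mult.assoc)+

lemma op_star_star: assumes "T \<in> bounded_ops I" shows "op_star I (op_star I T) = T"
proof (rule op_star_unique)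
  fix f h assume "f \<in> ell2 I" "h \<in> ell2 I"
  then show "l2_inner (T f) h = l2_inner f (op_star I T h)"
    using assms op_star_inner[OF assms, of h f] l2_inner_cnj[of "T f" h] l2_inner_cnj[of f "op_star I T h"]
    by simp
qed (use assms in auto)

lemma op_star_mult:
  assumes "T \<in> bounded_ops I" "U \<in> bounded_ops I"
  shows "op_star I (T \<otimes>\<^bsub>ops I\<^esub> U) = op_star I U \<otimes>\<^bsub>ops I\<^esub> op_star I T"
  by (rule op_star_unique) (use assms in \<open>auto simp: op_star_inner\<close>)

lemma op_star_smult:
  assumes "T \<in> bounded_ops I" shows "op_star I (z \<odot>\<^bsub>ops I\<^esub> T) = cnj z \<odot>\<^bsub>ops I\<^esub> op_star I T"
  by (rule op_star_unique)
    (use assms in \<open>auto simp: op_star_inner l2_inner_cmult_left l2_inner_cmult_right\<close>)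

lemma op_star_add:
  assumes "T \<in> bounded_ops I" "U \<in> bounded_ops I"
  shows "op_star I (T \<oplus>\<^bsub>ops I\<^esub> U) = op_star I T \<oplus>\<^bsub>ops I\<^esub> op_star I U"
proof (rule op_star_unique)
  fix f h assume fh: "f \<in> ell2 I" "h \<in> ell2 I"
  then have "op_star I T f \<in> ell2 I" "op_star I U f \<in> ell2 I" "T h \<in> ell2 I" "U h \<in> ell2 I"
    using assms by auto
  then show "l2_inner ((op_star I T \<oplus>\<^bsub>ops I\<^esub> op_star I U) f) h = l2_inner f ((T \<oplus>\<^bsub>ops I\<^esub> U) h)"
    using assms fh l2_inner_add_left[of h I "op_star I T f" I "op_star I U f" I]
      l2_inner_add_right[of f I "T h" I "U h" I]
    by (simp add: op_star_inner)
qed (use assms in auto)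

text \<open>The squared norm of T* f is the inner product of f with T T* f, hence at most |f| C |T*
  f|; one factor cancels.\<close>

lemma op_bound_star:
  assumes T: "T \<in> bounded_ops I" and C: "0 \<le> C" "op_bound I T C" shows "op_bound I (op_star I T) C"
  unfolding op_bound_def
proof
  fix f assume f: "f \<in> ell2 I"
  let ?g = "op_star I T f"
  have g: "?g \<in> ell2 I" using T f by simp
  have "complex_of_real ((l2_norm ?g)\<^sup>2) = l2_inner f (T ?g)"
    using op_star_inner[OF T f g] l2_inner_self[OF g] by simp
  then have "(l2_norm ?g)\<^sup>2 = cmod (l2_inner f (T ?g))" by (metis abs_of_nonneg norm_of_real zero_le_power2)
  also have "\<dots> \<le> l2_norm f * l2_norm (T ?g)" using f g T by (intro l2_inner_bound[of f I _ I]) auto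
  also have "\<dots> \<le> l2_norm f * (C * l2_norm ?g)"
    using C g by (intro mult_left_mono) (auto simp: op_bound_def)
  finally have "l2_norm ?g * l2_norm ?g \<le> (C * l2_norm f) * l2_norm ?g"
    by (simp add: power2_eq_square algebra_simps)
  then show "l2_norm ?g \<le> C * l2_norm f"
    using C(1) by (cases "l2_norm ?g = 0") (auto simp: mult_le_cancel_right less_le)
qed

subsection \<open>Norm-closed spaces of operators\<close>

text \<open>Written with the algebra operations, so that linear and conjugate-linear maps pass
  through it by their rules for sums and scalars.\<close>

definition op_diff :: "'i set \<Rightarrow> 'i l2_op \<Rightarrow> 'i l2_op \<Rightarrow> 'i l2_op" where
  "op_diff I T U = T \<oplus>\<^bsub>ops I\<^esub> (-1) \<odot>\<^bsub>ops I\<^esub> U"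

lemma op_diff_closed [simp, intro]:
  "T \<in> bounded_ops I \<Longrightarrow> U \<in> bounded_ops I \<Longrightarrow> op_diff I T U \<in> bounded_ops I"
  and op_diff_apply [simp]: "f \<in> ell2 I \<Longrightarrow> op_diff I T U f = (\<lambda>i. T f i - U f i)"
  by (simp_all add: op_diff_def)

lemma op_diff_triangle:
  assumes "T \<in> bounded_ops I" "U \<in> bounded_ops I" "V \<in> bounded_ops I"
    "op_bound I (op_diff I T U) C" "op_bound I (op_diff I U V) D"
  shows "op_bound I (op_diff I T V) (C + D)"
  unfolding op_bound_def
proof
  fix f assume f: "f \<in> ell2 I"
  have "l2_norm (\<lambda>i. (T f i - U f i) + (U f i - V f i)) \<le>
      l2_norm (\<lambda>i. T f i - U f i) + l2_norm (\<lambda>i. U f i - V f i)"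
    using assms f by (intro l2_norm_add_le[of _ I] ell2_diff) auto
  also have "\<dots> \<le> C * l2_norm f + D * l2_norm f"
    using assms f by (intro add_mono) (auto simp: op_bound_def)
  finally show "l2_norm (op_diff I T V f) \<le> (C + D) * l2_norm f" using f by (simp add: distrib_right)
qed

text \<open>Such spaces serve as induction predicates: a property that cuts one out and holds for
  the generators holds on their closed span. Closedness is stated by approximation, without
  sequences.\<close>

definition closed_op_space :: "'i set \<Rightarrow> 'i l2_op set \<Rightarrow> bool" where
  "closed_op_space I V \<longleftrightarrow> V \<subseteq> bounded_ops I \<and> \<zero>\<^bsub>ops I\<^esub> \<in> V \<and>
     (\<forall>T\<in>V. \<forall>U\<in>V. T \<oplus>\<^bsub>ops I\<^esub> U \<in> V) \<and> (\<forall>z. \<forall>T\<in>V. z \<odot>\<^bsub>ops I\<^esub> T \<in> V) \<and>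
     (\<forall>T\<in>bounded_ops I. (\<forall>\<epsilon>>0. \<exists>U\<in>V. op_bound I (op_diff I T U) \<epsilon>) \<longrightarrow> T \<in> V)"

lemma closed_op_spaceI:
  assumes "V \<subseteq> bounded_ops I" "\<zero>\<^bsub>ops I\<^esub> \<in> V"
    and "\<And>T U. T \<in> V \<Longrightarrow> U \<in> V \<Longrightarrow> T \<oplus>\<^bsub>ops I\<^esub> U \<in> V"
    and "\<And>z T. T \<in> V \<Longrightarrow> z \<odot>\<^bsub>ops I\<^esub> T \<in> V"
    and "\<And>T. T \<in> bounded_ops I \<Longrightarrow> (\<And>\<epsilon>. 0 < \<epsilon> \<Longrightarrow> \<exists>U\<in>V. op_bound I (op_diff I T U) \<epsilon>) \<Longrightarrow> T \<in> V"
  shows "closed_op_space I V"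
  using assms unfolding closed_op_space_def by blast

lemma
  assumes "closed_op_space I V"
  shows closed_op_space_zero: "\<zero>\<^bsub>ops I\<^esub> \<in> V"
    and closed_op_space_add: "T \<in> V \<Longrightarrow> U \<in> V \<Longrightarrow> T \<oplus>\<^bsub>ops I\<^esub> U \<in> V"
    and closed_op_space_smult: "T \<in> V \<Longrightarrow> z \<odot>\<^bsub>ops I\<^esub> T \<in> V"
    and closed_op_space_limit: "T \<in> bounded_ops I \<Longrightarrow>
      (\<And>\<epsilon>. 0 < \<epsilon> \<Longrightarrow> \<exists>U\<in>V. op_bound I (op_diff I T U) \<epsilon>) \<Longrightarrow> T \<in> V"
  using assms unfolding closed_op_space_def by blast+

lemma closed_op_space_bounded_ops: "closed_op_space I (bounded_ops I)"
  by (rule closed_op_spaceI) auto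

lemma op_bound_0: assumes T: "T \<in> bounded_ops I" and "op_bound I T 0" shows "T = \<zero>\<^bsub>ops I\<^esub>"
proof (rule bounded_ops_eqI[OF T op_zero_closed])
  fix f assume f: "f \<in> ell2 I"
  then have "l2_norm (T f) \<le> 0" using assms(2) by (simp add: op_bound_def)
  then have "T f = (\<lambda>i. 0)" using T f by (intro l2_norm_eq_0[of _ I]) auto
  then show "T f = \<zero>\<^bsub>ops I\<^esub> f" using f by simp
qed

lemma closed_op_space_singleton: "closed_op_space I {\<zero>\<^bsub>ops I\<^esub>}"
proof (rule closed_op_spaceI)
  show "T \<oplus>\<^bsub>ops I\<^esub> U \<in> {\<zero>\<^bsub>ops I\<^esub>}" if "T \<in> {\<zero>\<^bsub>ops I\<^esub>}" "U \<in> {\<zero>\<^bsub>ops I\<^esub>}" for T U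
    using that by (auto intro: bounded_ops_eqI[of _ I])
  show "z \<odot>\<^bsub>ops I\<^esub> T \<in> {\<zero>\<^bsub>ops I\<^esub>}" if "T \<in> {\<zero>\<^bsub>ops I\<^esub>}" for z T
    using that by (auto intro: bounded_ops_eqI[of _ I])
  fix T assume T: "T \<in> bounded_ops I"
    and "\<And>\<epsilon>. 0 < \<epsilon> \<Longrightarrow> \<exists>U\<in>{\<zero>\<^bsub>ops I\<^esub>}. op_bound I (op_diff I T U) \<epsilon>"
  then have b: "op_bound I T \<epsilon>" if "0 < \<epsilon>" for \<epsilon> using that by (fastforce simp: op_bound_def)
  have "l2_norm (T f) \<le> 0" if f: "f \<in> ell2 I" for f
  proof (rule field_le_epsilon)
    fix e :: real assume e: "0 < e"
    \<comment> \<open>The summand 1 in the denominator avoids a case distinction on vectors of norm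
      0.\<close>
    have "l2_norm (T f) \<le> e / (l2_norm f + 1) * l2_norm f"
      using b[of "e / (l2_norm f + 1)"] f e by (simp add: op_bound_def add_nonneg_pos)
    also have "\<dots> = e * (l2_norm f / (l2_norm f + 1))" by simp
    also have "\<dots> \<le> e" using e by (intro mult_left_le) (auto simp: divide_le_eq add_nonneg_pos)
    finally show "l2_norm (T f) \<le> 0 + e" by simp
  qed
  then show "T \<in> {\<zero>\<^bsub>ops I\<^esub>}" using op_bound_0[OF T] by (simp add: op_bound_def)
qed auto

text \<open>The factor \<open>\<kappa>\<close> allows conjugate-linear maps such as the adjoint.\<close>

lemma closed_op_space_vimage:
  assumes V: "closed_op_space I V"
    and closed: "\<And>T. T \<in> bounded_ops I \<Longrightarrow> \<phi> T \<in> bounded_ops I"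
    and add: "\<And>T U. T \<in> bounded_ops I \<Longrightarrow> U \<in> bounded_ops I \<Longrightarrow> \<phi> (T \<oplus>\<^bsub>ops I\<^esub> U) = \<phi> T \<oplus>\<^bsub>ops I\<^esub> \<phi> U"
    and smult: "\<And>z T. T \<in> bounded_ops I \<Longrightarrow> \<phi> (z \<odot>\<^bsub>ops I\<^esub> T) = \<kappa> z \<odot>\<^bsub>ops I\<^esub> \<phi> T"
    and \<kappa>: "\<kappa> (-1) = -1"
    and K: "0 \<le> K" "\<And>T C. T \<in> bounded_ops I \<Longrightarrow> 0 \<le> C \<Longrightarrow> op_bound I T C \<Longrightarrow> op_bound I (\<phi> T) (K * C)"
  shows "closed_op_space I {T \<in> bounded_ops I. \<phi> T \<in> V}"
proof (rule closed_op_spaceI)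
  \<comment> \<open>That the map sends 0 to 0 is read off its norm bound with C = 0.\<close>
  have "op_bound I \<zero>\<^bsub>ops I\<^esub> 0" by (simp add: op_bound_def)
  then have "op_bound I (\<phi> \<zero>\<^bsub>ops I\<^esub>) 0" using K(2)[of "\<zero>\<^bsub>ops I\<^esub>" 0] by simp
  then have "\<phi> \<zero>\<^bsub>ops I\<^esub> = \<zero>\<^bsub>ops I\<^esub>" using closed by (intro op_bound_0) auto
  then show "\<zero>\<^bsub>ops I\<^esub> \<in> {T \<in> bounded_ops I. \<phi> T \<in> V}" using closed_op_space_zero[OF V] by simp
  fix T assume T: "T \<in> bounded_ops I"
    and lim: "\<And>\<epsilon>. 0 < \<epsilon> \<Longrightarrow> \<exists>U\<in>{T \<in> bounded_ops I. \<phi> T \<in> V}. op_bound I (op_diff I T U) \<epsilon>"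
  have "\<exists>U\<in>V. op_bound I (op_diff I (\<phi> T) U) \<epsilon>" if e: "0 < \<epsilon>" for \<epsilon>
  proof -
    \<comment> \<open>The divisor is K + 1 because K may be 0.\<close>
    have pos: "0 < \<epsilon> / (K + 1)" using e K(1) by simp
    then obtain U where U: "U \<in> bounded_ops I" "\<phi> U \<in> V" "op_bound I (op_diff I T U) (\<epsilon> / (K + 1))"
      using lim by blast
    have "\<phi> (op_diff I T U) = op_diff I (\<phi> T) (\<phi> U)"
      using T U by (simp add: op_diff_def add smult \<kappa>)
    then have "op_bound I (op_diff I (\<phi> T) (\<phi> U)) (K * (\<epsilon> / (K + 1)))"
      using K(2)[OF _ _ U(3)] T U pos by simp
    moreover have "K * (\<epsilon> / (K + 1)) \<le> \<epsilon>" using e K(1) by (simp add: field_simps)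
    ultimately have "op_bound I (op_diff I (\<phi> T) (\<phi> U)) \<epsilon>"
      unfolding op_bound_def by (meson l2_norm_nonneg mult_right_mono order_trans)
    then show ?thesis using U by blast
  qed
  then show "T \<in> {T \<in> bounded_ops I. \<phi> T \<in> V}"
    using T closed closed_op_space_limit[OF V] by simp
qed (auto simp: add smult closed_op_space_add[OF V] closed_op_space_smult[OF V])

lemma closed_op_space_mult_left:
  assumes V: "closed_op_space I V" and U: "U \<in> bounded_ops I"
  shows "closed_op_space I {T \<in> bounded_ops I. U \<otimes>\<^bsub>ops I\<^esub> T \<in> V}"
proof -
  obtain K where K: "0 \<le> K" "op_bound I U K" using U by (rule bounded_ops_bound)
  show ?thesis
    by (rule closed_op_space_vimage[OF V, where \<kappa>="\<lambda>z. z" and K=K])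
      (use U K op_bound_mult[of _ I K U] in \<open>auto simp: op_mult_add op_mult_smult\<close>)
qed

lemma closed_op_space_mult_right:
  assumes V: "closed_op_space I V" and U: "U \<in> bounded_ops I"
  shows "closed_op_space I {T \<in> bounded_ops I. T \<otimes>\<^bsub>ops I\<^esub> U \<in> V}"
proof -
  obtain K where K: "0 \<le> K" "op_bound I U K" using U by (rule bounded_ops_bound)
  show ?thesis
    by (rule closed_op_space_vimage[OF V, where \<kappa>="\<lambda>z. z" and K=K])
      (use U K op_bound_mult[of U I _ _ K] in \<open>auto simp: op_add_mult op_smult_mult mult.commute\<close>)
qed

lemma closed_op_space_star:
  assumes V: "closed_op_space I V"
  shows "closed_op_space I {T \<in> bounded_ops I. op_star I T \<in> V}"
  by (rule closed_op_space_vimage[OF V, where \<kappa>=cnj and K=1])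
    (use op_bound_star in \<open>auto simp: op_star_add op_star_smult\<close>)

text \<open>The commutant is the preimage of the zero space under T |-> UT - TU, a map bounded by
  twice a bound of U.\<close>

lemma closed_op_space_commutant:
  assumes U: "U \<in> bounded_ops I"
  shows "closed_op_space I {T \<in> bounded_ops I. U \<otimes>\<^bsub>ops I\<^esub> T = T \<otimes>\<^bsub>ops I\<^esub> U}"
proof -
  obtain K where K: "0 \<le> K" "op_bound I U K" using U by (rule bounded_ops_bound)
  let ?\<phi> = "\<lambda>T. op_diff I (U \<otimes>\<^bsub>ops I\<^esub> T) (T \<otimes>\<^bsub>ops I\<^esub> U)"
  have eq: "U \<otimes>\<^bsub>ops I\<^esub> T = T \<otimes>\<^bsub>ops I\<^esub> U \<longleftrightarrow> ?\<phi> T \<in> {\<zero>\<^bsub>ops I\<^esub>}" if T: "T \<in> bounded_ops I" for T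
  proof
    assume "U \<otimes>\<^bsub>ops I\<^esub> T = T \<otimes>\<^bsub>ops I\<^esub> U"
    then show "?\<phi> T \<in> {\<zero>\<^bsub>ops I\<^esub>}" using T U by (auto intro!: bounded_ops_eqI[of _ I])
  next
    assume \<phi>: "?\<phi> T \<in> {\<zero>\<^bsub>ops I\<^esub>}"
    show "U \<otimes>\<^bsub>ops I\<^esub> T = T \<otimes>\<^bsub>ops I\<^esub> U"
    proof (rule bounded_ops_eqI[of _ I])
      fix f assume f: "f \<in> ell2 I"
      then have "(\<lambda>i. U (T f) i - T (U f) i) = (\<lambda>i. 0)"
        using \<phi> op_diff_apply[OF f, of "U \<otimes>\<^bsub>ops I\<^esub> T" "T \<otimes>\<^bsub>ops I\<^esub> U"] by simp
      then show "(U \<otimes>\<^bsub>ops I\<^esub> T) f = (T \<otimes>\<^bsub>ops I\<^esub> U) f"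
        using f by (simp add: fun_eq_iff)
    qed (use T U in auto)
  qed
  have "closed_op_space I {T \<in> bounded_ops I. ?\<phi> T \<in> {\<zero>\<^bsub>ops I\<^esub>}}"
  proof (rule closed_op_space_vimage[OF closed_op_space_singleton, where \<kappa>="\<lambda>z. z" and K="2 * K"])
    fix T C assume T: "T \<in> bounded_ops I" "0 \<le> C" "op_bound I T C"
    show "op_bound I (?\<phi> T) (2 * K * C)"
      unfolding op_bound_def
    proof
      fix f assume f: "f \<in> ell2 I"
      have "l2_norm (\<lambda>i. U (T f) i + (-1) * T (U f) i) \<le> l2_norm (U (T f)) + l2_norm (\<lambda>i. (-1) * T (U f) i)"
        using f T U by (intro l2_norm_add_le[of _ I] ell2_cmult) auto
      also have "\<dots> \<le> l2_norm (U (T f)) + l2_norm (T (U f))"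
        using f T U l2_norm_cmult_le[of "T (U f)" I "-1"] by auto
      also have "\<dots> \<le> (K * C) * l2_norm f + (C * K) * l2_norm f"
        using op_bound_mult[OF T(1) K T(3)] op_bound_mult[OF U T(2,3) K(2)] f
        by (intro add_mono) (auto simp: op_bound_def)
      finally show "l2_norm (?\<phi> T f) \<le> 2 * K * C * l2_norm f" using f by (simp add: algebra_simps)
    qed
  qed (use U K in \<open>auto intro!: bounded_ops_eqI[of _ I] simp: bounded_ops_add bounded_ops_cmult algebra_simps\<close>)
  moreover have "{T \<in> bounded_ops I. U \<otimes>\<^bsub>ops I\<^esub> T = T \<otimes>\<^bsub>ops I\<^esub> U} = {T \<in> bounded_ops I. ?\<phi> T \<in> {\<zero>\<^bsub>ops I\<^esub>}}"
    using eq by blast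
  ultimately show ?thesis by simp
qed

section \<open>Twisted reduced group algebras\<close>

lemma op_norm_cong: "(\<And>f. f \<in> ell2 I \<Longrightarrow> T f = U f) \<Longrightarrow> op_norm I T = op_norm I U"
  unfolding op_norm_def by (intro SUP_cong) auto

lemma op_norm_le:
  assumes "op_bound I T C" "0 \<le> C" shows "op_norm I T \<le> C"
  unfolding op_norm_def
proof (rule cSUP_least)
  show "{f \<in> ell2 I. l2_norm f \<le> 1} \<noteq> {}" using ell2_zero[of I] l2_norm_zero by fastforce
  fix f assume f: "f \<in> {f \<in> ell2 I. l2_norm f \<le> 1}"
  then have "l2_norm (T f) \<le> C * l2_norm f" using assms by (simp add: op_bound_def)
  also have "\<dots> \<le> C" using f assms(2) by (simp add: mult_left_le)
  finally show "l2_norm (T f) \<le> C" .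
qed

text \<open>Rescale f to norm 1. A vector of norm 0 cannot be rescaled and is handled by an
  arbitrary bound of T.\<close>

lemma op_bound_op_norm:
  assumes T: "T \<in> bounded_ops I" shows "op_bound I T (op_norm I T)"
  unfolding op_bound_def
proof
  fix f assume f: "f \<in> ell2 I"
  obtain C where C: "0 \<le> C" "op_bound I T C" using T by (rule bounded_ops_bound)
  have bdd: "bdd_above ((\<lambda>f. l2_norm (T f)) ` {f \<in> ell2 I. l2_norm f \<le> 1})"
  proof (rule bdd_aboveI2)
    fix f assume f: "f \<in> {f \<in> ell2 I. l2_norm f \<le> 1}"
    then have "l2_norm (T f) \<le> C * l2_norm f" using C by (simp add: op_bound_def)
    also have "\<dots> \<le> C" using f C by (simp add: mult_left_le)
    finally show "l2_norm (T f) \<le> C" .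
  qed
  show "l2_norm (T f) \<le> op_norm I T * l2_norm f"
  proof (cases "l2_norm f = 0")
    case True
    then have "l2_norm (T f) \<le> C * 0" using C f unfolding op_bound_def by metis
    then show ?thesis using True by simp
  next
    case False
    let ?n = "l2_norm f" and ?g = "\<lambda>i. complex_of_real (1 / l2_norm f) * f i"
    have n: "0 < ?n" using False l2_norm_nonneg[of f] by linarith
    have g: "?g \<in> ell2 I" using f by (rule ell2_cmult)
    have "l2_norm ?g \<le> 1"
      using l2_norm_cmult_le[OF f, of "complex_of_real (1 / ?n)"] n by (simp add: norm_divide)
    then have le: "l2_norm (T ?g) \<le> op_norm I T"
      unfolding op_norm_def using g by (intro cSUP_upper[OF _ bdd]) simp
    have "f = (\<lambda>i. complex_of_real ?n * ?g i)" using n by (auto simp: field_simps)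
    then have "T f = (\<lambda>i. complex_of_real ?n * T ?g i)" using bounded_ops_cmult[OF T g] by metis
    then have "l2_norm (T f) \<le> ?n * l2_norm (T ?g)"
      using l2_norm_cmult_le[OF bounded_ops_ell2[OF T g], of "complex_of_real ?n"] by simp
    also have "\<dots> \<le> ?n * op_norm I T" using le by (intro mult_left_mono) auto
    finally show ?thesis by (simp add: mult.commute)
  qed
qed

lemma circle_cnj_mult: "z \<in> circle \<Longrightarrow> cnj z * z = 1"
  and circle_mult_cnj: "z \<in> circle \<Longrightarrow> z * cnj z = 1"
  by (simp_all add: complex_norm_square[symmetric] mult.commute)

locale twisted_group = group G for G :: "('g, 'm) monoid_scheme" (structure) +
  fixes c :: "'g \<Rightarrow> 'g \<Rightarrow> complex"
  assumes cocycle: "group_cocycle G c"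
begin

abbreviation L where "L \<equiv> bounded_op_algebra (carrier G)"
abbreviation BL where "BL \<equiv> bounded_ops (carrier G)"
abbreviation \<delta> where "\<delta> \<equiv> delta G c"

section \<open>Twisted translation operators\<close>

lemma cocycle_circle: "g \<in> carrier G \<Longrightarrow> h \<in> carrier G \<Longrightarrow> c g h \<in> circle"
  and cocycle_one [simp]: "g \<in> carrier G \<Longrightarrow> c g \<one> = 1" "g \<in> carrier G \<Longrightarrow> c \<one> g = 1"
  and cocycle_identity: "g \<in> carrier G \<Longrightarrow> h \<in> carrier G \<Longrightarrow> k \<in> carrier G \<Longrightarrow>
    c g (h \<otimes> k) * c h k = c (g \<otimes> h) k * c g h"
  using cocycle unfolding group_cocycle_def by blast+

lemma delta_apply: "f \<in> ell2 (carrier G) \<Longrightarrow>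
    \<delta> g f = (\<lambda>k. if k \<in> carrier G then c g (inv g \<otimes> k) * f (inv g \<otimes> k) else 0)"
  by (simp add: delta_def)

lemma bij_betw_translate: "g \<in> carrier G \<Longrightarrow> bij_betw (\<lambda>k. g \<otimes> k) (carrier G) (carrier G)"
  by (rule bij_betw_byWitness[where f'="\<lambda>k. inv g \<otimes> k"]) (auto simp: m_assoc[symmetric])

text \<open>Left translation permutes the coordinates and c has modulus 1, so every finite square
  sum of \<open>\<delta> g f\<close> is a finite square sum of f.\<close>

lemma delta_bounded [simp, intro]: assumes g: "g \<in> carrier G" shows "\<delta> g \<in> BL"
proof (rule bounded_opsI)
  have le: "L2_set (\<lambda>k. cmod (\<delta> g f k)) F \<le> l2_norm f" if f: "f \<in> ell2 (carrier G)" and F: "finite F" for f F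
  proof -
    have inj: "inj_on (\<lambda>k. inv g \<otimes> k) (F \<inter> carrier G)"
      using bij_betw_translate[of "inv g"] g by (auto simp: bij_betw_def intro: inj_on_subset)
    have "(\<Sum>k\<in>F. (cmod (\<delta> g f k))\<^sup>2) = (\<Sum>k\<in>F \<inter> carrier G. (cmod (f (inv g \<otimes> k)))\<^sup>2)"
      using F f g cocycle_circle by (intro sum.mono_neutral_cong_right) (auto simp: delta_apply norm_mult)
    also have "\<dots> = (\<Sum>k\<in>(\<lambda>k. inv g \<otimes> k) ` (F \<inter> carrier G). (cmod (f k))\<^sup>2)"
      using inj by (simp add: sum.reindex)
    finally have "L2_set (\<lambda>k. cmod (\<delta> g f k)) F =
        L2_set (\<lambda>k. cmod (f k)) ((\<lambda>k. inv g \<otimes> k) ` (F \<inter> carrier G))" by (simp add: L2_set_def)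
    then show ?thesis using L2_set_le_l2_norm[OF f] F by simp
  qed
  have off: "\<delta> g f k = 0" if "f \<in> ell2 (carrier G)" "k \<notin> carrier G" for f k
    using that by (simp add: delta_apply)
  show "op_bound (carrier G) (\<delta> g) 1"
    unfolding op_bound_def
  proof
    fix f assume f: "f \<in> ell2 (carrier G)"
    show "l2_norm (\<delta> g f) \<le> 1 * l2_norm f"
      using ell2_boundI(2)[of "carrier G" "\<delta> g f", OF off[OF f] le[OF f]] by simp
  qed
  have "\<delta> g f \<in> ell2 (carrier G)" if f: "f \<in> ell2 (carrier G)" for f
    by (rule ell2_boundI(1)[OF off[OF f] le[OF f]])
  then show "\<delta> g \<in> ell2 (carrier G) \<rightarrow>\<^sub>E ell2 (carrier G)" by (auto simp: delta_def)
qed (auto simp: delta_apply algebra_simps)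

lemma delta_mult:
  assumes g: "g \<in> carrier G" and h: "h \<in> carrier G"
  shows "\<delta> g \<otimes>\<^bsub>L\<^esub> \<delta> h = c g h \<odot>\<^bsub>L\<^esub> \<delta> (g \<otimes> h)"
proof (rule bounded_ops_eqI)
  fix f assume f: "f \<in> ell2 (carrier G)"
  show "(\<delta> g \<otimes>\<^bsub>L\<^esub> \<delta> h) f = (c g h \<odot>\<^bsub>L\<^esub> \<delta> (g \<otimes> h)) f"
  proof
    fix k
    show "(\<delta> g \<otimes>\<^bsub>L\<^esub> \<delta> h) f k = (c g h \<odot>\<^bsub>L\<^esub> \<delta> (g \<otimes> h)) f k"
    proof (cases "k \<in> carrier G")
      case True
      \<comment> \<open>The index at which both sides read f; the cocycle identity for g, h and
        \<open>?k\<close> matches the coefficients.\<close>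
      let ?k = "inv h \<otimes> (inv g \<otimes> k)"
      have k: "?k \<in> carrier G" "inv g \<otimes> k = h \<otimes> ?k" "inv (g \<otimes> h) \<otimes> k = ?k"
        using g h True by (auto simp: m_assoc[symmetric] inv_mult_group)
      have "(\<delta> g \<otimes>\<^bsub>L\<^esub> \<delta> h) f k = c g (h \<otimes> ?k) * (c h ?k * f ?k)"
        using f g h True k(2) bounded_ops_ell2[OF delta_bounded[OF h] f] by (simp add: delta_apply)
      also have "\<dots> = c g h * (c (g \<otimes> h) ?k * f ?k)"
        using cocycle_identity[OF g h k(1)] by (simp add: mult_ac)
      finally show ?thesis using f g h True k(3) by (simp add: delta_apply)
    next
      case False
      then show ?thesis
        using f bounded_ops_ell2[OF delta_bounded[OF h] f] by (simp add: delta_apply)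
    qed
  qed
qed (use g h in auto)

lemma delta_one: "\<delta> \<one> = \<one>\<^bsub>L\<^esub>"
proof (rule bounded_ops_eqI)
  fix f assume f: "f \<in> ell2 (carrier G)"
  then show "\<delta> \<one> f = \<one>\<^bsub>L\<^esub> f" using ell2_eq_0[OF f] by (auto simp: delta_apply)
qed auto

text \<open>The cocycle identity for g, inv g, gk gives c(g,k) c(inv g, gk) = c(g, inv g), which
  fixes the coefficient; translating the summation variable by g gives the adjoint equation.\<close>

lemma delta_star:
  assumes g: "g \<in> carrier G"
  shows "op_star (carrier G) (\<delta> g) = cnj (c g (inv g)) \<odot>\<^bsub>L\<^esub> \<delta> (inv g)"
proof (rule op_star_unique)
  fix f h assume f: "f \<in> ell2 (carrier G)" and h: "h \<in> ell2 (carrier G)"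
  have coeff: "cnj (c g (inv g)) * c (inv g) (g \<otimes> k) = cnj (c g k)" if k: "k \<in> carrier G" for k
  proof -
    have "c g k * c (inv g) (g \<otimes> k) = c g (inv g)"
      using cocycle_identity[of g "inv g" "g \<otimes> k"] g k by (simp add: m_assoc[symmetric])
    then have "cnj (c g k) * (c g k * c (inv g) (g \<otimes> k)) = cnj (c g k) * c g (inv g)" by simp
    then have "c (inv g) (g \<otimes> k) = cnj (c g k) * c g (inv g)"
      using circle_cnj_mult[OF cocycle_circle[OF g k]] by (simp add: mult.assoc[symmetric])
    then have "cnj (c g (inv g)) * c (inv g) (g \<otimes> k) = cnj (c g k) * (cnj (c g (inv g)) * c g (inv g))"
      by (simp add: mult_ac)
    then show ?thesis using circle_cnj_mult[OF cocycle_circle[OF g inv_closed[OF g]]] by simp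
  qed
  have "l2_inner ((cnj (c g (inv g)) \<odot>\<^bsub>L\<^esub> \<delta> (inv g)) f) h =
      (\<Sum>\<^sub>\<infinity>k\<in>carrier G. cnj (f (g \<otimes> k)) * (c g k * h k))"
    unfolding l2_inner_def
  proof (rule infsum_cong_neutral)
    fix k assume "k \<in> UNIV \<inter> carrier G"
    then have k: "k \<in> carrier G" by simp
    have "(cnj (c g (inv g)) \<odot>\<^bsub>L\<^esub> \<delta> (inv g)) f k = cnj (c g k) * f (g \<otimes> k)"
      using f g k coeff[OF k] by (simp add: delta_apply mult.assoc[symmetric])
    then show "cnj ((cnj (c g (inv g)) \<odot>\<^bsub>L\<^esub> \<delta> (inv g)) f k) * h k = cnj (f (g \<otimes> k)) * (c g k * h k)"
      by simp
  qed (use f h g in \<open>auto simp: delta_apply\<close>)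
  also have "\<dots> = (\<Sum>\<^sub>\<infinity>k\<in>carrier G. cnj (f k) * \<delta> g h k)"
    unfolding infsum_reindex_bij_betw[OF bij_betw_translate[OF g], of "\<lambda>k. cnj (f k) * \<delta> g h k", symmetric]
    by (intro infsum_cong) (use g h in \<open>simp add: delta_apply m_assoc[symmetric]\<close>)
  also have "\<dots> = l2_inner f (\<delta> g h)"
    unfolding l2_inner_def by (rule infsum_cong_neutral) (use f ell2_eq_0 in auto)
  finally show "l2_inner ((cnj (c g (inv g)) \<odot>\<^bsub>L\<^esub> \<delta> (inv g)) f) h = l2_inner f (\<delta> g h)" .
qed (use g in auto)

lemma delta_star_mult:
  assumes g: "g \<in> carrier G" shows "op_star (carrier G) (\<delta> g) \<otimes>\<^bsub>L\<^esub> \<delta> g = \<one>\<^bsub>L\<^esub>"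
proof -
  have "c g (inv g) = c (inv g) g"
    using cocycle_identity[of g "inv g" g] g by simp
  then show ?thesis
    using g circle_cnj_mult[OF cocycle_circle[of g "inv g"]]
    by (simp add: delta_star delta_mult op_smult_mult op_smult_smult delta_one op_one_smult)
qed

lemma delta_mult_star:
  assumes g: "g \<in> carrier G" shows "\<delta> g \<otimes>\<^bsub>L\<^esub> op_star (carrier G) (\<delta> g) = \<one>\<^bsub>L\<^esub>"
  using g circle_cnj_mult[OF cocycle_circle[of g "inv g"]]
  by (simp add: delta_star delta_mult op_mult_smult op_smult_smult delta_one op_one_smult)

subsection \<open>The reduced algebra of a subset\<close>

lemma regular_rep_mem:
  assumes V: "closed_op_space (carrier G) V" and \<delta>: "\<And>h. h \<in> H \<Longrightarrow> \<delta> h \<in> V" and a: "a \<in> Cc H"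
  shows "regular_rep G c a \<in> V"
proof -
  \<comment> \<open>The range of summation is separated from the support of a, so that it can shrink
    in an induction.\<close>
  define R where "R F = (\<lambda>f\<in>ell2 (carrier G). \<lambda>k. \<Sum>h\<in>F. a h * \<delta> h f k)" for F
  have "R F \<in> V" if "finite F" "F \<subseteq> H" for F
    using that
  proof (induction F)
    case empty
    have "R {} = \<zero>\<^bsub>L\<^esub>" by (auto simp: R_def bounded_op_algebra_simps)
    then show ?case using closed_op_space_zero[OF V] by metis
  next
    case (insert j F)
    have "R (insert j F) = a j \<odot>\<^bsub>L\<^esub> \<delta> j \<oplus>\<^bsub>L\<^esub> R F"
      using insert.hyps by (auto simp: R_def bounded_op_algebra_simps)
    then show ?case
      using insert \<delta> closed_op_space_add[OF V] closed_op_space_smult[OF V] by (metis insert_subset)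
  qed
  from this[of "{h. a h \<noteq> 0}"] a show ?thesis by (simp add: R_def regular_rep_def Cc_def)
qed

lemma regular_rep_bounded: "H \<subseteq> carrier G \<Longrightarrow> a \<in> Cc H \<Longrightarrow> regular_rep G c a \<in> BL"
  by (rule regular_rep_mem[OF closed_op_space_bounded_ops, of H]) auto

lemma regular_rep_superset:
  assumes "finite F" "{h. a h \<noteq> 0} \<subseteq> F" "f \<in> ell2 (carrier G)"
  shows "regular_rep G c a f = (\<lambda>k. \<Sum>h\<in>F. a h * \<delta> h f k)"
  using assms unfolding regular_rep_def by (auto intro!: ext sum.mono_neutral_left)

text \<open>Trades the supremum for explicit bounds; halving the tolerance recovers the strict
  inequality.\<close>

lemma reduced_closure_iff:
  assumes H: "H \<subseteq> carrier G"
  shows "T \<in> reduced_closure G c H \<longleftrightarrow>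
    T \<in> BL \<and> (\<forall>\<epsilon>>0. \<exists>a\<in>Cc H. op_bound (carrier G) (op_diff (carrier G) T (regular_rep G c a)) \<epsilon>)"
proof -
  let ?n = "\<lambda>a. op_norm (carrier G) (\<lambda>f k. T f k - regular_rep G c a f k)"
  let ?D = "\<lambda>a. op_diff (carrier G) T (regular_rep G c a)"
  have n: "?n a = op_norm (carrier G) (?D a)" for a by (rule op_norm_cong) simp
  have "(\<forall>\<epsilon>>0. \<exists>a\<in>Cc H. ?n a < \<epsilon>) \<longleftrightarrow> (\<forall>\<epsilon>>0. \<exists>a\<in>Cc H. op_bound (carrier G) (?D a) \<epsilon>)" if T: "T \<in> BL"
  proof (intro iffI allI impI)
    fix \<epsilon> :: real assume "\<forall>\<epsilon>>0. \<exists>a\<in>Cc H. ?n a < \<epsilon>" "0 < \<epsilon>"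
    then obtain a where a: "a \<in> Cc H" "op_norm (carrier G) (?D a) < \<epsilon>" unfolding n by blast
    have "op_bound (carrier G) (?D a) (op_norm (carrier G) (?D a))"
      using T a H by (intro op_bound_op_norm op_diff_closed regular_rep_bounded)
    then have "op_bound (carrier G) (?D a) \<epsilon>"
      using a(2) unfolding op_bound_def by (meson l2_norm_nonneg less_imp_le mult_right_mono order_trans)
    then show "\<exists>a\<in>Cc H. op_bound (carrier G) (?D a) \<epsilon>" using a by blast
  next
    fix \<epsilon> :: real assume "\<forall>\<epsilon>>0. \<exists>a\<in>Cc H. op_bound (carrier G) (?D a) \<epsilon>" and e: "0 < \<epsilon>"
    then obtain a where a: "a \<in> Cc H" "op_bound (carrier G) (?D a) (\<epsilon> / 2)" by (metis half_gt_zero)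
    then have "?n a \<le> \<epsilon> / 2" unfolding n using e by (intro op_norm_le) auto
    then show "\<exists>a\<in>Cc H. ?n a < \<epsilon>" using a(1) e by (intro bexI[of _ a]) auto
  qed
  then show ?thesis unfolding reduced_closure_def by blast
qed

lemma regular_rep_closure:
  assumes "H \<subseteq> carrier G" "a \<in> Cc H" shows "regular_rep G c a \<in> reduced_closure G c H"
proof -
  have "op_bound (carrier G) (op_diff (carrier G) (regular_rep G c a) (regular_rep G c a)) \<epsilon>" if "0 < \<epsilon>" for \<epsilon>
    using that by (simp add: op_bound_def)
  then show ?thesis using assms regular_rep_bounded unfolding reduced_closure_iff[OF assms(1)] by blast
qed

lemma delta_closure:
  assumes "H \<subseteq> carrier G" "h \<in> H" shows "\<delta> h \<in> reduced_closure G c H"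
proof -
  let ?a = "\<lambda>k. if k = h then 1 else (0::complex)"
  have a: "?a \<in> Cc H" using assms by (simp add: Cc_def)
  moreover have "regular_rep G c ?a = \<delta> h"
  proof (rule bounded_ops_eqI)
    fix f assume "f \<in> ell2 (carrier G)"
    then show "regular_rep G c ?a f = \<delta> h f"
      using regular_rep_superset[of "{h}" ?a f] by simp
  qed (use assms a regular_rep_bounded in auto)
  ultimately show ?thesis using regular_rep_closure[OF assms(1)] by metis
qed

text \<open>The induction principle for reduced algebras: V is taken to be the space of operators
  with the desired property, which then has to be checked only on the
  \<open>\<delta> h\<close>.\<close>

lemma reduced_closure_minimal:
  assumes H: "H \<subseteq> carrier G" and V: "closed_op_space (carrier G) V"
    and \<delta>: "\<And>h. h \<in> H \<Longrightarrow> \<delta> h \<in> V" and T: "T \<in> reduced_closure G c H"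
  shows "T \<in> V"
proof (rule closed_op_space_limit[OF V])
  show "T \<in> BL" using T reduced_closure_iff[OF H] by blast
  fix \<epsilon> :: real assume "0 < \<epsilon>"
  then show "\<exists>U\<in>V. op_bound (carrier G) (op_diff (carrier G) T U) \<epsilon>"
    using T regular_rep_mem[OF V \<delta>] unfolding reduced_closure_iff[OF H] by blast
qed

lemma closed_op_space_reduced_closure:
  assumes H: "H \<subseteq> carrier G" shows "closed_op_space (carrier G) (reduced_closure G c H)"
proof (rule closed_op_spaceI)
  let ?I = "carrier G" and ?R = "regular_rep G c" and ?V = "reduced_closure G c H"
  show sub: "?V \<subseteq> BL" using reduced_closure_iff[OF H] by blast
  have "?R (\<lambda>h. 0) = \<zero>\<^bsub>L\<^esub>" by (simp add: regular_rep_def bounded_op_algebra_simps)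
  then show "\<zero>\<^bsub>L\<^esub> \<in> ?V" using regular_rep_closure[OF H, of "\<lambda>h. 0"] by (simp add: Cc_def)
  show "T \<oplus>\<^bsub>L\<^esub> U \<in> ?V" if T: "T \<in> ?V" and U: "U \<in> ?V" for T U
    unfolding reduced_closure_iff[OF H]
  proof (intro conjI allI impI)
    show "T \<oplus>\<^bsub>L\<^esub> U \<in> BL" using T U sub by auto
    fix \<epsilon> :: real assume e: "0 < \<epsilon>"
    obtain a where a: "a \<in> Cc H" "op_bound ?I (op_diff ?I T (?R a)) (\<epsilon> / 2)"
      using T e unfolding reduced_closure_iff[OF H] by (metis half_gt_zero)
    obtain b where b: "b \<in> Cc H" "op_bound ?I (op_diff ?I U (?R b)) (\<epsilon> / 2)"
      using U e unfolding reduced_closure_iff[OF H] by (metis half_gt_zero)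
    let ?s = "\<lambda>h. a h + b h"
    have supp: "{h. ?s h \<noteq> 0} \<subseteq> {h. a h \<noteq> 0} \<union> {h. b h \<noteq> 0}" by auto
    then have s: "?s \<in> Cc H"
      using a(1) b(1) finite_subset[OF supp] unfolding Cc_def by blast
    have R: "?R ?s f = (\<lambda>k. ?R a f k + ?R b f k)" if f: "f \<in> ell2 ?I" for f
    proof -
      let ?F = "{h. a h \<noteq> 0} \<union> {h. b h \<noteq> 0}"
      have F: "finite ?F" using a(1) b(1) by (simp add: Cc_def)
      show ?thesis
        using regular_rep_superset[OF F supp f] regular_rep_superset[OF F, of a f]
          regular_rep_superset[OF F, of b f] f
        by (auto simp: sum.distrib[symmetric] distrib_right)
    qed
    have "op_bound ?I (op_diff ?I (T \<oplus>\<^bsub>L\<^esub> U) (?R ?s)) \<epsilon>"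
      unfolding op_bound_def
    proof
      fix f assume f: "f \<in> ell2 ?I"
      have m: "T f \<in> ell2 ?I" "U f \<in> ell2 ?I" "?R a f \<in> ell2 ?I" "?R b f \<in> ell2 ?I"
        using f bounded_ops_ell2[OF subsetD[OF sub T]] bounded_ops_ell2[OF subsetD[OF sub U]]
          bounded_ops_ell2[OF regular_rep_bounded[OF H a(1)]] bounded_ops_ell2[OF regular_rep_bounded[OF H b(1)]]
        by simp_all
      have "l2_norm (op_diff ?I (T \<oplus>\<^bsub>L\<^esub> U) (?R ?s) f) =
          l2_norm (\<lambda>i. (T f i - ?R a f i) + (U f i - ?R b f i))"
        using f by (simp add: R algebra_simps)
      also have "\<dots> \<le> l2_norm (\<lambda>i. T f i - ?R a f i) + l2_norm (\<lambda>i. U f i - ?R b f i)"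
        using m by (intro l2_norm_add_le[of _ ?I] ell2_diff)
      also have "\<dots> \<le> \<epsilon> / 2 * l2_norm f + \<epsilon> / 2 * l2_norm f"
        using a(2) b(2) f by (intro add_mono) (auto simp: op_bound_def)
      finally show "l2_norm (op_diff ?I (T \<oplus>\<^bsub>L\<^esub> U) (?R ?s) f) \<le> \<epsilon> * l2_norm f" by simp
    qed
    then show "\<exists>a\<in>Cc H. op_bound ?I (op_diff ?I (T \<oplus>\<^bsub>L\<^esub> U) (?R a)) \<epsilon>" using s by blast
  qed
  show "z \<odot>\<^bsub>L\<^esub> T \<in> ?V" if T: "T \<in> ?V" for z T
    unfolding reduced_closure_iff[OF H]
  proof (intro conjI allI impI)
    show "z \<odot>\<^bsub>L\<^esub> T \<in> BL" using T sub by auto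
    fix \<epsilon> :: real assume e: "0 < \<epsilon>"
    have pos: "0 < \<epsilon> / (cmod z + 1)" using e by (simp add: add_nonneg_pos)
    obtain a where a: "a \<in> Cc H" "op_bound ?I (op_diff ?I T (?R a)) (\<epsilon> / (cmod z + 1))"
      using T pos unfolding reduced_closure_iff[OF H] by meson
    let ?s = "\<lambda>h. z * a h"
    have s: "?s \<in> Cc H"
      using a(1) finite_subset[of "{h. ?s h \<noteq> 0}" "{h. a h \<noteq> 0}"] by (auto simp: Cc_def)
    have R: "?R ?s f = (\<lambda>k. z * ?R a f k)" if f: "f \<in> ell2 ?I" for f
    proof -
      have F: "finite {h. a h \<noteq> 0}" using a(1) by (simp add: Cc_def)
      show ?thesis
        using regular_rep_superset[OF F, of ?s f] regular_rep_superset[OF F, of a f] f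
        by (auto simp: sum_distrib_left mult.assoc)
    qed
    have "cmod z * (\<epsilon> / (cmod z + 1)) = \<epsilon> * (cmod z / (cmod z + 1))" by simp
    also have "\<dots> \<le> \<epsilon>" using e by (intro mult_left_le) (auto simp: divide_le_eq add_nonneg_pos)
    finally have le: "cmod z * (\<epsilon> / (cmod z + 1)) \<le> \<epsilon>" .
    have "op_bound ?I (op_diff ?I (z \<odot>\<^bsub>L\<^esub> T) (?R ?s)) \<epsilon>"
      unfolding op_bound_def
    proof
      fix f assume f: "f \<in> ell2 ?I"
      have "T f \<in> ell2 ?I" "?R a f \<in> ell2 ?I"
        using f bounded_ops_ell2[OF subsetD[OF sub T]] bounded_ops_ell2[OF regular_rep_bounded[OF H a(1)]]
        by simp_all
      then have m: "(\<lambda>i. T f i - ?R a f i) \<in> ell2 ?I" by simp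
      have "l2_norm (op_diff ?I (z \<odot>\<^bsub>L\<^esub> T) (?R ?s) f) = l2_norm (\<lambda>i. z * (T f i - ?R a f i))"
        using f by (simp add: R algebra_simps)
      also have "\<dots> \<le> cmod z * l2_norm (\<lambda>i. T f i - ?R a f i)"
        by (rule l2_norm_cmult_le[OF m])
      also have "\<dots> \<le> cmod z * (\<epsilon> / (cmod z + 1) * l2_norm f)"
        using a(2) f by (intro mult_left_mono) (auto simp: op_bound_def)
      also have "\<dots> \<le> \<epsilon> * l2_norm f"
        using mult_right_mono[OF le l2_norm_nonneg[of f]] by (simp add: mult.assoc)
      finally show "l2_norm (op_diff ?I (z \<odot>\<^bsub>L\<^esub> T) (?R ?s) f) \<le> \<epsilon> * l2_norm f" .
    qed
    then show "\<exists>a\<in>Cc H. op_bound ?I (op_diff ?I (z \<odot>\<^bsub>L\<^esub> T) (?R a)) \<epsilon>" using s by blast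
  qed
  fix T assume T: "T \<in> BL" and lim: "\<And>\<epsilon>. 0 < \<epsilon> \<Longrightarrow> \<exists>U\<in>?V. op_bound ?I (op_diff ?I T U) \<epsilon>"
  have "\<exists>a\<in>Cc H. op_bound ?I (op_diff ?I T (?R a)) \<epsilon>" if e: "0 < \<epsilon>" for \<epsilon>
  proof -
    obtain U where U: "U \<in> ?V" "op_bound ?I (op_diff ?I T U) (\<epsilon> / 2)" using lim e by (metis half_gt_zero)
    obtain a where a: "a \<in> Cc H" "op_bound ?I (op_diff ?I U (?R a)) (\<epsilon> / 2)"
      using U(1) e unfolding reduced_closure_iff[OF H] by (metis half_gt_zero)
    have "op_bound ?I (op_diff ?I T (?R a)) (\<epsilon> / 2 + \<epsilon> / 2)"
      using op_diff_triangle[OF T _ regular_rep_bounded[OF H a(1)] U(2) a(2)] U(1) sub by blast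
    then show ?thesis using a by auto
  qed
  then show "T \<in> ?V" using T unfolding reduced_closure_iff[OF H] by blast
qed

section \<open>Products, adjoints, commutativity and conjugation in the reduced algebra of a
  subgroup\<close>

lemma reduced_closure_bounded: "H \<subseteq> carrier G \<Longrightarrow> T \<in> reduced_closure G c H \<Longrightarrow> T \<in> BL"
  by (simp add: reduced_closure_iff)

lemma reduced_closure_mono:
  assumes "H \<subseteq> K" "K \<subseteq> carrier G" shows "reduced_closure G c H \<subseteq> reduced_closure G c K"
proof
  fix T assume T: "T \<in> reduced_closure G c H"
  show "T \<in> reduced_closure G c K"
    by (rule reduced_closure_minimal[OF _ _ _ T]) (use assms closed_op_space_reduced_closure delta_closure in auto)
qed

text \<open>Density is used once per factor: first in U with the left factor
  \<open>\<delta> g\<close> fixed, then in T with U fixed.\<close>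

lemma reduced_closure_mult:
  assumes H: "subgroup H G" and T: "T \<in> reduced_closure G c H" and U: "U \<in> reduced_closure G c H"
  shows "T \<otimes>\<^bsub>L\<^esub> U \<in> reduced_closure G c H"
proof -
  let ?V = "reduced_closure G c H"
  note sub = subgroup.subset[OF H]
  note V = closed_op_space_reduced_closure[OF sub]
  have 1: "\<delta> g \<otimes>\<^bsub>L\<^esub> U \<in> ?V" if g: "g \<in> H" for g
  proof -
    have gG: "g \<in> carrier G" using g sub by blast
    have 2: "\<delta> g \<otimes>\<^bsub>L\<^esub> \<delta> h \<in> ?V" if h: "h \<in> H" for h
    proof -
      have hG: "h \<in> carrier G" using h sub by blast
      show ?thesis
        unfolding delta_mult[OF gG hG]
        by (rule closed_op_space_smult[OF V delta_closure[OF sub subgroup.m_closed[OF H g h]]])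
    qed
    have "U \<in> {U \<in> BL. \<delta> g \<otimes>\<^bsub>L\<^esub> U \<in> ?V}"
      by (rule reduced_closure_minimal[OF sub closed_op_space_mult_left[OF V] _ U]) (use 2 gG sub in auto)
    then show ?thesis by simp
  qed
  have "T \<in> {T \<in> BL. T \<otimes>\<^bsub>L\<^esub> U \<in> ?V}"
    by (rule reduced_closure_minimal[OF sub closed_op_space_mult_right[OF V] _ T])
      (use 1 sub reduced_closure_bounded[OF sub U] in auto)
  then show ?thesis by simp
qed

lemma reduced_closure_star:
  assumes H: "subgroup H G" and T: "T \<in> reduced_closure G c H"
  shows "op_star (carrier G) T \<in> reduced_closure G c H"
proof -
  let ?V = "reduced_closure G c H"
  note sub = subgroup.subset[OF H]
  note V = closed_op_space_reduced_closure[OF sub]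
  have 1: "op_star (carrier G) (\<delta> h) \<in> ?V" if h: "h \<in> H" for h
  proof -
    have hG: "h \<in> carrier G" using h sub by blast
    show ?thesis
      unfolding delta_star[OF hG]
      by (rule closed_op_space_smult[OF V delta_closure[OF sub subgroup.m_inv_closed[OF H h]]])
  qed
  have "T \<in> {T \<in> BL. op_star (carrier G) T \<in> ?V}"
    by (rule reduced_closure_minimal[OF sub closed_op_space_star[OF V] _ T]) (use 1 sub in auto)
  then show ?thesis by simp
qed

text \<open>On generators both products are a scalar times \<open>\<delta> (g \<otimes> h)\<close>;
  commutativity of H equates the operators and symmetry of c the scalars. Density in each factor
  does the rest.\<close>

lemma reduced_closure_commute:
  assumes H: "abelian_symmetric_subgroup G c H"
    and T: "T \<in> reduced_closure G c H" and U: "U \<in> reduced_closure G c H"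
  shows "T \<otimes>\<^bsub>L\<^esub> U = U \<otimes>\<^bsub>L\<^esub> T"
proof -
  have sub: "H \<subseteq> carrier G"
    using H by (simp add: abelian_symmetric_subgroup_def subgroup.subset)
  have \<delta>: "\<delta> g \<otimes>\<^bsub>L\<^esub> \<delta> h = \<delta> h \<otimes>\<^bsub>L\<^esub> \<delta> g" if "g \<in> H" "h \<in> H" for g h
  proof -
    have gh: "g \<in> carrier G" "h \<in> carrier G" using that sub by auto
    have "g \<otimes> h = h \<otimes> g" "c g h = c h g" using that H unfolding abelian_symmetric_subgroup_def by blast+
    then show ?thesis unfolding delta_mult[OF gh] delta_mult[OF gh(2,1)] by simp
  qed
  have 1: "\<delta> g \<otimes>\<^bsub>L\<^esub> U = U \<otimes>\<^bsub>L\<^esub> \<delta> g" if g: "g \<in> H" for g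
  proof -
    have "U \<in> {U \<in> BL. \<delta> g \<otimes>\<^bsub>L\<^esub> U = U \<otimes>\<^bsub>L\<^esub> \<delta> g}"
      by (rule reduced_closure_minimal[OF sub closed_op_space_commutant _ U]) (use g sub \<delta> in auto)
    then show ?thesis by simp
  qed
  have "T \<in> {T \<in> BL. U \<otimes>\<^bsub>L\<^esub> T = T \<otimes>\<^bsub>L\<^esub> U}"
    by (rule reduced_closure_minimal[OF sub closed_op_space_commutant _ T])
      (use 1 sub reduced_closure_bounded[OF sub U] in auto)
  then show ?thesis by simp
qed

text \<open>By normality the conjugate of a generator is a scalar multiple of a generator. The
  admissible T form a nested preimage, under a right inside a left multiplication.\<close>

lemma reduced_closure_conj:
  assumes H: "H \<lhd> G" and g: "g \<in> carrier G" and T: "T \<in> reduced_closure G c H"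
  shows "\<delta> g \<otimes>\<^bsub>L\<^esub> T \<otimes>\<^bsub>L\<^esub> op_star (carrier G) (\<delta> g) \<in> reduced_closure G c H"
proof -
  let ?V = "reduced_closure G c H" and ?s = "op_star (carrier G) (\<delta> g)"
  note sub = subgroup.subset[OF normal_imp_subgroup[OF H]]
  note V = closed_op_space_reduced_closure[OF sub]
  have "\<delta> g \<otimes>\<^bsub>L\<^esub> \<delta> h \<otimes>\<^bsub>L\<^esub> ?s \<in> ?V" if h: "h \<in> H" for h
  proof -
    have hG: "h \<in> carrier G" using h sub by blast
    have "\<delta> g \<otimes>\<^bsub>L\<^esub> \<delta> h \<otimes>\<^bsub>L\<^esub> ?s =
        (c g h * cnj (c g (inv g)) * c (g \<otimes> h) (inv g)) \<odot>\<^bsub>L\<^esub> \<delta> (g \<otimes> h \<otimes> inv g)"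
      using g hG by (simp add: delta_star delta_mult op_smult_mult op_mult_smult op_smult_smult mult_ac)
    then show ?thesis
      using closed_op_space_smult[OF V delta_closure[OF sub normal.inv_op_closed2[OF H g h]]] by simp
  qed
  then have \<delta>: "\<delta> h \<in> {T \<in> BL. \<delta> g \<otimes>\<^bsub>L\<^esub> T \<in> {T \<in> BL. T \<otimes>\<^bsub>L\<^esub> ?s \<in> ?V}}" if "h \<in> H" for h
    using that g sub by auto
  have "T \<in> {T \<in> BL. \<delta> g \<otimes>\<^bsub>L\<^esub> T \<in> {T \<in> BL. T \<otimes>\<^bsub>L\<^esub> ?s \<in> ?V}}"
    by (rule reduced_closure_minimal[OF sub closed_op_space_mult_left[OF closed_op_space_mult_right[OF V]] \<delta> T])
      (use g in auto)
  then show ?thesis by simp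
qed

end

section \<open>The homomorphism into the Weyl twist\<close>

subsection \<open>Twisted transformation groupoids\<close>

text \<open>The cocycle \<open>w\<close> is not normalized, so the unit at \<open>x\<close> carries the scalar \<open>cnj (w \<one> \<one> x)\<close> and
  the inverse of \<open>(q, x, t)\<close> has to absorb \<open>w \<one> \<one> x\<close>.\<close>

lemma is_groupoid_twisted_transformation:
  fixes Q (structure) and w :: "'q \<Rightarrow> 'q \<Rightarrow> 'x \<Rightarrow> complex"
  assumes "group Q"
    and act: "\<And>q x. q \<in> carrier Q \<Longrightarrow> x \<in> X \<Longrightarrow> act q x \<in> X"
    and act_one: "\<And>x. x \<in> X \<Longrightarrow> act \<one> x = x"
    and act_mult: "\<And>p q x. p \<in> carrier Q \<Longrightarrow> q \<in> carrier Q \<Longrightarrow> x \<in> X \<Longrightarrow> act (p \<otimes> q) x = act p (act q x)"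
    and \<sigma>: "\<And>p z q y. p \<in> carrier Q \<Longrightarrow> q \<in> carrier Q \<Longrightarrow> y \<in> X \<Longrightarrow> \<sigma> (p, z) (q, y) = w p q y"
    and circle: "\<And>p q y. p \<in> carrier Q \<Longrightarrow> q \<in> carrier Q \<Longrightarrow> y \<in> X \<Longrightarrow> w p q y \<in> circle"
    and cocycle: "\<And>p q k y. p \<in> carrier Q \<Longrightarrow> q \<in> carrier Q \<Longrightarrow> k \<in> carrier Q \<Longrightarrow> y \<in> X \<Longrightarrow>
          w (p \<otimes> q) k y * w p q (act k y) = w p (q \<otimes> k) y * w q k y"
  shows "is_groupoid (twisted_groupoid (transformation_groupoid Q X act) \<sigma>)"
proof -
  interpret group Q by fact
  let ?K = "twisted_groupoid (transformation_groupoid Q X act) \<sigma>"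
  have arr: "((q, x), t) \<in> arrows ?K \<longleftrightarrow> q \<in> carrier Q \<and> x \<in> X \<and> t \<in> circle" for q x t
    by (auto simp: twisted_groupoid_def transformation_groupoid_def)
  have comp: "(((p, z), t), ((q, y), s)) \<in> composable ?K \<longleftrightarrow>
      p \<in> carrier Q \<and> q \<in> carrier Q \<and> y \<in> X \<and> z = act q y \<and> t \<in> circle \<and> s \<in> circle" for p z t q y s
    using act by (auto simp: twisted_groupoid_def transformation_groupoid_def)
  have prod: "gprod ?K ((p, z), t) ((q, y), s) = ((p \<otimes> q, y), w p q y * t * s)"
    if "p \<in> carrier Q" "q \<in> carrier Q" "y \<in> X" for p z t q y s
    using that \<sigma> by (simp add: twisted_groupoid_def transformation_groupoid_def)
  have mult_circle: "z * z' \<in> circle" if "z \<in> circle" "z' \<in> circle" for z z'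
    using that by (simp add: norm_mult)
  have nz: "w p q y \<noteq> 0" if "p \<in> carrier Q" "q \<in> carrier Q" "y \<in> X" for p q y
    using circle[OF that] by auto
  \<comment> \<open>The cocycle identity for (1, 1, q), and below for (q, 1, 1): with a unit as one
    argument, the value depends only on the range point or the source point of the other
    arrow.\<close>
  have left: "w \<one> q x = w \<one> \<one> (act q x)" if "q \<in> carrier Q" "x \<in> X" for q x
    using cocycle[of \<one> \<one> q x] that nz[of \<one> q x] by simp
  have right: "w q \<one> x = w \<one> \<one> x" if "q \<in> carrier Q" "x \<in> X" for q x
    using cocycle[of q \<one> \<one> x] that nz[of q \<one> x] by (simp add: act_one)
  have cancel: "act (inv q) (act q x) = x" if "q \<in> carrier Q" "x \<in> X" for q x
    using act_mult[of "inv q" q x] that by (simp add: act_one)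
  \<comment> \<open>The cocycle identity for (q, inv q, q) with the unit values inserted. It equates
    the corrections that arise when inverting from the left and from the right.\<close>
  have balance: "w \<one> \<one> (act q x) * w q (inv q) (act q x) = w \<one> \<one> x * w (inv q) q x"
    if "q \<in> carrier Q" "x \<in> X" for q x
    using cocycle[of q "inv q" q x] that left[of q x] right[of q x] by simp
  \<comment> \<open>Solves \<open>w (inv q) q x * inv' q x t * t = cnj (w \<one> \<one> x)\<close>,
    the condition that inverse times arrow is the unit at x. All factors are unimodular, so
    conjugation inverts them.\<close>
  define inv' where "inv' q x t = cnj (t * w (inv q) q x * w \<one> \<one> x)" for q x t
  define i where "i = (\<lambda>((q, x), t). ((inv q, act q x), inv' q x t))"
  have i: "i ((q, x), t) = ((inv q, act q x), inv' q x t)" for q x t by (simp add: i_def)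
  have inv'_circle: "inv' q x t \<in> circle" if "q \<in> carrier Q" "x \<in> X" "t \<in> circle" for q x t
    using that circle[of "inv q" q x] circle[of \<one> \<one> x] by (simp add: inv'_def norm_mult)
  have inv': "w \<one> \<one> x * w (inv q) q x * t * inv' q x t = 1" if "q \<in> carrier Q" "x \<in> X" "t \<in> circle" for q x t
  proof -
    have "t * w (inv q) q x * w \<one> \<one> x \<in> circle"
      using that circle[of "inv q" q x] circle[of \<one> \<one> x] by (intro mult_circle) auto
    from circle_mult_cnj[OF this] show ?thesis by (simp add: inv'_def mult_ac)
  qed
  have assoc: "(gprod ?K \<gamma> \<eta>, \<zeta>) \<in> composable ?K \<and> (\<gamma>, gprod ?K \<eta> \<zeta>) \<in> composable ?K \<and>
      gprod ?K (gprod ?K \<gamma> \<eta>) \<zeta> = gprod ?K \<gamma> (gprod ?K \<eta> \<zeta>)"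
    if "(\<gamma>, \<eta>) \<in> composable ?K" "(\<eta>, \<zeta>) \<in> composable ?K" for \<gamma> \<eta> \<zeta>
  proof -
    obtain p x t q y s k z u where e: "\<gamma> = ((p, x), t)" "\<eta> = ((q, y), s)" "\<zeta> = ((k, z), u)"
      by (cases \<gamma>, cases "fst \<gamma>", cases \<eta>, cases "fst \<eta>", cases \<zeta>, cases "fst \<zeta>") auto
    have h: "p \<in> carrier Q" "q \<in> carrier Q" "k \<in> carrier Q" "y \<in> X" "z \<in> X" "x = act q y" "y = act k z"
        "t \<in> circle" "s \<in> circle" "u \<in> circle"
      using that act unfolding e comp by auto
    have c: "w p q y * t * s \<in> circle" "w q k z * s * u \<in> circle"
      using h circle by (auto simp: norm_mult)
    have "w (p \<otimes> q) k z * (w p q y * t * s) * u = (w (p \<otimes> q) k z * w p q (act k z)) * (t * s * u)"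
      by (simp add: h(7)[symmetric] mult_ac)
    also have "\<dots> = (w p (q \<otimes> k) z * w q k z) * (t * s * u)"
      using cocycle[OF h(1-3,5)] by simp
    also have "\<dots> = w p (q \<otimes> k) z * t * (w q k z * s * u)" by (simp add: mult_ac)
    finally show ?thesis
      unfolding e using h c by (simp add: prod comp act_mult m_assoc)
  qed
  have inv: "i \<gamma> \<in> arrows ?K \<and> i (i \<gamma>) = \<gamma> \<and> (\<gamma>, i \<gamma>) \<in> composable ?K \<and>
        (\<forall>\<eta>. (\<gamma>, \<eta>) \<in> composable ?K \<longrightarrow> gprod ?K (i \<gamma>) (gprod ?K \<gamma> \<eta>) = \<eta>) \<and>
        (\<forall>\<eta>. (\<eta>, \<gamma>) \<in> composable ?K \<longrightarrow> gprod ?K (gprod ?K \<eta> \<gamma>) (i \<gamma>) = \<eta>)"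
    if \<gamma>: "\<gamma> \<in> arrows ?K" for \<gamma>
  proof -
    obtain q x t where e: "\<gamma> = ((q, x), t)" by (cases \<gamma>, cases "fst \<gamma>") auto
    have h: "q \<in> carrier Q" "x \<in> X" "t \<in> circle" using \<gamma> unfolding e arr by auto
    note t' = inv'_circle[OF h]
    have ax: "act q x \<in> X" using act h by blast
    \<comment> \<open>By \<open>balance\<close>, t and the twice inverted scalar are inverse to the
      same number.\<close>
    have "inv' (inv q) (act q x) (inv' q x t) = t"
    proof -
      have "w \<one> \<one> (act q x) * w q (inv q) (act q x) * inv' q x t * inv' (inv q) (act q x) (inv' q x t) = 1"
        using inv'[of "inv q" "act q x" "inv' q x t"] h ax t' by simp
      then have "(w \<one> \<one> x * w (inv q) q x * inv' q x t) * inv' (inv q) (act q x) (inv' q x t) = 1"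
        using balance[OF h(1,2)] by simp
      moreover have "(w \<one> \<one> x * w (inv q) q x * inv' q x t) * t = 1"
        using inv'[OF h] by (simp add: mult_ac)
      moreover have "z' = t'" if "z * z' = 1" "z * t' = 1" for z z' t' :: complex
      proof -
        have "z \<noteq> 0" "z * z' = z * t'" using that by auto
        then show ?thesis by simp
      qed
      ultimately show ?thesis by blast
    qed
    then have ii: "i (i \<gamma>) = \<gamma>" unfolding e i using h cancel by simp
    have L: "gprod ?K (i \<gamma>) (gprod ?K \<gamma> \<eta>) = \<eta>" if "(\<gamma>, \<eta>) \<in> composable ?K" for \<eta>
    proof -
      obtain p y u where f: "\<eta> = ((p, y), u)" by (cases \<eta>, cases "fst \<eta>") auto
      have g: "p \<in> carrier Q" "y \<in> X" "x = act p y" "u \<in> circle" using that unfolding e f comp by auto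
      have "w (inv q) (q \<otimes> p) y * inv' q x t * (w q p y * t * u) =
          (w (inv q) (q \<otimes> p) y * w q p y) * (t * inv' q x t * u)" by (simp add: mult_ac)
      also have "w (inv q) (q \<otimes> p) y * w q p y = w \<one> \<one> x * w (inv q) q x"
        using cocycle[of "inv q" q p y] h g left[of p y] by simp
      also have "\<dots> * (t * inv' q x t * u) = u" using inv'[OF h] by (simp add: mult.assoc[symmetric])
      finally have val: "w (inv q) (q \<otimes> p) y * inv' q x t * (w q p y * t * u) = u" .
      have "inv q \<otimes> (q \<otimes> p) = p" using h g by (simp add: m_assoc[symmetric])
      then show ?thesis unfolding e f i using h g val by (simp add: prod)
    qed
    have R: "gprod ?K (gprod ?K \<eta> \<gamma>) (i \<gamma>) = \<eta>" if "(\<eta>, \<gamma>) \<in> composable ?K" for \<eta>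
    proof -
      obtain p z u where f: "\<eta> = ((p, z), u)" by (cases \<eta>, cases "fst \<eta>") auto
      have g: "p \<in> carrier Q" "z = act q x" "u \<in> circle" using that unfolding e f comp by auto
      have "w (p \<otimes> q) (inv q) z * (w p q x * u * t) * inv' q x t =
          (w (p \<otimes> q) (inv q) z * w p q x) * (t * inv' q x t * u)" by (simp add: mult_ac)
      also have "w (p \<otimes> q) (inv q) z * w p q x = w \<one> \<one> x * w (inv q) q x"
        using cocycle[of p q "inv q" z] h g ax right[of p z] balance[OF h(1,2)] cancel[OF h(1,2)] by simp
      also have "\<dots> * (t * inv' q x t * u) = u" using inv'[OF h] by (simp add: mult.assoc[symmetric])
      finally have val: "w (p \<otimes> q) (inv q) z * (w p q x * u * t) * inv' q x t = u" .
      have "(p \<otimes> q) \<otimes> inv q = p" using h g by (simp add: m_assoc)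
      then show ?thesis unfolding e f i using h g ax val by (simp add: prod)
    qed
    have "i \<gamma> \<in> arrows ?K" "(\<gamma>, i \<gamma>) \<in> composable ?K"
      unfolding e i arr comp using h ax t' cancel by auto
    then show ?thesis using ii L R by blast
  qed
  show ?thesis unfolding is_groupoid_def
  proof (intro conjI)
    show "composable ?K \<subseteq> arrows ?K \<times> arrows ?K"
      using act by (auto simp: twisted_groupoid_def transformation_groupoid_def)
    show "\<forall>(\<gamma>, \<eta>)\<in>composable ?K. gprod ?K \<gamma> \<eta> \<in> arrows ?K"
    proof clarify
      fix p x t q y s assume "(((p, x), t), ((q, y), s)) \<in> composable ?K"
      then have h: "p \<in> carrier Q" "q \<in> carrier Q" "y \<in> X" "t \<in> circle" "s \<in> circle"
        unfolding comp by auto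
      then show "gprod ?K ((p, x), t) ((q, y), s) \<in> arrows ?K"
        unfolding prod[OF h(1-3)] arr by (intro conjI mult_circle circle m_closed)
    qed
    show "\<forall>\<gamma> \<eta> \<zeta>. (\<gamma>, \<eta>) \<in> composable ?K \<and> (\<eta>, \<zeta>) \<in> composable ?K \<longrightarrow>
        (gprod ?K \<gamma> \<eta>, \<zeta>) \<in> composable ?K \<and> (\<gamma>, gprod ?K \<eta> \<zeta>) \<in> composable ?K \<and>
        gprod ?K (gprod ?K \<gamma> \<eta>) \<zeta> = gprod ?K \<gamma> (gprod ?K \<eta> \<zeta>)"
      by (intro allI impI, elim conjE, rule assoc)
  qed (rule exI[of _ i], rule ballI, rule inv)
qed

subsection \<open>The pair of a normal subgroup\<close>

lemma reduced_algebra_simps: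
  "carrier (reduced_algebra G c) = reduced_closure G c (carrier G)"
  "mult (reduced_algebra G c) = mult (bounded_op_algebra (carrier G))"
  "one (reduced_algebra G c) = one (bounded_op_algebra (carrier G))"
  "add (reduced_algebra G c) = add (bounded_op_algebra (carrier G))"
  "smult (reduced_algebra G c) = smult (bounded_op_algebra (carrier G))"
  "star (reduced_algebra G c) = star (bounded_op_algebra (carrier G))"
  by (simp_all add: reduced_algebra_def)

locale twisted_group_pair = twisted_group G c for G :: "('g, 'm) monoid_scheme" (structure) and c +
  fixes S :: "'g set"
  assumes normal: "S \<lhd> G" and abelian_symmetric: "abelian_symmetric_subgroup G c S"
begin

abbreviation A where "A \<equiv> reduced_algebra G c"
abbreviation B where "B \<equiv> reduced_closure G c S"
abbreviation Q where "Q \<equiv> G Mod S"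
abbreviation act where "act \<equiv> quotient_action G c S"

lemma S_subgroup: "subgroup S G" and S_subset: "S \<subseteq> carrier G"
  using normal normal_imp_subgroup subgroup.subset by blast+

text \<open>The identities come from bounded operators, the closure properties from density. The
  unit lies in B because it is \<open>\<delta> \<one>\<close> and S contains the neutral
  element.\<close>

sublocale pair: star_algebra_pair A B
proof -
  note whole = subgroup_self
  have bl: "T \<in> BL" if "T \<in> reduced_closure G c (carrier G)" for T
    using that reduced_closure_bounded by blast
  have bl': "T \<in> BL" if "T \<in> B" for T
    using that reduced_closure_bounded S_subset by blast
  note V = closed_op_space_reduced_closure[OF subset_refl] closed_op_space_reduced_closure[OF S_subset]
  have one: "\<one>\<^bsub>L\<^esub> \<in> B"
    using delta_closure[OF S_subset subgroup.one_closed[OF S_subgroup]] by (simp add: delta_one)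
  have BA: "B \<subseteq> reduced_closure G c (carrier G)" using S_subset by (intro reduced_closure_mono) auto
  show "star_algebra_pair A B"
    by unfold_locales
      (use one BA bl bl' in \<open>auto simp: reduced_algebra_simps op_mult_assoc op_one_mult op_mult_one
        op_star_star op_star_mult op_smult_mult op_mult_smult op_smult_smult op_one_smult op_star_smult
        op_mult_add op_add_mult
        intro: reduced_closure_mult[OF whole] reduced_closure_mult[OF S_subgroup]
          reduced_closure_star[OF whole] reduced_closure_star[OF S_subgroup]
          closed_op_space_add[OF V(1)] closed_op_space_add[OF V(2)]
          closed_op_space_smult[OF V(1)] closed_op_space_smult[OF V(2)]
          reduced_closure_commute[OF abelian_symmetric]\<close>)
qed

lemma delta_carrier [simp, intro]: "g \<in> carrier G \<Longrightarrow> \<delta> g \<in> carrier A"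
  by (simp add: reduced_algebra_simps delta_closure)

lemma delta_mult_A: "g \<in> carrier G \<Longrightarrow> h \<in> carrier G \<Longrightarrow> \<delta> g \<otimes>\<^bsub>A\<^esub> \<delta> h = c g h \<odot>\<^bsub>A\<^esub> \<delta> (g \<otimes> h)"
  by (simp add: reduced_algebra_simps delta_mult)

lemma delta_unitary: "g \<in> carrier G \<Longrightarrow> pair.unitary (\<delta> g)"
  unfolding pair.unitary_def by (simp add: delta_closure reduced_algebra_simps delta_star_mult delta_mult_star)

text \<open>One conjugation is \<open>reduced_closure_conj\<close>. The other reduces to it for inv
  g: up to scalars, the adjoint of \<open>\<delta> g\<close> is \<open>\<delta> (inv g)\<close> and
  \<open>\<delta> g\<close> is the adjoint of \<open>\<delta> (inv g)\<close>.\<close>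

lemma delta_normalizer [simp, intro]: assumes g: "g \<in> carrier G" shows "\<delta> g \<in> pair.N"
proof -
  have conj: "\<delta> h \<otimes>\<^bsub>A\<^esub> b \<otimes>\<^bsub>A\<^esub> star A (\<delta> h) \<in> B" if "h \<in> carrier G" "b \<in> B" for h b
    using reduced_closure_conj[OF normal that] by (simp add: reduced_algebra_simps)
  have "star A (\<delta> g) \<otimes>\<^bsub>A\<^esub> b \<otimes>\<^bsub>A\<^esub> \<delta> g \<in> B" if b: "b \<in> B" for b
  proof -
    have s: "star A (\<delta> g) = cnj (c g (inv g)) \<odot>\<^bsub>A\<^esub> \<delta> (inv g)"
      using g by (simp add: reduced_algebra_simps delta_star)
    have s': "star A (\<delta> (inv g)) = cnj (c (inv g) g) \<odot>\<^bsub>A\<^esub> \<delta> g"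
      using g by (simp add: reduced_algebra_simps delta_star)
    have "\<delta> g = c (inv g) g \<odot>\<^bsub>A\<^esub> star A (\<delta> (inv g))"
      unfolding s' using g circle_mult_cnj[OF cocycle_circle[of "inv g" g]]
      by (simp add: pair.smult_smult pair.one_smult)
    then have "star A (\<delta> g) \<otimes>\<^bsub>A\<^esub> b \<otimes>\<^bsub>A\<^esub> \<delta> g =
        (cnj (c g (inv g)) \<odot>\<^bsub>A\<^esub> \<delta> (inv g)) \<otimes>\<^bsub>A\<^esub> b \<otimes>\<^bsub>A\<^esub> (c (inv g) g \<odot>\<^bsub>A\<^esub> star A (\<delta> (inv g)))"
      unfolding s by simp
    also have "\<dots> = (cnj (c g (inv g)) * c (inv g) g) \<odot>\<^bsub>A\<^esub> (\<delta> (inv g) \<otimes>\<^bsub>A\<^esub> b \<otimes>\<^bsub>A\<^esub> star A (\<delta> (inv g)))"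
      using g b by (simp add: pair.smult_mult pair.mult_smult pair.smult_smult mult_ac)
    finally show ?thesis using conj[of "inv g" b] g b by simp
  qed
  then show ?thesis unfolding normalizers_def using conj[OF g] delta_carrier[OF g] by blast
qed

lemma delta_dom [simp, intro]: "g \<in> carrier G \<Longrightarrow> x \<in> pair.X \<Longrightarrow> x \<in> pair.dom (\<delta> g)"
  using pair.unitary_dom delta_unitary by blast

lemma delta_sub: "s \<in> S \<Longrightarrow> \<delta> s \<in> B"
  using delta_closure[OF S_subset] .

lemma delta_factor:
  assumes "g \<in> carrier G" "s \<in> S"
  shows "\<delta> (g \<otimes> s) = cnj (c g s) \<odot>\<^bsub>A\<^esub> (\<delta> g \<otimes>\<^bsub>A\<^esub> \<delta> s)"
proof -
  have s: "s \<in> carrier G" using assms S_subset by blast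
  show ?thesis
    using assms s circle_cnj_mult[OF cocycle_circle[OF assms(1) s]]
    by (simp add: delta_mult_A pair.smult_smult pair.one_smult)
qed

lemma scalar_dom_move:
  assumes "z \<in> circle" "g \<in> carrier G" "x \<in> pair.X"
  shows "x \<in> pair.dom (z \<odot>\<^bsub>A\<^esub> \<delta> g)" and "pair.move (z \<odot>\<^bsub>A\<^esub> \<delta> g) x = pair.move (\<delta> g) x"
  using pair.weyl_action_germ(1,2)[of "\<delta> g" x z] assms by auto

lemma move_delta_X [simp, intro]: "g \<in> carrier G \<Longrightarrow> x \<in> pair.X \<Longrightarrow> pair.move (\<delta> g) x \<in> pair.X"
  using pair.move_character by blast

text \<open>The product of \<open>\<delta> g\<close> and \<open>\<delta> h\<close> differs from
  \<open>\<delta> (g \<otimes> h)\<close> by a unimodular scalar, which does not affect the moved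
  point.\<close>

lemma move_delta_mult:
  assumes "g \<in> carrier G" "h \<in> carrier G" "x \<in> pair.X"
  shows "pair.move (\<delta> (g \<otimes> h)) x = pair.move (\<delta> g) (pair.move (\<delta> h) x)"
proof -
  have "pair.move (\<delta> g) (pair.move (\<delta> h) x) = pair.move (\<delta> g \<otimes>\<^bsub>A\<^esub> \<delta> h) x"
    using assms by (intro pair.move_mult(2)[symmetric]) auto
  also have "\<dots> = pair.move (\<delta> (g \<otimes> h)) x"
    using assms scalar_dom_move(2)[OF cocycle_circle] by (simp add: delta_mult_A)
  finally show ?thesis by simp
qed

text \<open>A unitary of B has the germ of a scalar multiple of 1. This is why the action depends
  only on cosets.\<close>

lemma move_delta_sub: assumes "s \<in> S" "x \<in> pair.X" shows "pair.move (\<delta> s) x = x"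
proof -
  have s: "s \<in> carrier G" using assms S_subset by blast
  have one: "\<one>\<^bsub>A\<^esub> \<otimes>\<^bsub>A\<^esub> \<delta> s = \<delta> s" using s by simp
  have N: "\<one>\<^bsub>A\<^esub> \<in> pair.N" by (rule pair.normalizerI) auto
  have "x \<in> pair.dom \<one>\<^bsub>A\<^esub>" using assms pair.unitary_dom[of "\<one>\<^bsub>A\<^esub>"] by (simp add: pair.unitary_def)
  then show ?thesis
    using pair.germ_unitary(2)[OF N, of x "\<delta> s"] assms s delta_unitary[OF s] delta_sub
    by (simp add: one pair.move_one)
qed

text \<open>The quotient is made of right cosets; normality turns them into left cosets, so that the
  factor from S stands on the right, where it acts first and trivially.\<close>

lemma coset_factor:
  assumes "q \<in> carrier Q" "g \<in> q" "h \<in> q"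
  obtains s where "s \<in> S" "g = h \<otimes> s"
proof -
  obtain a where a: "a \<in> carrier G" "q = S #> a"
    using assms(1) by (auto simp: FactGroup_def RCOSETS_def)
  have "q = a <# S" using a normal.coset_eq[OF normal] by blast
  then obtain s t where st: "s \<in> S" "t \<in> S" "g = a \<otimes> s" "h = a \<otimes> t"
    using assms by (auto simp: l_coset_def)
  have car: "s \<in> carrier G" "t \<in> carrier G" using st S_subset by auto
  have "t \<otimes> (inv t \<otimes> s) = (t \<otimes> inv t) \<otimes> s" using car by (intro m_assoc[symmetric]) auto
  then have "g = h \<otimes> (inv t \<otimes> s)" using st(3,4) a(1) car by (simp add: m_assoc)
  moreover have "inv t \<otimes> s \<in> S"
    using st S_subgroup by (simp add: subgroup.m_closed subgroup.m_inv_closed)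
  ultimately show thesis using that by blast
qed

lemma coset_subset: "q \<in> carrier Q \<Longrightarrow> q \<subseteq> carrier G"
  using S_subset by (auto simp: FactGroup_def RCOSETS_def r_coset_def)

text \<open>The definite description asks for equality of whole maps, domains included. Since the
  \<open>\<delta> g\<close> are unitary, each domain is the full spectrum.\<close>

lemma quotient_action_eq:
  assumes q: "q \<in> carrier Q" and g: "g \<in> q" and x: "x \<in> pair.X"
  shows "act q x = pair.move (\<delta> g) x"
proof -
  have gG: "g \<in> carrier G" using coset_subset[OF q] g by blast
  have dom: "pair.dom (\<delta> h) = pair.X" if "h \<in> carrier G" for h
  proof (rule equalityI; rule subsetI)
    show "x \<in> pair.X" if "x \<in> pair.dom (\<delta> h)" for x using pair.dom_character[OF that] .
    show "x \<in> pair.dom (\<delta> h)" if "x \<in> pair.X" for x using delta_dom[OF \<open>h \<in> carrier G\<close> that] .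
  qed
  have eq: "weyl_map A B (\<delta> h) = weyl_map A B (\<delta> g)" if h: "h \<in> q" for h
  proof -
    have hG: "h \<in> carrier G" using coset_subset[OF q] h by blast
    obtain s where s: "s \<in> S" "h = g \<otimes> s" using coset_factor[OF q h g] .
    have sG: "s \<in> carrier G" using s S_subset by blast
    have "pair.move (\<delta> h) x = pair.move (\<delta> g) x" if "x \<in> pair.X" for x
      unfolding s(2) move_delta_mult[OF gG sG that] move_delta_sub[OF s(1) that] ..
    then show ?thesis
      unfolding pair.weyl_map_eq[OF delta_normalizer[OF hG]] pair.weyl_map_eq[OF delta_normalizer[OF gG]]
        dom[OF hG] dom[OF gG] by (intro restrict_ext)
  qed
  have "act q = weyl_map A B (\<delta> g)"
    unfolding quotient_action_def
  proof (rule the_equality)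
    show "\<forall>h\<in>q. weyl_map A B (\<delta> g) = weyl_map A B (\<delta> h)" using eq by metis
    show "\<alpha> = weyl_map A B (\<delta> g)" if "\<forall>h\<in>q. \<alpha> = weyl_map A B (\<delta> h)" for \<alpha>
      using that g by blast
  qed
  then show ?thesis using gG x by simp
qed

end

locale twisted_group_section = twisted_group_pair G c S
  for G :: "('g, 'm) monoid_scheme" (structure) and c S +
  fixes r :: "'g set \<Rightarrow> 'g"
  assumes representative: "q \<in> carrier (G Mod S) \<Longrightarrow> r q \<in> q"
begin

section \<open>Unitaries comparing products of coset representatives\<close>

definition W :: "'g set \<Rightarrow> 'g set \<Rightarrow> 'g l2_op" where
  "W p q = star A (\<delta> (r (p \<otimes>\<^bsub>Q\<^esub> q))) \<otimes>\<^bsub>A\<^esub> \<delta> (r p) \<otimes>\<^bsub>A\<^esub> \<delta> (r q)"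

declare mult_FactGroup [simp del]

interpretation quotient: group Q
  using normal.factorgroup_is_group[OF normal] .

lemma representative_closed [simp, intro]: "q \<in> carrier Q \<Longrightarrow> r q \<in> carrier G"
  using representative coset_subset by blast

lemma representative_mult:
  assumes "p \<in> carrier Q" "q \<in> carrier Q" shows "r p \<otimes> r q \<in> p \<otimes>\<^bsub>Q\<^esub> q"
  using assms representative by (auto simp: mult_FactGroup set_mult_def)

lemma quotient_action_representative:
  "q \<in> carrier Q \<Longrightarrow> x \<in> pair.X \<Longrightarrow> act q x = pair.move (\<delta> (r q)) x"
  using quotient_action_eq representative by blast

lemma W_unitary: assumes "p \<in> carrier Q" "q \<in> carrier Q" shows "pair.unitary (W p q)"
  unfolding W_def using assms
  by (intro pair.unitary_mult pair.unitary_star delta_unitary representative_closed quotient.m_closed)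

text \<open>The product of the representatives of p and q lies in the same coset as the
  representative of the product, so they differ by some s in S on the right, and
  \<open>W p q\<close> is a scalar multiple of \<open>\<delta> s\<close>.\<close>

lemma W_sub: assumes p: "p \<in> carrier Q" and q: "q \<in> carrier Q" shows "W p q \<in> B"
proof -
  let ?k = "r (p \<otimes>\<^bsub>Q\<^esub> q)"
  have pq: "p \<otimes>\<^bsub>Q\<^esub> q \<in> carrier Q" using p q by simp
  have car: "r p \<in> carrier G" "r q \<in> carrier G" "?k \<in> carrier G" using p q pq by auto
  obtain s where s: "s \<in> S" "r p \<otimes> r q = ?k \<otimes> s"
    using coset_factor[OF pq representative_mult[OF p q] representative[OF pq]] .
  have sG: "s \<in> carrier G" using s S_subset by blast
  have "W p q = star A (\<delta> ?k) \<otimes>\<^bsub>A\<^esub> (\<delta> (r p) \<otimes>\<^bsub>A\<^esub> \<delta> (r q))"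
    unfolding W_def using car by (simp add: pair.m_assoc)
  also have "\<dots> = (c (r p) (r q) * cnj (c ?k s)) \<odot>\<^bsub>A\<^esub> ((star A (\<delta> ?k) \<otimes>\<^bsub>A\<^esub> \<delta> ?k) \<otimes>\<^bsub>A\<^esub> \<delta> s)"
    unfolding delta_mult_A[OF car(1,2)] s(2) delta_factor[OF car(3) s(1)]
    using car sG by (simp add: pair.mult_smult pair.smult_smult pair.m_assoc)
  also have "\<dots> = (c (r p) (r q) * cnj (c ?k s)) \<odot>\<^bsub>A\<^esub> \<delta> s"
    using delta_unitary[OF car(3)] sG by (simp add: pair.unitary_def)
  finally show ?thesis using delta_sub[OF s(1)] by simp
qed

lemma delta_mult_W:
  assumes "p \<in> carrier Q" "q \<in> carrier Q"
  shows "\<delta> (r p) \<otimes>\<^bsub>A\<^esub> \<delta> (r q) = \<delta> (r (p \<otimes>\<^bsub>Q\<^esub> q)) \<otimes>\<^bsub>A\<^esub> W p q"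
proof -
  let ?k = "r (p \<otimes>\<^bsub>Q\<^esub> q)"
  have car: "r p \<in> carrier G" "r q \<in> carrier G" "?k \<in> carrier G" using assms by auto
  have "\<delta> ?k \<otimes>\<^bsub>A\<^esub> W p q = (\<delta> ?k \<otimes>\<^bsub>A\<^esub> star A (\<delta> ?k)) \<otimes>\<^bsub>A\<^esub> (\<delta> (r p) \<otimes>\<^bsub>A\<^esub> \<delta> (r q))"
    unfolding W_def using car by (simp add: pair.m_assoc)
  then show ?thesis using delta_unitary[OF car(3)] car by (simp add: pair.unitary_def)
qed

lemma W_cocycle:
  assumes "p \<in> carrier Q" "q \<in> carrier Q" "k \<in> carrier Q" and y: "y \<in> pair.X"
  shows "y (W (p \<otimes>\<^bsub>Q\<^esub> q) k) * act k y (W p q) = y (W p (q \<otimes>\<^bsub>Q\<^esub> k)) * y (W q k)"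
proof -
  let ?pq = "p \<otimes>\<^bsub>Q\<^esub> q" and ?qk = "q \<otimes>\<^bsub>Q\<^esub> k" and ?pqk = "p \<otimes>\<^bsub>Q\<^esub> q \<otimes>\<^bsub>Q\<^esub> k"
  have assoc: "p \<otimes>\<^bsub>Q\<^esub> ?qk = ?pqk" using assms by (simp add: quotient.m_assoc)
  have in_Q: "?pq \<in> carrier Q" "?qk \<in> carrier Q" "?pqk \<in> carrier Q" using assms by auto
  let ?d = "\<lambda>q. \<delta> (r q)"
  \<comment> \<open>What \<open>W p q\<close> becomes when \<open>\<delta> (r k)\<close> is pulled
    out to its left. Its value at y is the value of \<open>W p q\<close> at \<open>act k y\<close>,
    with denominator 1 by unitarity; this is where the moved point in the cocycle identity comes
    from.\<close>
  let ?V = "star A (?d k) \<otimes>\<^bsub>A\<^esub> (W p q \<otimes>\<^bsub>A\<^esub> ?d k)"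
  have d: "?d p \<in> carrier A" "?d q \<in> carrier A" "?d k \<in> carrier A" "?d ?pq \<in> carrier A" "?d ?pqk \<in> carrier A"
    using assms in_Q by auto
  have WB: "W p q \<in> B" "W ?pq k \<in> B" "W p ?qk \<in> B" "W q k \<in> B" using assms in_Q W_sub by auto
  have VB: "?V \<in> B" using pair.normalizer_conj[OF _ WB(1)] assms by auto
  have u: "?d k \<otimes>\<^bsub>A\<^esub> star A (?d k) = \<one>\<^bsub>A\<^esub>" "star A (?d ?pqk) \<otimes>\<^bsub>A\<^esub> ?d ?pqk = \<one>\<^bsub>A\<^esub>"
    using delta_unitary assms in_Q by (auto simp: pair.unitary_def)
  have "(?d p \<otimes>\<^bsub>A\<^esub> ?d q) \<otimes>\<^bsub>A\<^esub> ?d k = ?d ?pq \<otimes>\<^bsub>A\<^esub> (\<one>\<^bsub>A\<^esub> \<otimes>\<^bsub>A\<^esub> (W p q \<otimes>\<^bsub>A\<^esub> ?d k))"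
    unfolding delta_mult_W[OF assms(1,2)] using d WB by (simp add: pair.m_assoc)
  also have "\<dots> = (?d ?pq \<otimes>\<^bsub>A\<^esub> ?d k) \<otimes>\<^bsub>A\<^esub> ?V"
    unfolding u(1)[symmetric] using d WB by (simp add: pair.m_assoc)
  also have "\<dots> = ?d ?pqk \<otimes>\<^bsub>A\<^esub> (W ?pq k \<otimes>\<^bsub>A\<^esub> ?V)"
    unfolding delta_mult_W[OF in_Q(1) assms(3)] using d WB VB by (simp add: pair.m_assoc)
  finally have lhs: "(?d p \<otimes>\<^bsub>A\<^esub> ?d q) \<otimes>\<^bsub>A\<^esub> ?d k = ?d ?pqk \<otimes>\<^bsub>A\<^esub> (W ?pq k \<otimes>\<^bsub>A\<^esub> ?V)" .
  have "?d p \<otimes>\<^bsub>A\<^esub> (?d q \<otimes>\<^bsub>A\<^esub> ?d k) = (?d p \<otimes>\<^bsub>A\<^esub> ?d ?qk) \<otimes>\<^bsub>A\<^esub> W q k"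
    unfolding delta_mult_W[OF assms(2,3)] using d WB in_Q by (simp add: pair.m_assoc)
  also have "\<dots> = ?d ?pqk \<otimes>\<^bsub>A\<^esub> (W p ?qk \<otimes>\<^bsub>A\<^esub> W q k)"
    unfolding delta_mult_W[OF assms(1) in_Q(2)] assoc using d WB by (simp add: pair.m_assoc)
  finally have "?d ?pqk \<otimes>\<^bsub>A\<^esub> (W ?pq k \<otimes>\<^bsub>A\<^esub> ?V) = ?d ?pqk \<otimes>\<^bsub>A\<^esub> (W p ?qk \<otimes>\<^bsub>A\<^esub> W q k)"
    using lhs d by (simp add: pair.m_assoc)
  then have "(star A (?d ?pqk) \<otimes>\<^bsub>A\<^esub> ?d ?pqk) \<otimes>\<^bsub>A\<^esub> (W ?pq k \<otimes>\<^bsub>A\<^esub> ?V) =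
      (star A (?d ?pqk) \<otimes>\<^bsub>A\<^esub> ?d ?pqk) \<otimes>\<^bsub>A\<^esub> (W p ?qk \<otimes>\<^bsub>A\<^esub> W q k)"
    using d(5) pair.sub_closed[OF pair.sub_mult[OF WB(2) VB]] pair.sub_closed[OF pair.sub_mult[OF WB(3,4)]]
    by (simp only: pair.m_assoc pair.star_closed)
  then have "W ?pq k \<otimes>\<^bsub>A\<^esub> ?V = W p ?qk \<otimes>\<^bsub>A\<^esub> W q k"
    unfolding u(2) using pair.sub_mult[OF WB(2) VB] pair.sub_mult[OF WB(3,4)] by simp
  then have "y (W ?pq k) * y ?V = y (W p ?qk) * y (W q k)"
    using pair.character_mult[OF y WB(2) VB] pair.character_mult[OF y WB(3,4)] by simp
  moreover have "act k y (W p q) = y ?V"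
    using pair.move_apply[OF WB(1), of y "?d k"] delta_unitary[of "r k"] pair.character_one[OF y]
      quotient_action_representative[OF assms(3) y] assms
    by (simp add: pair.unitary_def delta_dom)
  ultimately show ?thesis by simp
qed

text \<open>A character has modulus 1 on a unitary, so the normalization in the cocycle divides by
  1.\<close>

lemma quotient_cocycle_eq:
  assumes "p \<in> carrier Q" "q \<in> carrier Q" "y \<in> pair.X"
  shows "quotient_cocycle G c S r (p, z) (q, y) = y (W p q)"
proof -
  have "cmod (y (W p q)) = 1"
    using pair.character_unitary(1)[OF W_unitary W_sub assms(3)] assms by simp
  then show ?thesis by (simp add: quotient_cocycle_def W_def Let_def)
qed

lemma is_groupoid_domain:
  "is_groupoid (twisted_groupoid (quotient_groupoid G c S) (quotient_cocycle G c S r))"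
  unfolding quotient_groupoid_def
proof (rule is_groupoid_twisted_transformation[where w="\<lambda>p q y. y (W p q)"])
  show "group Q" by (rule quotient.group_axioms)
  show "act q x \<in> pair.X" if "q \<in> carrier Q" "x \<in> pair.X" for q x
    using that quotient_action_representative by auto
  show "act \<one>\<^bsub>Q\<^esub> x = x" if x: "x \<in> pair.X" for x
  proof -
    \<comment> \<open>The trivial coset is S, and its action is computed with the neutral element in
      place of the representative, which may differ from it.\<close>
    have "\<one> \<in> \<one>\<^bsub>Q\<^esub>" using S_subgroup by (simp add: FactGroup_def subgroup.one_closed)
    then have "act \<one>\<^bsub>Q\<^esub> x = pair.move (\<delta> \<one>) x" using quotient_action_eq x by blast
    then show ?thesis using move_delta_sub[OF subgroup.one_closed[OF S_subgroup] x] by simp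
  qed
  show "act (p \<otimes>\<^bsub>Q\<^esub> q) x = act p (act q x)" if pq: "p \<in> carrier Q" "q \<in> carrier Q" and x: "x \<in> pair.X" for p q x
  proof -
    \<comment> \<open>The product of the two representatives serves as an element of the product
      coset, so no comparison with its chosen representative is needed.\<close>
    have "act (p \<otimes>\<^bsub>Q\<^esub> q) x = pair.move (\<delta> (r p \<otimes> r q)) x"
      by (rule quotient_action_eq[OF quotient.m_closed[OF pq] representative_mult[OF pq] x])
    also have "\<dots> = pair.move (\<delta> (r p)) (pair.move (\<delta> (r q)) x)"
      using pq x by (intro move_delta_mult) auto
    finally show ?thesis using pq x by (simp add: quotient_action_representative move_delta_X)
  qed
  show "quotient_cocycle G c S r (p, z) (q, y) = y (W p q)"
    if "p \<in> carrier Q" "q \<in> carrier Q" "y \<in> pair.X" for p z q y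
    by (rule quotient_cocycle_eq[OF that])
  show "y (W p q) \<in> circle" if "p \<in> carrier Q" "q \<in> carrier Q" "y \<in> pair.X" for p q y
    using pair.character_unitary(1)[OF W_unitary W_sub that(3)] that by blast
qed (rule W_cocycle)

lemma twist_map_eq:
  assumes "q \<in> carrier Q" "x \<in> pair.X" "t \<in> circle"
  shows "twist_map G c S r ((q, x), t) = pair.germ (t \<odot>\<^bsub>A\<^esub> \<delta> (r q)) x"
proof -
  have "act q x = weyl_map A B (t \<odot>\<^bsub>A\<^esub> \<delta> (r q)) x"
    using assms scalar_dom_move[OF assms(3) _ assms(2)] by (simp add: quotient_action_representative)
  then show ?thesis by (simp add: twist_map_def pair.germ_def Let_def)
qed

lemma arrows_domain:
  "\<gamma> \<in> arrows (twisted_groupoid (quotient_groupoid G c S) \<sigma>) \<longleftrightarrow>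
    (\<exists>q x t. \<gamma> = ((q, x), t) \<and> q \<in> carrier Q \<and> x \<in> pair.X \<and> t \<in> circle)"
  by (auto simp: twisted_groupoid_def quotient_groupoid_def transformation_groupoid_def)

lemma groupoid_hom_twist_map:
  "groupoid_hom (twisted_groupoid (quotient_groupoid G c S) (quotient_cocycle G c S r))
     (weyl_twist A B) (twist_map G c S r)"
proof -
  let ?K = "twisted_groupoid (quotient_groupoid G c S) (quotient_cocycle G c S r)"
  have arrow: "twist_map G c S r \<in> arrows ?K \<rightarrow> arrows (weyl_twist A B)"
  proof
    fix \<gamma> assume "\<gamma> \<in> arrows ?K"
    then obtain q x t where h: "\<gamma> = ((q, x), t)" "q \<in> carrier Q" "x \<in> pair.X" "t \<in> circle"
      unfolding arrows_domain by blast
    have "t \<odot>\<^bsub>A\<^esub> \<delta> (r q) \<in> pair.N" "x \<in> pair.dom (t \<odot>\<^bsub>A\<^esub> \<delta> (r q))"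
      using h scalar_dom_move(1) by auto
    then show "twist_map G c S r \<gamma> \<in> arrows (weyl_twist A B)"
      unfolding h(1) twist_map_eq[OF h(2-4)] pair.arrows_weyl_twist 
      by - (rule CollectI, rule exI, rule exI, rule conjI[OF refl conjI])
  qed
  have mult: "(twist_map G c S r \<gamma>, twist_map G c S r \<eta>) \<in> composable (weyl_twist A B) \<and>
      twist_map G c S r (gprod ?K \<gamma> \<eta>) = gprod (weyl_twist A B) (twist_map G c S r \<gamma>) (twist_map G c S r \<eta>)"
    if c: "(\<gamma>, \<eta>) \<in> composable ?K" for \<gamma> \<eta>
  proof -
    obtain p t q y s where e: "\<gamma> = ((p, act q y), t)" "\<eta> = ((q, y), s)"
      and h: "p \<in> carrier Q" "q \<in> carrier Q" "y \<in> pair.X" "t \<in> circle" "s \<in> circle"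
      using c by (auto simp: twisted_groupoid_def quotient_groupoid_def transformation_groupoid_def)
    let ?m = "s \<odot>\<^bsub>A\<^esub> \<delta> (r q)" and ?n = "t \<odot>\<^bsub>A\<^esub> \<delta> (r p)" and ?k = "r (p \<otimes>\<^bsub>Q\<^esub> q)"
    have pq: "p \<otimes>\<^bsub>Q\<^esub> q \<in> carrier Q" using h by simp
    have car: "r p \<in> carrier G" "r q \<in> carrier G" "?k \<in> carrier G" using h pq by auto
    have N: "?n \<in> pair.N" "?m \<in> pair.N" using car by auto
    have act: "act q y = pair.move ?m y"
      using quotient_action_representative[OF h(2,3)] scalar_dom_move(2)[OF h(5) car(2) h(3)] by simp
    have aX: "act q y \<in> pair.X" using quotient_action_representative[OF h(2,3)] car h by auto
    have dom: "y \<in> pair.dom ?m" "pair.move ?m y \<in> pair.dom ?n"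
      using scalar_dom_move(1)[OF h(5) car(2) h(3)] scalar_dom_move(1)[OF h(4) car(1) aX] act by auto
    have img: "twist_map G c S r \<gamma> = pair.germ ?n (pair.move ?m y)" "twist_map G c S r \<eta> = pair.germ ?m y"
      unfolding e using twist_map_eq[OF h(1) aX h(4)] twist_map_eq[OF h(2,3,5)] act by auto
    have comp: "(twist_map G c S r \<gamma>, twist_map G c S r \<eta>) \<in> composable (weyl_twist A B)"
      unfolding img by (subst pair.composable_weyl_twist_iff) (use N dom in auto)
    let ?l = "(t * s) \<odot>\<^bsub>A\<^esub> \<delta> ?k" and ?w = "W p q"
    have w: "pair.unitary ?w" "?w \<in> B" "y ?w \<in> circle"
      using W_unitary[OF h(1,2)] W_sub[OF h(1,2)] pair.character_unitary(1)[OF _ _ h(3)] by auto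
    have ts: "t * s \<in> circle" using h by (simp add: norm_mult)
    \<comment> \<open>The discrepancy \<open>W p q\<close> is kept at the right end, where
      evaluation at y turns it into the scalar of the cocycle.\<close>
    have prod: "?n \<otimes>\<^bsub>A\<^esub> ?m = ?l \<otimes>\<^bsub>A\<^esub> ?w"
      using car w(2) by (simp add: pair.smult_mult pair.mult_smult pair.smult_smult delta_mult_W[OF h(1,2)]
          mult.commute[of s t])
    have l: "?l \<in> pair.N" "y \<in> pair.dom ?l" using car scalar_dom_move(1)[OF ts car(3) h(3)] by auto
    have "y \<in> pair.dom (?n \<otimes>\<^bsub>A\<^esub> ?m)" by (rule pair.move_mult(1)[OF N dom])
    then have lw: "y \<in> pair.dom (?l \<otimes>\<^bsub>A\<^esub> ?w)" unfolding prod .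
    have "gprod (weyl_twist A B) (twist_map G c S r \<gamma>) (twist_map G c S r \<eta>) = pair.germ (?l \<otimes>\<^bsub>A\<^esub> ?w) y"
      unfolding img pair.gprod_weyl_twist[OF N dom] prod ..
    also have "\<dots> = pair.germ (y ?w \<odot>\<^bsub>A\<^esub> ?l) y"
      by (rule pair.germ_unitary(1)[OF l lw w(1,2)])
    also have "y ?w \<odot>\<^bsub>A\<^esub> ?l = (y ?w * t * s) \<odot>\<^bsub>A\<^esub> \<delta> ?k"
      using car by (simp add: pair.smult_smult mult.assoc)
    also have "pair.germ ((y ?w * t * s) \<odot>\<^bsub>A\<^esub> \<delta> ?k) y = twist_map G c S r ((p \<otimes>\<^bsub>Q\<^esub> q, y), y ?w * t * s)"
      using w(3) h by (intro twist_map_eq[OF pq h(3), symmetric]) (simp add: norm_mult)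
    also have "((p \<otimes>\<^bsub>Q\<^esub> q, y), y ?w * t * s) = gprod ?K \<gamma> \<eta>"
      unfolding e using quotient_cocycle_eq[OF h(1-3)]
      by (simp add: twisted_groupoid_def quotient_groupoid_def transformation_groupoid_def)
    finally show ?thesis using comp by simp
  qed
  show ?thesis
    unfolding groupoid_hom_def
  proof (intro conjI ballI is_groupoid_domain pair.is_groupoid_weyl_twist arrow)
    fix \<xi> assume "\<xi> \<in> composable ?K"
    then show "case \<xi> of (\<gamma>, \<eta>) \<Rightarrow>
        (twist_map G c S r \<gamma>, twist_map G c S r \<eta>) \<in> composable (weyl_twist A B) \<and>
        twist_map G c S r (gprod ?K \<gamma> \<eta>) = gprod (weyl_twist A B) (twist_map G c S r \<gamma>) (twist_map G c S r \<eta>)"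
      using mult[of "fst \<xi>" "snd \<xi>"] by (simp add: split_beta)
  qed
qed

text \<open>Both sides are the germ at x of \<open>\<delta> (r q)\<close> scaled by the product of
  the two scalars.\<close>

lemma twist_map_equivariant:
  assumes \<nu>: "\<nu> \<in> circle" and "\<gamma> \<in> arrows (twisted_groupoid (quotient_groupoid G c S) \<sigma>)"
  shows "twist_map G c S r (twisted_action \<nu> \<gamma>) = weyl_action A B \<nu> (twist_map G c S r \<gamma>)"
proof -
  obtain q x t where h: "\<gamma> = ((q, x), t)" "q \<in> carrier Q" "x \<in> pair.X" "t \<in> circle"
    using assms(2) unfolding arrows_domain by blast
  have m: "t \<odot>\<^bsub>A\<^esub> \<delta> (r q) \<in> pair.N" "x \<in> pair.dom (t \<odot>\<^bsub>A\<^esub> \<delta> (r q))"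
    using h scalar_dom_move(1) by auto
  have "\<nu> * t \<in> circle" using \<nu> h by (simp add: norm_mult)
  then show ?thesis
    unfolding h(1) twisted_action_def prod.case
    using twist_map_eq[OF h(2,3)] h(2,4) pair.weyl_action_germ(3)[OF m \<nu>]
    by (simp add: pair.smult_smult)
qed

end

theorem theorem5p7:
  fixes G :: "('g, 'm) monoid_scheme"
    and c :: "'g \<Rightarrow> 'g \<Rightarrow> complex"
    and S :: "'g set"
    and r :: "'g set \<Rightarrow> 'g"
  assumes "group G"
    and "countable (carrier G)"
    and "group_cocycle G c"
    and "maximal_abelian_symmetric G c S"
    and "S \<lhd> G"
    and "immediately_centralizing G S"
    and "topologically_free (G Mod S)
           (spectrum_topology (reduced_algebra G c) (reduced_closure G c S))
           (quotient_action G c S)"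
    and "\<forall>q\<in>carrier (G Mod S). r q \<in> q"
  shows "groupoid_hom
           (twisted_groupoid (quotient_groupoid G c S) (quotient_cocycle G c S r))
           (weyl_twist (reduced_algebra G c) (reduced_closure G c S))
           (twist_map G c S r) \<and>
         (\<forall>\<nu>\<in>circle.
            \<forall>\<gamma>\<in>arrows (twisted_groupoid (quotient_groupoid G c S) (quotient_cocycle G c S r)).
              twist_map G c S r (twisted_action \<nu> \<gamma>) =
                weyl_action (reduced_algebra G c) (reduced_closure G c S) \<nu> (twist_map G c S r \<gamma>))"
proof -
  interpret twisted_group_section G c S r
  proof (intro twisted_group_section.intro twisted_group_pair.intro twisted_group.intro
      twisted_group_axioms.intro twisted_group_pair_axioms.intro twisted_group_section_axioms.intro)
    show "group G" "group_cocycle G c" "S \<lhd> G" by fact+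
    show "abelian_symmetric_subgroup G c S"
      using assms(4) by (simp add: maximal_abelian_symmetric_def)
    show "r q \<in> q" if "q \<in> carrier (G Mod S)" for q
      using assms(8) that by blast
  qed
  show ?thesis by (intro conjI ballI groupoid_hom_twist_map twist_map_equivariant)
qed

end
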